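(* Assume that $F:C_\mu\to H$ is globally Lipschitz continuous; that $G$ maps $C_\mu$ into $L(U;D((-A)^\nu))$ for some $\nu\in(0,1)$ and is Lipschitz continuous, $\|G(x)-G(y)\|_{L(U;D((-A)^\nu))}\le L_{G,\nu}\|x-y\|_\mu$ for $x,y\in C_\mu$; and that there is a Lipschitz continuous map $K:C_\mu\to L(U;H)$ such that for every $T>0$ and every $u\in C([-\mu,T];H)$ the mapping $t\mapsto G(u_t)$ belongs to $C^1([0,T];L(U;H))$ with $\frac{d}{dt}G(u_t)=K(u_t)$. For $\xi\in C_\mu$, $\omega\in\Omega$ let $u$ be the global mild solution with initial function $\xi$ and noise path $\omega$. Then $\phi:\mathbb{R}^+\times\Omega\times C_\mu\to C_\mu$, $\phi(t,\omega,\xi)=u_t$, i.e. $$\phi(t,\omega,\xi)(s)=S(t+s)\xi(0)+\int_0^{t+s}S(t+s-r)F(u_r)\,dr+G(u_{t+s})\omega(t+s)+\int_0^{t+s}AS(t+s-r)G(u_r)\omega(r)\,dr-\int_0^{t+s}S(t+s-r)K(u_r)\omega(r)\,dr$$ for $s\in[-\mu,0]$ with $t+s\ge0$, and $\phi(t,\omega,\xi)(s)=\xi(t+s)$ for $t+s\le0$, is a random dynamical system over the metric dynamical system $(\Omega,\mathcal{F},\mathbb{P},\theta)$. Moreover, $\xi\mapsto\phi(t,\omega,\xi)$ is continuous on $C_\mu$ for every $t\ge0$ and $\omega\in\Omega$.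
   Context: $H$ and $U$ are separable Hilbert spaces with norms $|\cdot|$ and $|\cdot|_U$. Fix $\mu>0$; $C_\mu=C([-\mu,0];H)$ with sup norm $\|\cdot\|_\mu$. For a continuous $H$-valued function $u$ on $[-\mu,T]$ or $[-\mu,\infty)$ and $t\ge0$ in its domain, $u_t\in C_\mu$ is defined by $u_t(s)=u(t+s)$, $s\in[-\mu,0]$. $-A$ is a strictly positive symmetric (self-adjoint) operator on $H$ with compact inverse, and $A$ generates an analytic $C_0$-semigroup $S=(S(t))_{t\ge0}$ on $H$. $D((-A)^\gamma)$, $\gamma\ge0$, are the domains of the fractional powers with their usual norms. There is $\lambda>0$ such that for $t>0$ (constants normalized to $1$): $|S(t)|\le e^{-\lambda t}$; $|(-A)^\gamma S(t)|_{L(H)}\le t^{-\gamma}e^{-\lambda t}$ for $\gamma\in[0,1)$; $|S(t)-\mathrm{id}|_{L(D((-A)^\sigma),D((-A)^\theta))}\le t^{\sigma-\theta}$ for $\theta\ge0$, $\sigma\in[\theta,1+\theta]$. Noise: $C_0(\mathbb{R};U)$ is the space of continuous functions $\mathbb{R}\to U$ vanishing at $0$ with the compact-open topology, carrying the Wiener measure $\mathbb{P}$ with trace-class covariance operator $Q$. Fix $\beta\in(0,1/2)$. $\Omega$ is the set of $\omega\in C_0(\mathbb{R};U)$ with finite $\beta$-Hölder seminorm on every $[-k,k]$, $k\in\mathbb{N}$ (a Borel set of full measure), $\mathcal{F}$ is the trace on $\Omega$ of the Borel $\sigma$-algebra, $\mathbb{P}$ is restricted to $\mathcal{F}$, and $\theta=(\theta_t)_{t\in\mathbb{R}}$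 is the Wiener shift $\theta_t\omega(\cdot)=\omega(\cdot+t)-\omega(t)$, which leaves $\Omega$ invariant and is ergodic. Global mild solution (with initial function $\xi$ and noise path $\omega$): under the stated hypotheses there is exactly one $u\in C([-\mu,\infty);H)$ with $u=\xi$ on $[-\mu,0]$ and, for $t\ge0$, $u(t)=S(t)\xi(0)+\int_0^tS(t-r)F(u_r)dr+\int_0^tAS(t-r)G(u_r)\omega(r)dr+G(u_t)\omega(t)-\int_0^tS(t-r)K(u_r)\omega(r)dr$. A random dynamical system over $(\Omega,\mathcal{F},\mathbb{P},\theta)$ on a Banach space $V$ is a $\mathcal{B}(\mathbb{R}^+)\otimes\mathcal{F}\otimes\mathcal{B}(V),\mathcal{B}(V)$-measurable mapping $\phi:\mathbb{R}^+\times\Omega\times V\to V$ with $\phi(0,\omega,u_0)=u_0$ and $\phi(t+\tau,\omega,u_0)=\phi(t,\theta_\tau\omega,\phi(\tau,\omega,u_0))$ for all $t,\tau\in\mathbb{R}^+$, $u_0\in V$, $\omega\in\Omega$ (no exceptional sets). *)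

theory Defs
  imports "HOL-Probability.Probability"
begin

section \<open>Operators and semigroups\<close>

text \<open>Hilbert spaces are real, complete and separable: sort
  \<open>{real_inner, banach, second_countable_topology}\<close>.  An unbounded operator is a function \<open>A\<close>
  together with its domain \<open>D\<close>; values of \<open>A\<close> outside \<open>D\<close> are irrelevant.\<close>

definition self_adjoint_on :: "'h::real_inner set \<Rightarrow> ('h \<Rightarrow> 'h) \<Rightarrow> bool" where
  "self_adjoint_on D A \<longleftrightarrow>
     subspace D \<and> closure D = UNIV \<and>
     (\<forall>x\<in>D. \<forall>y\<in>D. A (x + y) = A x + A y) \<and> (\<forall>c. \<forall>x\<in>D. A (c *\<^sub>R x) = c *\<^sub>R A x) \<and>
     (\<forall>y z. (\<forall>x\<in>D. inner (A x) y = inner x z) \<longleftrightarrow> (y \<in> D \<and> A y = z))"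

definition strictly_positive_on :: "'h::real_inner set \<Rightarrow> ('h \<Rightarrow> 'h) \<Rightarrow> bool" where
  "strictly_positive_on D B \<longleftrightarrow> (\<forall>x\<in>D. x \<noteq> 0 \<longrightarrow> inner (B x) x > 0)"

definition has_compact_inverse :: "'h::real_normed_vector set \<Rightarrow> ('h \<Rightarrow> 'h) \<Rightarrow> bool" where
  "has_compact_inverse D B \<longleftrightarrow>
     bij_betw B D UNIV \<and> compact (closure (inv_into D B ` cball 0 1))"

definition C0_semigroup :: "(real \<Rightarrow> 'h::real_normed_vector \<Rightarrow>\<^sub>L 'h) \<Rightarrow> bool" where
  "C0_semigroup S \<longleftrightarrow>
     S 0 = id_blinfun \<and>
     (\<forall>s\<ge>0. \<forall>t\<ge>0. S (s + t) = S s o\<^sub>L S t) \<and>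
     (\<forall>x. ((\<lambda>t. blinfun_apply (S t) x) \<longlongrightarrow> x) (at_right 0))"

definition generates ::
  "'h::real_normed_vector set \<Rightarrow> ('h \<Rightarrow> 'h) \<Rightarrow> (real \<Rightarrow> 'h \<Rightarrow>\<^sub>L 'h) \<Rightarrow> bool" where
  "generates D A S \<longleftrightarrow>
     (\<forall>x y. (x \<in> D \<and> A x = y) \<longleftrightarrow>
        ((\<lambda>t. (blinfun_apply (S t) x - x) /\<^sub>R t) \<longlongrightarrow> y) (at_right 0))"

text \<open>\<open>S\<close> extends to a holomorphic semigroup \<open>T(z) = P(z) + i Q(z)\<close> on a sector
  \<open>|arg z| < d\<close>, acting on the complexification of the space; \<open>P\<close> and \<open>Q\<close> are the real and
  imaginary parts.  \<open>P' + i Q'\<close> is the complex derivative.\<close>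

definition analytic_semigroup :: "(real \<Rightarrow> 'h::real_normed_vector \<Rightarrow>\<^sub>L 'h) \<Rightarrow> bool" where
  "analytic_semigroup S \<longleftrightarrow> C0_semigroup S \<and>
     (\<exists>d>0. d \<le> pi / 2 \<and> (\<exists>P Q :: complex \<Rightarrow> 'h \<Rightarrow>\<^sub>L 'h. \<exists>\<Delta>.
        \<Delta> = {z. z \<noteq> 0 \<and> \<bar>Arg z\<bar> < d} \<and>
        (\<forall>t>0. P (complex_of_real t) = S t \<and> Q (complex_of_real t) = 0) \<and>
        (\<forall>z\<in>\<Delta>. \<forall>w\<in>\<Delta>.
           P (z + w) = (P z o\<^sub>L P w) - (Q z o\<^sub>L Q w) \<and>
           Q (z + w) = (P z o\<^sub>L Q w) + (Q z o\<^sub>L P w)) \<and>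
        (\<forall>z\<in>\<Delta>. \<exists>P' Q'.
           (P has_derivative (\<lambda>h. Re h *\<^sub>R P' - Im h *\<^sub>R Q')) (at z) \<and>
           (Q has_derivative (\<lambda>h. Re h *\<^sub>R Q' + Im h *\<^sub>R P')) (at z)) \<and>
        (\<forall>x. ((\<lambda>z. blinfun_apply (P z) x) \<longlongrightarrow> x) (at 0 within \<Delta>) \<and>
             ((\<lambda>z. blinfun_apply (Q z) x) \<longlongrightarrow> 0) (at 0 within \<Delta>))))"

text \<open>Fractional powers of \<open>-A\<close> where \<open>A\<close> generates the exponentially stable analytic semigroup
  \<open>S\<close>: \<open>(-A)\<^sup>-\<^sup>\<gamma> x = 1/\<Gamma>(\<gamma>) \<integral>\<^sub>0\<^sup>\<infinity> t\<^sup>\<gamma>\<^sup>-\<^sup>1 S(t) x dt\<close> for \<open>\<gamma> > 0\<close>, and \<open>(-A)\<^sup>\<gamma>\<close> is the inverse of this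
  injective operator, with domain its range.  The norm on \<open>D((-A)\<^sup>\<gamma>)\<close> is \<open>|(-A)\<^sup>\<gamma> x|\<close>.\<close>

definition neg_frac_power ::
  "(real \<Rightarrow> 'h::{banach, second_countable_topology} \<Rightarrow>\<^sub>L 'h) \<Rightarrow> real \<Rightarrow> 'h \<Rightarrow> 'h" where
  "neg_frac_power S \<gamma> x =
     (if \<gamma> = 0 then x
      else (1 / Gamma \<gamma>) *\<^sub>R (LINT t:{0<..}|lborel. (t powr (\<gamma> - 1)) *\<^sub>R blinfun_apply (S t) x))"

definition frac_dom ::
  "(real \<Rightarrow> 'h::{banach, second_countable_topology} \<Rightarrow>\<^sub>L 'h) \<Rightarrow> real \<Rightarrow> 'h set" where
  "frac_dom S \<gamma> = range (neg_frac_power S \<gamma>)"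

definition frac_power ::
  "(real \<Rightarrow> 'h::{banach, second_countable_topology} \<Rightarrow>\<^sub>L 'h) \<Rightarrow> real \<Rightarrow> 'h \<Rightarrow> 'h" where
  "frac_power S \<gamma> x = (THE y. neg_frac_power S \<gamma> y = x)"

text \<open>The three semigroup estimates with constants normalized to 1; the operator-norm bounds are
  written out pointwise.\<close>

definition semigroup_estimates ::
  "(real \<Rightarrow> 'h::{banach, second_countable_topology} \<Rightarrow>\<^sub>L 'h) \<Rightarrow> real \<Rightarrow> bool" where
  "semigroup_estimates S l \<longleftrightarrow>
     (\<forall>t>0. norm (S t) \<le> exp (- l * t)) \<and>
     (\<forall>t>0. \<forall>\<gamma>. 0 \<le> \<gamma> \<and> \<gamma> < 1 \<longrightarrow>
        (\<forall>x. blinfun_apply (S t) x \<in> frac_dom S \<gamma> \<and>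
             norm (frac_power S \<gamma> (blinfun_apply (S t) x)) \<le> t powr (- \<gamma>) * exp (- l * t) * norm x)) \<and>
     (\<forall>t>0. \<forall>\<theta>\<ge>0. \<forall>\<sigma>. \<theta> \<le> \<sigma> \<and> \<sigma> \<le> 1 + \<theta> \<longrightarrow>
        (\<forall>x\<in>frac_dom S \<sigma>. blinfun_apply (S t) x - x \<in> frac_dom S \<theta> \<and>
             norm (frac_power S \<theta> (blinfun_apply (S t) x - x))
               \<le> t powr (\<sigma> - \<theta>) * norm (frac_power S \<sigma> x)))"

text \<open>\<open>L(U; D((-A)\<^sup>\<nu>))\<close> is viewed inside \<open>L(U; H)\<close>; this loses nothing because \<open>D((-A)\<^sup>\<nu>)\<close> embeds
  continuously into \<open>H\<close>.\<close>

definition L_frac_dom ::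
  "(real \<Rightarrow> 'h::{banach, second_countable_topology} \<Rightarrow>\<^sub>L 'h) \<Rightarrow> real
     \<Rightarrow> ('u::real_normed_vector \<Rightarrow>\<^sub>L 'h) set" where
  "L_frac_dom S \<nu> =
     {T. (\<forall>v. blinfun_apply T v \<in> frac_dom S \<nu>) \<and>
         bounded_linear (\<lambda>v. frac_power S \<nu> (blinfun_apply T v))}"

definition L_frac_norm ::
  "(real \<Rightarrow> 'h::{banach, second_countable_topology} \<Rightarrow>\<^sub>L 'h) \<Rightarrow> real
     \<Rightarrow> ('u::real_normed_vector \<Rightarrow>\<^sub>L 'h) \<Rightarrow> real" where
  "L_frac_norm S \<nu> T = onorm (\<lambda>v. frac_power S \<nu> (blinfun_apply T v))"


section \<open>Delay space\<close>

text \<open>\<open>C([-\<mu>,0];H)\<close> with the supremum distance.  Its points are extensional functions, i.e.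
  \<open>undefined\<close> outside \<open>[-\<mu>,0]\<close>.\<close>

definition delay_space :: "real \<Rightarrow> (real \<Rightarrow> 'h::metric_space) metric" where
  "delay_space \<mu> = cfunspace (top_of_set {-\<mu>..0}) euclidean_metric"

definition segment :: "real \<Rightarrow> (real \<Rightarrow> 'h) \<Rightarrow> real \<Rightarrow> (real \<Rightarrow> 'h)" where
  "segment \<mu> u t = restrict (\<lambda>s. u (t + s)) {-\<mu>..0}"


section \<open>Noise\<close>

definition borel_of_topology :: "'a topology \<Rightarrow> 'a measure" where
  "borel_of_topology X = sigma (topspace X) {U. openin X U}"

definition C0_paths :: "(real \<Rightarrow> 'u::real_normed_vector) set" where
  "C0_paths = {w. continuous_on UNIV w \<and> w 0 = 0}"

definition C0_compact_open :: "(real \<Rightarrow> 'u::real_normed_vector) topology" where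
  "C0_compact_open =
     topology_generated_by {{w \<in> C0_paths. w ` C \<subseteq> V} | C V. compact C \<and> open V}"

definition orthonormal_basis :: "'u::real_inner set \<Rightarrow> bool" where
  "orthonormal_basis B \<longleftrightarrow>
     pairwise orthogonal B \<and> (\<forall>e\<in>B. norm e = 1) \<and> closure (span B) = UNIV"

definition trace_class_covariance :: "('u::real_inner \<Rightarrow>\<^sub>L 'u) \<Rightarrow> bool" where
  "trace_class_covariance Q \<longleftrightarrow>
     (\<forall>x y. inner (blinfun_apply Q x) y = inner x (blinfun_apply Q y)) \<and>
     (\<forall>x. inner (blinfun_apply Q x) x \<ge> 0) \<and>
     (\<exists>B. orthonormal_basis B \<and> (\<lambda>e. inner (blinfun_apply Q e) e) summable_on B)"

definition centered_gaussian :: "real \<Rightarrow> real measure" where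
  "centered_gaussian v =
     (if v = 0 then return borel 0 else density lborel (normal_density 0 (sqrt v)))"

text \<open>Law of the two-sided \<open>Q\<close>-Wiener process on \<open>C\<^sub>0(\<real>;U)\<close>: independent increments over
  successive intervals of the whole line, \<open>\<omega>(t) - \<omega>(s)\<close> centred Gaussian with covariance
  \<open>(t - s) Q\<close>.\<close>

definition wiener_measure ::
  "('u::{real_inner, banach, second_countable_topology} \<Rightarrow>\<^sub>L 'u) \<Rightarrow> (real \<Rightarrow> 'u) measure \<Rightarrow> bool" where
  "wiener_measure Q W \<longleftrightarrow>
     prob_space W \<and>
     space W = C0_paths \<and> sets W = sets (borel_of_topology C0_compact_open) \<and>
     (\<forall>s t h. s < t \<longrightarrow>
        distr W borel (\<lambda>w. inner (w t - w s) h)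
          = centered_gaussian ((t - s) * inner (blinfun_apply Q h) h)) \<and>
     (\<forall>(n::nat) (t :: nat \<Rightarrow> real). (\<forall>i<n. t i < t (Suc i)) \<longrightarrow>
        prob_space.indep_vars W (\<lambda>_. borel) (\<lambda>i w. w (t (Suc i)) - w (t i)) {..<n})"

definition Holder_paths :: "real \<Rightarrow> (real \<Rightarrow> 'u::real_normed_vector) set" where
  "Holder_paths \<beta> =
     {w \<in> C0_paths. \<forall>k::nat. \<exists>C. \<forall>s\<in>{-real k..real k}. \<forall>t\<in>{-real k..real k}.
        norm (w t - w s) \<le> C * \<bar>t - s\<bar> powr \<beta>}"

text \<open>\<open>(\<Omega>, \<F>, \<bbbP>)\<close>: the trace \<open>\<sigma>\<close>-algebra and the restricted measure.\<close>

definition noise_space :: "real \<Rightarrow> (real \<Rightarrow> 'u::real_normed_vector) measure \<Rightarrow> (real \<Rightarrow> 'u) measure"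
  where "noise_space \<beta> W = restrict_space W (Holder_paths \<beta>)"

definition wiener_shift :: "real \<Rightarrow> (real \<Rightarrow> 'u::real_normed_vector) \<Rightarrow> (real \<Rightarrow> 'u)" where
  "wiener_shift t w = (\<lambda>r. w (r + t) - w t)"


section \<open>Mild solutions and random dynamical systems\<close>

definition mild_rhs ::
  "real \<Rightarrow> ('h \<Rightarrow> 'h::{real_inner, banach, second_countable_topology}) \<Rightarrow> (real \<Rightarrow> 'h \<Rightarrow>\<^sub>L 'h)
     \<Rightarrow> ((real \<Rightarrow> 'h) \<Rightarrow> 'h)
     \<Rightarrow> ((real \<Rightarrow> 'h) \<Rightarrow> 'u::{real_inner, banach, second_countable_topology} \<Rightarrow>\<^sub>L 'h)
     \<Rightarrow> ((real \<Rightarrow> 'h) \<Rightarrow> 'u \<Rightarrow>\<^sub>L 'h)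
     \<Rightarrow> (real \<Rightarrow> 'u) \<Rightarrow> (real \<Rightarrow> 'h) \<Rightarrow> (real \<Rightarrow> 'h) \<Rightarrow> real \<Rightarrow> 'h" where
  "mild_rhs \<mu> A S F G K w \<xi> u t =
     blinfun_apply (S t) (\<xi> 0)
     + (LINT r:{0..t}|lborel. blinfun_apply (S (t - r)) (F (segment \<mu> u r)))
     + blinfun_apply (G (segment \<mu> u t)) (w t)
     + (LINT r:{0..t}|lborel. A (blinfun_apply (S (t - r)) (blinfun_apply (G (segment \<mu> u r)) (w r))))
     - (LINT r:{0..t}|lborel. blinfun_apply (S (t - r)) (blinfun_apply (K (segment \<mu> u r)) (w r)))"

text \<open>The integrals are required to exist, since the Bochner integral of a non-integrable function
  is 0 by convention.  Solutions are extensional (\<open>undefined\<close> before \<open>-\<mu>\<close>) so that they are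
  unique as functions on \<open>\<real>\<close>.\<close>

definition global_mild_solution ::
  "real \<Rightarrow> ('h \<Rightarrow> 'h::{real_inner, banach, second_countable_topology}) \<Rightarrow> (real \<Rightarrow> 'h \<Rightarrow>\<^sub>L 'h)
     \<Rightarrow> ((real \<Rightarrow> 'h) \<Rightarrow> 'h)
     \<Rightarrow> ((real \<Rightarrow> 'h) \<Rightarrow> 'u::{real_inner, banach, second_countable_topology} \<Rightarrow>\<^sub>L 'h)
     \<Rightarrow> ((real \<Rightarrow> 'h) \<Rightarrow> 'u \<Rightarrow>\<^sub>L 'h)
     \<Rightarrow> (real \<Rightarrow> 'u) \<Rightarrow> (real \<Rightarrow> 'h) \<Rightarrow> (real \<Rightarrow> 'h) \<Rightarrow> bool" where
  "global_mild_solution \<mu> A S F G K w \<xi> u \<longleftrightarrow>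
     u \<in> extensional {-\<mu>..} \<and> continuous_on {-\<mu>..} u \<and> (\<forall>s\<in>{-\<mu>..0}. u s = \<xi> s) \<and>
     (\<forall>t\<ge>0.
        set_integrable lborel {0..t} (\<lambda>r. blinfun_apply (S (t - r)) (F (segment \<mu> u r))) \<and>
        set_integrable lborel {0..t}
          (\<lambda>r. A (blinfun_apply (S (t - r)) (blinfun_apply (G (segment \<mu> u r)) (w r)))) \<and>
        set_integrable lborel {0..t}
          (\<lambda>r. blinfun_apply (S (t - r)) (blinfun_apply (K (segment \<mu> u r)) (w r))) \<and>
        u t = mild_rhs \<mu> A S F G K w \<xi> u t)"

definition the_mild_solution ::
  "real \<Rightarrow> ('h \<Rightarrow> 'h::{real_inner, banach, second_countable_topology}) \<Rightarrow> (real \<Rightarrow> 'h \<Rightarrow>\<^sub>L 'h)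
     \<Rightarrow> ((real \<Rightarrow> 'h) \<Rightarrow> 'h)
     \<Rightarrow> ((real \<Rightarrow> 'h) \<Rightarrow> 'u::{real_inner, banach, second_countable_topology} \<Rightarrow>\<^sub>L 'h)
     \<Rightarrow> ((real \<Rightarrow> 'h) \<Rightarrow> 'u \<Rightarrow>\<^sub>L 'h)
     \<Rightarrow> (real \<Rightarrow> 'u) \<Rightarrow> (real \<Rightarrow> 'h) \<Rightarrow> (real \<Rightarrow> 'h)" where
  "the_mild_solution \<mu> A S F G K w \<xi> = (THE u. global_mild_solution \<mu> A S F G K w \<xi> u)"

definition solution_cocycle ::
  "real \<Rightarrow> ('h \<Rightarrow> 'h::{real_inner, banach, second_countable_topology}) \<Rightarrow> (real \<Rightarrow> 'h \<Rightarrow>\<^sub>L 'h)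
     \<Rightarrow> ((real \<Rightarrow> 'h) \<Rightarrow> 'h)
     \<Rightarrow> ((real \<Rightarrow> 'h) \<Rightarrow> 'u::{real_inner, banach, second_countable_topology} \<Rightarrow>\<^sub>L 'h)
     \<Rightarrow> ((real \<Rightarrow> 'h) \<Rightarrow> 'u \<Rightarrow>\<^sub>L 'h)
     \<Rightarrow> real \<Rightarrow> (real \<Rightarrow> 'u) \<Rightarrow> (real \<Rightarrow> 'h) \<Rightarrow> (real \<Rightarrow> 'h)" where
  "solution_cocycle \<mu> A S F G K t w \<xi> = segment \<mu> (the_mild_solution \<mu> A S F G K w \<xi>) t"

text \<open>A random dynamical system \<open>\<phi>\<close> on the metric space \<open>V\<close> (here always the underlying space of a
  Banach space) over the base \<open>(M, \<theta>)\<close>, without exceptional sets.  Invariance and ergodicity of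
  the measure of \<open>M\<close> under \<open>\<theta>\<close> are properties of the base alone and are not part of the notion.\<close>

definition random_dynamical_system ::
  "'w measure \<Rightarrow> (real \<Rightarrow> 'w \<Rightarrow> 'w) \<Rightarrow> 'v metric \<Rightarrow> (real \<Rightarrow> 'w \<Rightarrow> 'v \<Rightarrow> 'v) \<Rightarrow> bool" where
  "random_dynamical_system M \<theta> V \<phi> \<longleftrightarrow>
     (\<forall>t. \<forall>w\<in>space M. \<theta> t w \<in> space M) \<and>
     (\<lambda>(t, w, v). \<phi> t w v)
       \<in> (restrict_space borel {0..} \<Otimes>\<^sub>M (M \<Otimes>\<^sub>M borel_of_topology (mtopology_of V)))
           \<rightarrow>\<^sub>M borel_of_topology (mtopology_of V) \<and>
     (\<forall>w\<in>space M. \<forall>v\<in>mspace V. \<phi> 0 w v = v) \<and>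
     (\<forall>t\<ge>0. \<forall>\<tau>\<ge>0. \<forall>w\<in>space M. \<forall>v\<in>mspace V. \<phi> (t + \<tau>) w v = \<phi> t (\<theta> \<tau> w) (\<phi> \<tau> w v))"

end

theory Submission
  imports Defs
begin

text \<open>The obstacle in the mild equation is the term \<open>G(u\<^sub>t) \<omega>(t)\<close>: it involves the present state,
  and where \<open>\<omega>(t)\<close> is large its Lipschitz constant may exceed \<open>1\<close> on intervals of any length, so that
  a direct contraction argument fails.  The
  differentiability of \<open>t \<mapsto> G(u\<^sub>t)\<close> along every continuous path removes the obstacle.  It gives
  \<open>G(u\<^sub>t) = G(\<xi>) + \<integral>\<^sub>0\<^sup>t K(u\<^sub>r) dr\<close>, so for two paths with the same history the difference
  \<open>G(u\<^sub>t) - G(v\<^sub>t)\<close> is an integral of \<open>K(u\<^sub>r) - K(v\<^sub>r)\<close>, and the entire right-hand side is a Volterra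
  operator in \<open>u\<close>.  Its kernel is \<open>1 + s\<^sup>\<nu>\<^sup>-\<^sup>1\<close>, up to constants: the singular part comes from
  \<open>|A S(s) x| \<le> const s\<^sup>\<nu>\<^sup>-\<^sup>1 |(-A)\<^sup>\<nu> x|\<close> (lemma \<open>norm_dS_frac_le\<close>) and is integrable because \<open>\<nu> > 0\<close>.

  One inequality, \<open>rhs_diff_le\<close>, bounds the difference of two right-hand sides by the differences
  of histories and noise paths plus the Volterra integral of the difference of the unknowns.  In a norm
  weighted by \<open>exp(-\<rho> t)\<close> with large \<open>\<rho>\<close> the Volterra part has constant at most \<open>1/2\<close>
  (\<open>exponential_weight_small\<close>).  Hence Picard iteration converges on every bounded interval
  (\<open>solution_exists\<close>), and two solutions differ at most by a constant times the difference of
  their data (\<open>solution_estimate\<close>).  The latter contains uniqueness, Lipschitz continuity in the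
  history, and continuity in the noise for uniform convergence on bounded intervals.  All this
  holds for continuous noise paths that vanish at \<open>0\<close>, a class that contains the interpolated paths used
  below.

  For the cocycle property the solution is restarted at time \<open>\<tau>\<close>, which replaces the noise
  \<open>\<omega>(\<cdot> + \<tau>)\<close> by \<open>\<omega>(\<cdot> + \<tau>) - \<omega>(\<tau>)\<close>.  The extra terms all contain the constant vector \<open>\<omega>(\<tau>)\<close>, and they
  cancel by integrating the derivative of \<open>r \<mapsto> S(t-r) G(v\<^sub>r) \<omega>(\<tau>)\<close> (\<open>integration_by_parts\<close>);
  uniqueness then identifies the restarted solution.

  Measurability is reduced to continuity.  The delay space is separable, so a map into it is measurable
  once its evaluations are (\<open>delay_space_measurableI\<close>).  Piecewise linear interpolation of \<open>\<omega>\<close> and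
  \<open>\<xi>\<close> turns the evaluated solution into a continuous function of the time and finitely many point
  values of \<open>\<omega>\<close> and \<open>\<xi>\<close>, which depend measurably on \<open>(\<omega>, \<xi>)\<close>; refining the mesh, these functions
  converge to the evaluated solution (\<open>solution_eval_measurable\<close>).\<close>

section \<open>Self-adjoint analytic semigroups\<close>

lemma has_vector_derivative_quotient:
  fixes f :: "real \<Rightarrow> 'a::real_normed_vector"
  assumes "(f has_vector_derivative y) (at t)"
  shows "((\<lambda>h. (f (t + h) - f t) /\<^sub>R h) \<longlongrightarrow> y) (at 0)"
proof -
  have "((\<lambda>h. norm (f (t + h) - f t - h *\<^sub>R y) / norm h) \<longlongrightarrow> 0) (at 0)"
    using assms by (simp add: has_vector_derivative_def has_derivative_at)
  moreover have "\<forall>\<^sub>F h in at 0. norm (f (t + h) - f t - h *\<^sub>R y) / norm h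
      = norm ((f (t + h) - f t) /\<^sub>R h - y)"
  proof (intro eventually_at_ball'[of 1, THEN eventually_mono])
    fix h :: real assume "h \<in> ball 0 1 \<and> h \<noteq> 0 \<and> h \<in> UNIV"
    then have "(f (t + h) - f t) /\<^sub>R h - y = (f (t + h) - f t - h *\<^sub>R y) /\<^sub>R h"
      by (simp add: algebra_simps)
    then show "norm (f (t + h) - f t - h *\<^sub>R y) / norm h = norm ((f (t + h) - f t) /\<^sub>R h - y)"
      by (simp add: divide_inverse_commute)
  qed simp
  ultimately have "((\<lambda>h. norm ((f (t + h) - f t) /\<^sub>R h - y)) \<longlongrightarrow> 0) (at 0)"
    by (rule Lim_transform_eventually)
  then show ?thesis
    by (rule LIM_zero_cancel[OF tendsto_norm_zero_cancel])
qed

text \<open>Self-adjointness enters through the symmetry of \<open>A\<close>, which gives the smoothing bound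
  \<open>norm_dS_le\<close> and the injectivity of the negative fractional powers by elementary calculus.\<close>

locale selfadjoint_semigroup =
  fixes D :: "'h::{real_inner, banach, second_countable_topology} set"
    and A :: "'h \<Rightarrow> 'h" and S :: "real \<Rightarrow> 'h \<Rightarrow>\<^sub>L 'h" and l :: real
  assumes self_adjoint: "self_adjoint_on D A"
    and positive: "strictly_positive_on D (\<lambda>x. - A x)"
    and generator: "generates D A S"
    and analytic: "analytic_semigroup S"
    and l_pos: "l > 0"
    and estimates: "semigroup_estimates S l"
begin

text \<open>The derivative \<open>A S(t)\<close> for \<open>t > 0\<close>; analyticity makes it a bounded operator and a derivative in
  operator norm.\<close>

definition dS :: "real \<Rightarrow> 'h \<Rightarrow>\<^sub>L 'h" where
  "dS t = vector_derivative S (at t)"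

lemma S_0: "S 0 = id_blinfun"
  and S_add: "s \<ge> 0 \<Longrightarrow> t \<ge> 0 \<Longrightarrow> S (s + t) = S s o\<^sub>L S t"
  and S_tendsto_0: "((\<lambda>t. S t x) \<longlongrightarrow> x) (at_right 0)"
  using analytic unfolding analytic_semigroup_def C0_semigroup_def by auto

lemma S_add_apply: "s \<ge> 0 \<Longrightarrow> t \<ge> 0 \<Longrightarrow> S (s + t) x = S s (S t x)"
  by (simp add: S_add)

lemma S_has_derivative:
  assumes "t > 0"
  shows "(S has_vector_derivative dS t) (at t)"
proof -
  from analytic obtain d and P :: "complex \<Rightarrow> 'h \<Rightarrow>\<^sub>L 'h" and Q
    where *: "d > 0"
      "\<forall>t>0. P (complex_of_real t) = S t \<and> Q (complex_of_real t) = (0 :: 'h \<Rightarrow>\<^sub>L 'h)"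
      "\<forall>z\<in>{z. z \<noteq> 0 \<and> \<bar>Arg z\<bar> < d}. \<exists>P' Q'.
           (P has_derivative (\<lambda>h. Re h *\<^sub>R P' - Im h *\<^sub>R Q')) (at z) \<and>
           (Q has_derivative (\<lambda>h. Re h *\<^sub>R Q' + Im h *\<^sub>R P')) (at z)"
    unfolding analytic_semigroup_def by (elim conjE exE) (rule that, auto)
  have d: "d > 0" and P: "\<And>t. t > 0 \<Longrightarrow> P (complex_of_real t) = S t"
    using * by auto
  have "Arg (complex_of_real t) = 0"
    using assms by simp
  with d assms have "complex_of_real t \<in> {z. z \<noteq> 0 \<and> \<bar>Arg z\<bar> < d}"
    by simp
  with *(3) obtain P' Q' where "(P has_derivative (\<lambda>h. Re h *\<^sub>R P' - Im h *\<^sub>R Q')) (at (complex_of_real t))"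
    by meson
  \<comment> \<open>Restricting the complex derivative of the holomorphic extension to the real axis.\<close>
  then have "((\<lambda>s. P (complex_of_real s)) has_derivative
      (\<lambda>h. Re (complex_of_real h) *\<^sub>R P' - Im (complex_of_real h) *\<^sub>R Q')) (at t)"
    by (rule has_derivative_compose[of complex_of_real complex_of_real t UNIV P, rotated])
       (intro bounded_linear.has_derivative[OF bounded_linear_of_real] has_derivative_ident)
  then have "((\<lambda>s. P (complex_of_real s)) has_vector_derivative P') (at t)"
    by (simp add: has_vector_derivative_def)
  moreover have "open {0::real<..}" "t \<in> {0<..}"
    using assms by auto
  ultimately have "(S has_vector_derivative P') (at t)"
    by (rule has_vector_derivative_transform_within_open) (simp add: P)
  then show ?thesis
    unfolding dS_def by (simp add: vector_derivative_at)
qed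

lemma norm_S_le_exp: "t > 0 \<Longrightarrow> norm (S t) \<le> exp (- l * t)"
  using estimates unfolding semigroup_estimates_def by blast

lemma norm_S_le_1:
  assumes "t \<ge> 0" shows "norm (S t) \<le> 1"
proof (cases "t = 0")
  case True
  then show ?thesis by (simp add: S_0 norm_blinfun_id_le)
next
  case False
  then have "norm (S t) \<le> exp (- l * t)"
    using assms by (intro norm_S_le_exp) auto
  also have "\<dots> \<le> 1" using assms l_pos by simp
  finally show ?thesis .
qed

lemma norm_S_apply_le: "t \<ge> 0 \<Longrightarrow> norm (S t x) \<le> norm x"
  using norm_blinfun[of "S t" x] norm_S_le_1[of t] mult_right_mono[of "norm (S t)" 1 "norm x"]
  by simp

lemma S_continuous_pos: "continuous_on {0<..} S"
  by (intro continuous_at_imp_continuous_on ballI has_vector_derivative_continuous)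
     (auto intro: S_has_derivative)

lemma S_strongly_continuous: "continuous_on {0..} (\<lambda>t. S t x)"
  unfolding continuous_on_eq_continuous_within
proof
  fix t :: real assume t: "t \<in> {0..}"
  show "continuous (at t within {0..}) (\<lambda>t. S t x)"
  proof (cases "t = 0")
    case True
    have "((\<lambda>t. S t x) \<longlongrightarrow> x) (at 0 within {0..})"
      using S_tendsto_0[of x] by (simp add: at_within_Ici_at_right)
    then show ?thesis using True by (simp add: continuous_within S_0)
  next
    case False
    then have "isCont S t" using t
      by (intro has_vector_derivative_continuous[OF S_has_derivative]) auto
    then have "isCont (\<lambda>t. S t x) t"
      by (intro continuous_intros)
    then show ?thesis by (rule continuous_at_imp_continuous_at_within)
  qed
qed

lemma S_apply_has_derivative:
  "t > 0 \<Longrightarrow> ((\<lambda>t. S t x) has_vector_derivative dS t x) (at t)"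
  using bounded_linear.has_vector_derivative[OF blinfun.bounded_linear_left S_has_derivative] .

lemma generatorI:
  "((\<lambda>t. (S t x - x) /\<^sub>R t) \<longlongrightarrow> y) (at_right 0) \<Longrightarrow> x \<in> D \<and> A x = y"
  using generator unfolding generates_def by blast

lemma
  assumes "t > 0" shows S_in_D: "S t x \<in> D" and A_S: "A (S t x) = dS t x"
proof -
  have "((\<lambda>h. (S (t + h) x - S t x) /\<^sub>R h) \<longlongrightarrow> dS t x) (at 0)"
    using has_vector_derivative_quotient[OF S_apply_has_derivative[OF assms, of x]] .
  then have "((\<lambda>h. (S (t + h) x - S t x) /\<^sub>R h) \<longlongrightarrow> dS t x) (at_right 0)"
    by (rule tendsto_within_subset) auto
  moreover have "\<forall>\<^sub>F h in at_right 0. (S (t + h) x - S t x) /\<^sub>R h = (S h (S t x) - S t x) /\<^sub>R h"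
    by (rule eventually_mono[OF eventually_at_right_less])
      (use assms in \<open>simp add: S_add_apply[symmetric] add.commute\<close>)
  ultimately have "((\<lambda>h. (S h (S t x) - S t x) /\<^sub>R h) \<longlongrightarrow> dS t x) (at_right 0)"
    by (rule Lim_transform_eventually)
  from generatorI[OF this] show "S t x \<in> D" "A (S t x) = dS t x" by auto
qed

lemma A_S_commute:
  assumes "x \<in> D" "t \<ge> 0" shows "S t x \<in> D" "A (S t x) = S t (A x)"
proof -
  have "((\<lambda>h. (S h x - x) /\<^sub>R h) \<longlongrightarrow> A x) (at_right 0)"
    using generator assms unfolding generates_def by blast
  then have "((\<lambda>h. S t ((S h x - x) /\<^sub>R h)) \<longlongrightarrow> S t (A x)) (at_right 0)"
    by (intro tendsto_intros)
  moreover have "\<forall>\<^sub>F h in at_right 0. S t ((S h x - x) /\<^sub>R h) = (S h (S t x) - S t x) /\<^sub>R h"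
    by (rule eventually_mono[OF eventually_at_right_less])
      (use assms in \<open>simp add: S_add_apply[symmetric] add.commute blinfun.bilinear_simps\<close>)
  ultimately have "((\<lambda>h. (S h (S t x) - S t x) /\<^sub>R h) \<longlongrightarrow> S t (A x)) (at_right 0)"
    by (rule Lim_transform_eventually)
  from generatorI[OF this] show "S t x \<in> D" "A (S t x) = S t (A x)" by auto
qed

lemma dS_add: "s > 0 \<Longrightarrow> t \<ge> 0 \<Longrightarrow> dS (t + s) x = S t (dS s x)"
  using A_S_commute(2)[OF S_in_D, of s t x] A_S[of "t + s" x] A_S[of s x]
  by (simp add: S_add_apply)

lemma dS_add': "s > 0 \<Longrightarrow> t \<ge> 0 \<Longrightarrow> dS (t + s) x = dS s (S t x)"
  using A_S[of "s + t" x] A_S[of s "S t x"]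
  by (simp add: S_add_apply add.commute)

text \<open>Near \<open>t\<close> the derivative factors as \<open>S(r - s) A S(s)\<close> with a fixed \<open>s < t\<close>, and \<open>S\<close> is already
  continuous in operator norm on \<open>(0, \<infinity>)\<close>.\<close>

lemma dS_continuous: "continuous_on {0<..} dS"
proof (intro continuous_at_imp_continuous_on ballI)
  fix t :: real assume "t \<in> {0<..}"
  then have t: "t > 0" by simp
  define s where "s = t / 2"
  have s: "s > 0" "t - s > 0" using t by (auto simp: s_def)
  have "isCont S (t - s)"
    using s by (intro has_vector_derivative_continuous[OF S_has_derivative])
  then have "isCont (\<lambda>r. S (r - s)) t"
    using isCont_o2[of t "\<lambda>r. r - s" S] by simp
  then have "isCont (\<lambda>r. S (r - s) o\<^sub>L dS s) t"
    by (intro bounded_bilinear.continuous[OF bounded_bilinear_blinfun_compose] continuous_const)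
  moreover have "\<forall>\<^sub>F r in nhds t. S (r - s) o\<^sub>L dS s = dS r"
  proof (rule eventually_nhds_in_open[THEN eventually_mono])
    show "open {s<..}" "t \<in> {s<..}" using s by auto
    fix r assume "r \<in> {s<..}"
    then show "S (r - s) o\<^sub>L dS s = dS r"
      using s by (intro blinfun_eqI) (simp add: dS_add[symmetric])
  qed
  ultimately show "isCont dS t"
    using isCont_cong by force
qed

lemma dS_apply_in_D: "t > 0 \<Longrightarrow> dS t x \<in> D"
  using dS_add[of "t/2" "t/2" x] S_in_D[of "t/2" "dS (t/2) x"] by simp

lemma dS_apply_has_derivative:
  assumes "t > 0"
  shows "((\<lambda>t. dS t x) has_vector_derivative A (dS t x)) (at t)"
proof -
  define s where "s = t / 2"
  have s: "s > 0" "t - s > 0" using assms by (auto simp: s_def)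
  have "((\<lambda>r. S (r - s) (dS s x)) has_vector_derivative 1 *\<^sub>R dS (t - s) (dS s x)) (at t)"
    using vector_diff_chain_at[of "\<lambda>r. r - s" 1 t "\<lambda>r. S r (dS s x)", OF _ S_apply_has_derivative]
      has_vector_derivative_diff[OF has_vector_derivative_id has_vector_derivative_const[of s]] s
    by (simp add: o_def)
  moreover have "dS (t - s) (dS s x) = A (dS t x)"
    using s A_S[of "t - s" "dS s x"] dS_add[of s "t - s" x] by simp
  ultimately have "((\<lambda>r. S (r - s) (dS s x)) has_vector_derivative A (dS t x)) (at t)" by simp
  moreover have "open {s<..}" "t \<in> {s<..}" using s by auto
  ultimately show ?thesis
    by (rule has_vector_derivative_transform_within_open)
       (use s in \<open>auto simp: dS_add[symmetric]\<close>)
qed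

lemma A_symmetric: "x \<in> D \<Longrightarrow> y \<in> D \<Longrightarrow> inner (A x) y = inner x (A y)"
  using self_adjoint unfolding self_adjoint_on_def by blast

lemma A_nonpos:
  assumes "x \<in> D" shows "inner (A x) x \<le> 0"
  using positive assms unfolding strictly_positive_on_def
  by (cases "x = 0") (auto simp: less_imp_le)

text \<open>The energy method for \<open>u' = A u\<close>, \<open>u(t) = S(t) x\<close>.  With \<open>a = |u|\<^sup>2\<close>, \<open>b = -\<langle>A u, u\<rangle> \<ge> 0\<close> and
  \<open>c = |A u|\<^sup>2\<close>, symmetry of \<open>A\<close> gives \<open>a' = -2 b\<close> and \<open>b' = -2 c\<close>, and \<open>b\<close> and \<open>c\<close> are
  nonincreasing.  The mean value theorem on \<open>[t/2, t]\<close> therefore bounds \<open>b(t)\<close> by \<open>a\<close> and then \<open>c(t)\<close>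
  by \<open>b(t/2)\<close>, each time at the cost of a factor \<open>1/t\<close>.\<close>

lemma norm_dS_le:
  assumes t: "t > 0"
  shows "norm (dS t x) \<le> 2 * norm x / t"
proof -
  define a where "a t = inner (S t x) (S t x)" for t
  define b where "b t = - inner (dS t x) (S t x)" for t
  define c where "c t = inner (dS t x) (dS t x)" for t
  have a': "(a has_real_derivative - 2 * b t) (at t)" if "t > 0" for t
    unfolding a_def[abs_def] has_real_derivative_iff_has_vector_derivative
    using bounded_bilinear.has_vector_derivative[OF bounded_bilinear_inner
        S_apply_has_derivative[OF that, of x] S_apply_has_derivative[OF that, of x]]
    by (simp add: b_def inner_commute)
  have b': "(b has_real_derivative - 2 * c t) (at t)" if "t > 0" for t
  proof -
    have "inner (A (dS t x)) (S t x) = c t"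
      using A_symmetric[OF dS_apply_in_D[OF that] S_in_D[OF that], of x x] A_S[OF that]
      by (simp add: c_def)
    then show ?thesis
      unfolding b_def[abs_def] has_real_derivative_iff_has_vector_derivative
      using has_vector_derivative_minus[OF bounded_bilinear.has_vector_derivative[OF bounded_bilinear_inner
        dS_apply_has_derivative[OF that, of x] S_apply_has_derivative[OF that, of x]]]
      by (simp add: c_def)
  qed
  have c_mono: "c t \<le> c s" if "0 < s" "s \<le> t" for s t
    using norm_S_apply_le[of "t - s" "dS s x"] dS_add[of s "t - s" x] that
    by (auto simp: c_def dot_square_norm)
  have b_nonneg: "b t \<ge> 0" if "t > 0" for t
    using A_nonpos[OF S_in_D[OF that, of x]] A_S[OF that] by (simp add: b_def)
  have b_le: "b t \<le> norm x ^ 2 / t" if t: "t > 0" for t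
  proof -
    have "\<exists>z>t/2. z < t \<and> a t - a (t/2) = (t - t/2) * (- 2 * b z)"
      by (rule MVT2) (use t a' in auto)
    then obtain z where z: "z > t/2" "z < t" "a t - a (t/2) = (t - t/2) * (- 2 * b z)"
      by blast
    have "b t \<le> b z"
    proof (rule DERIV_nonpos_imp_nonincreasing[of z t b])
      show "\<exists>y. DERIV b r :> y \<and> y \<le> 0" if "z \<le> r" "r \<le> t" for r
        using b'[of r] z t that by (intro exI[of _ "- 2 * c r"]) (auto simp: c_def)
    qed (use z in simp)
    then have "t * b t \<le> t * b z" using t by simp
    also have "\<dots> = a (t/2) - a t" using z(3) by (simp add: field_simps)
    also have "\<dots> \<le> a (t/2)" by (simp add: a_def)
    also have "\<dots> \<le> norm x ^ 2"
      using norm_S_apply_le[of "t/2" x] t by (simp add: a_def dot_square_norm)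
    finally show ?thesis using t by (simp add: field_simps)
  qed
  have "\<exists>z>t/2. z < t \<and> b t - b (t/2) = (t - t/2) * (- 2 * c z)"
    by (rule MVT2) (use t b' in auto)
  then obtain z where z: "z > t/2" "z < t" "b t - b (t/2) = (t - t/2) * (- 2 * c z)"
    by blast
  have "t * c t \<le> t * c z" using c_mono[of z t] z t by simp
  also have "\<dots> = b (t/2) - b t" using z(3) by (simp add: field_simps)
  also have "\<dots> \<le> norm x ^ 2 / (t/2)" using b_nonneg[OF t] b_le[of "t/2"] t by simp
  finally have "c t \<le> 2 * norm x ^ 2 / t ^ 2" using t by (simp add: field_simps power2_eq_square)
  also have "\<dots> \<le> (2 * norm x / t) ^ 2" by (simp add: power_divide power_mult_distrib divide_right_mono)
  finally have "norm (dS t x) ^ 2 \<le> (2 * norm x / t) ^ 2"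
    by (simp add: c_def dot_square_norm)
  then show ?thesis
    by (rule power2_le_imp_le) (use t in auto)
qed

text \<open>By symmetry of \<open>A\<close>, the function \<open>s \<mapsto> \<langle>S(t - s) x, S(s) y\<rangle>\<close> has derivative zero; the claim
  compares its values at the end points.\<close>

lemma S_symmetric:
  assumes "t \<ge> 0" shows "inner (S t x) y = inner x (S t y)"
proof (cases "t = 0")
  case False
  then have t: "0 < t" using assms by simp
  have "continuous_on {0..t} (\<lambda>s. S (t - s) x)"
    by (rule continuous_on_compose2[OF S_strongly_continuous]) (auto intro!: continuous_intros)
  then have cont: "continuous_on {0..t} (\<lambda>s. inner (S (t - s) x) (S s y))"
    by (intro continuous_on_inner continuous_on_subset[OF S_strongly_continuous[of y]]) auto
  have "((\<lambda>s. inner (S (t - s) x) (S s y)) has_real_derivative 0) (at s)" if s: "0 < s" "s < t" for s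
  proof -
    have "((\<lambda>r. S (t - r) x) has_vector_derivative (- 1) *\<^sub>R dS (t - s) x) (at s)"
      using vector_diff_chain_at[of "\<lambda>r. t - r" "- 1" s "\<lambda>r. S r x", OF _ S_apply_has_derivative]
        has_vector_derivative_diff[OF has_vector_derivative_const[of t] has_vector_derivative_id] s
      by (simp add: o_def)
    from bounded_bilinear.has_vector_derivative[OF bounded_bilinear_inner this
        S_apply_has_derivative[of s y]] s
    show ?thesis
      unfolding has_real_derivative_iff_has_vector_derivative
      using A_symmetric[OF S_in_D[of "t - s" x] S_in_D[of s y]] A_S[of "t-s" x] A_S[of s y]
      by simp
  qed
  then have "inner (S (t - t) x) (S t y) = inner (S (t - 0) x) (S 0 y)"
    by (intro DERIV_isconst_end[OF t cont]) auto
  then show ?thesis by (simp add: S_0)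
qed (simp add: S_0)

text \<open>Exponential decay of the semigroup dominates the integrand by that of a Gamma integral.\<close>

lemma neg_frac_power_integrable:
  assumes "\<gamma> > 0"
  shows "set_integrable lborel {0<..} (\<lambda>t. (t powr (\<gamma> - 1)) *\<^sub>R S t x)"
proof -
  have "(\<lambda>t. norm (complex_of_real t powr (complex_of_real \<gamma> - 1) / of_real (exp (l * t))))
      absolutely_integrable_on {0<..}"
    by (intro set_integrable_norm absolutely_integrable_Gamma_integral) (use assms l_pos in auto)
  also have "?this \<longleftrightarrow> (\<lambda>t. t powr (\<gamma> - 1) / exp (l * t)) absolutely_integrable_on {0<..}"
    by (intro set_integrable_cong) (auto simp: norm_divide norm_powr_real_powr)
  finally have "set_integrable lborel {0<..} (\<lambda>t. t powr (\<gamma> - 1) / exp (l * t))"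
    unfolding set_integrable_def
    by (subst (asm) integrable_completion) (auto intro!: measurable_If)
  then have "set_integrable lborel {0<..} (\<lambda>t. t powr (\<gamma> - 1) / exp (l * t) * norm x)"
    by (rule set_integrable_mult_left)
  then show ?thesis
  proof (rule set_integrable_bound)
    have "continuous_on {0<..} (\<lambda>t. (t powr (\<gamma> - 1)) *\<^sub>R S t x)"
      by (intro continuous_intros S_continuous_pos) auto
    from borel_measurable_continuous_on_indicator[OF _ this]
    show "set_borel_measurable lborel {0<..} (\<lambda>t. (t powr (\<gamma> - 1)) *\<^sub>R S t x)"
      unfolding set_borel_measurable_def by simp
    have "norm ((t powr (\<gamma> - 1)) *\<^sub>R S t x) \<le> norm (t powr (\<gamma> - 1) / exp (l * t) * norm x)"
      if "t > 0" for t
    proof -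
      have "norm (S t x) \<le> exp (- l * t) * norm x"
        using norm_blinfun[of "S t" x] norm_S_le_exp[OF that] 
        by (meson mult_right_mono norm_ge_zero order_trans)
      then show ?thesis
        using mult_left_mono[of "norm (S t x)" "exp (- l * t) * norm x" "t powr (\<gamma> - 1)"]
        by (simp add: exp_minus field_simps)
    qed
    then show "AE t in lborel. t \<in> {0<..} \<longrightarrow> norm ((t powr (\<gamma> - 1)) *\<^sub>R S t x)
        \<le> norm (t powr (\<gamma> - 1) / exp (l * t) * norm x)"
      by auto
  qed
qed

lemma neg_frac_power_0: "neg_frac_power S 0 x = x"
  by (simp add: neg_frac_power_def)

lemma frac_power_0: "frac_power S 0 x = x"
  by (simp add: frac_power_def neg_frac_power_0)

lemma linear_neg_frac_power:
  assumes "\<gamma> > 0" shows "linear (neg_frac_power S \<gamma>)"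
proof (rule linearI)
  fix x y :: 'h and c :: real
  note int = neg_frac_power_integrable[OF assms]
  show "neg_frac_power S \<gamma> (x + y) = neg_frac_power S \<gamma> x + neg_frac_power S \<gamma> y"
    using set_integral_add(2)[OF int[of x] int[of y]] assms
    by (simp add: neg_frac_power_def blinfun.bilinear_simps scaleR_add_right)
  have "(LINT t:{0<..}|lborel. (t powr (\<gamma> - 1)) *\<^sub>R S t (c *\<^sub>R x))
      = (LINT t:{0<..}|lborel. c *\<^sub>R ((t powr (\<gamma> - 1)) *\<^sub>R S t x))"
    by (simp add: blinfun.bilinear_simps mult.commute)
  also have "\<dots> = c *\<^sub>R (LINT t:{0<..}|lborel. (t powr (\<gamma> - 1)) *\<^sub>R S t x)"
    by (rule set_integral_scaleR_right)
  finally show "neg_frac_power S \<gamma> (c *\<^sub>R x) = c *\<^sub>R neg_frac_power S \<gamma> x"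
    using assms by (simp add: neg_frac_power_def)
qed

text \<open>If \<open>(-A)\<^sup>-\<^sup>\<gamma> x = 0\<close>, pairing with \<open>x\<close> gives \<open>\<integral> t\<^sup>\<gamma>\<^sup>-\<^sup>1 |S(t/2) x|\<^sup>2 dt = 0\<close>, because \<open>S(t/2)\<close> is
  symmetric.  So \<open>S(t/2) x = 0\<close> for arbitrarily small \<open>t\<close>, and strong continuity yields \<open>x = 0\<close>.
  Injectivity is what gives the description operator in \<open>frac_power\<close> its intended value.\<close>

lemma inj_neg_frac_power:
  assumes \<gamma>: "\<gamma> > 0" shows "inj (neg_frac_power S \<gamma>)"
  unfolding linear_injective_0[OF linear_neg_frac_power[OF \<gamma>]]
proof (intro allI impI)
  fix x assume "neg_frac_power S \<gamma> x = 0"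
  then have int0: "(LINT t:{0<..}|lborel. (t powr (\<gamma> - 1)) *\<^sub>R S t x) = 0"
    using \<gamma> Gamma_real_pos[OF \<gamma>] by (simp add: neg_frac_power_def)
  note int = neg_frac_power_integrable[OF \<gamma>, of x, unfolded set_integrable_def]
  have "(LINT t|lborel. inner (indicator {0<..} t *\<^sub>R (t powr (\<gamma> - 1)) *\<^sub>R S t x) x) = inner 0 x"
    using int0 by (subst integral_inner_left[OF int]) (simp add: set_lebesgue_integral_def)
  then have 0: "(LINT t|lborel. indicator {0<..} t * (t powr (\<gamma> - 1)) * inner (S t x) x) = 0"
    by (simp add: mult.assoc)
  have eq: "inner (S t x) x = (norm (S (t/2) x))^2" if "t > 0" for t
    using S_add_apply[of "t/2" "t/2" x] S_symmetric[of "t/2" "S (t/2) x" x] that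
    by (simp add: dot_square_norm)
  have "AE t in lborel. indicator {0<..} t * (t powr (\<gamma> - 1)) * inner (S t x) x = 0"
    using 0
  proof (subst (asm) integral_nonneg_eq_0_iff_AE)
    show "integrable lborel (\<lambda>t. indicator {0<..} t * (t powr (\<gamma> - 1)) * inner (S t x) x)"
      using integrable_inner_left[OF int, of x] by (simp add: mult.assoc)
    show "AE t in lborel. 0 \<le> indicator {0<..} t * (t powr (\<gamma> - 1)) * inner (S t x) x"
      by (auto simp: indicator_def eq)
  qed
  then have AE: "AE t in lborel. t > 0 \<longrightarrow> S (t/2) x = 0"
    by eventually_elim (auto simp: indicator_def eq)
  have "\<exists>t. 0 < t \<and> t < e \<and> S (t/2) x = 0" if "e > 0" for e
  proof (rule ccontr)
    assume "\<not> ?thesis"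
    with AE have "AE t in lborel. t \<notin> {0<..<e}"
      by (auto elim: eventually_mono)
    then have "{0<..<e} \<in> null_sets lborel"
      by (subst AE_iff_null_sets) auto
    then show False
      using that by (simp add: null_sets_def)
  qed
  then have "\<forall>n. \<exists>t. 0 < t \<and> t < 1 / real (Suc n) \<and> S (t/2) x = 0"
    by simp
  then obtain t where t: "\<And>n. 0 < t n" "\<And>n. t n < 1 / real (Suc n)" "\<And>n. S (t n / 2) x = 0"
    by metis
  have "t \<longlonglongrightarrow> 0"
    by (rule tendsto_sandwich[OF _ _ tendsto_const LIMSEQ_Suc[OF lim_1_over_n]])
       (use t in \<open>auto intro!: always_eventually less_imp_le\<close>)
  then have "filterlim (\<lambda>n. t n / 2) (at_right 0) sequentially"
    using t(1) by (auto simp: filterlim_at less_imp_neq[symmetric] intro!: tendsto_eq_intros always_eventually)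
  from filterlim_compose[OF S_tendsto_0[of x] this] have "(\<lambda>n. 0) \<longlonglongrightarrow> x"
    using t(3) by simp
  then show "x = 0"
    by (simp add: LIMSEQ_const_iff)
qed

lemma frac_power_neg_frac_power:
  "\<gamma> > 0 \<Longrightarrow> frac_power S \<gamma> (neg_frac_power S \<gamma> x) = x"
  using inj_neg_frac_power[of \<gamma>] unfolding frac_power_def inj_def by (intro the_equality) auto

lemma frac_dom_diff:
  assumes "\<gamma> > 0" "x \<in> frac_dom S \<gamma>" "y \<in> frac_dom S \<gamma>"
  shows "x - y \<in> frac_dom S \<gamma>"
    and "frac_power S \<gamma> (x - y) = frac_power S \<gamma> x - frac_power S \<gamma> y"
proof -
  obtain x' y' where [simp]: "x = neg_frac_power S \<gamma> x'" "y = neg_frac_power S \<gamma> y'"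
    using assms unfolding frac_dom_def by auto
  have *: "x - y = neg_frac_power S \<gamma> (x' - y')"
    by (simp add: linear_diff[OF linear_neg_frac_power[OF assms(1)]])
  show "x - y \<in> frac_dom S \<gamma>" unfolding * frac_dom_def by simp
  show "frac_power S \<gamma> (x - y) = frac_power S \<gamma> x - frac_power S \<gamma> y"
    unfolding * by (simp add: frac_power_neg_frac_power assms(1))
qed

lemma L_frac_dom_diff:
  assumes "\<gamma> > 0" "T \<in> L_frac_dom S \<gamma>" "T' \<in> L_frac_dom S \<gamma>"
  shows "T - T' \<in> L_frac_dom S \<gamma>"
  using assms frac_dom_diff[OF assms(1)] unfolding L_frac_dom_def
  by (auto simp: blinfun.bilinear_simps intro: bounded_linear_sub)

lemma norm_frac_power_le:
  "T \<in> L_frac_dom S \<gamma> \<Longrightarrow> norm (frac_power S \<gamma> (T v)) \<le> L_frac_norm S \<gamma> T * norm v"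
  unfolding L_frac_dom_def L_frac_norm_def by (auto intro: onorm)

lemma norm_S_diff_le:
  assumes "0 \<le> \<gamma>" "\<gamma> \<le> 1" "t > 0" "x \<in> frac_dom S \<gamma>"
  shows "norm (S t x - x) \<le> t powr \<gamma> * norm (frac_power S \<gamma> x)"
proof -
  have "norm (frac_power S 0 (S t x - x)) \<le> t powr (\<gamma> - 0) * norm (frac_power S \<gamma> x)"
    using estimates[unfolded semigroup_estimates_def, THEN conjunct2, THEN conjunct2,
        rule_format, of t 0 \<gamma> x] assms by simp
  then show ?thesis by (simp add: frac_power_0)
qed

text \<open>Time \<open>1\<close> is long enough for \<open>S(1)\<close> to be a strict contraction, and \<open>S(1) x - x\<close> is controlled by
  the fractional norm; the bound follows by absorbing \<open>|S(1) x|\<close>.\<close>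

lemma norm_le_frac_power:
  assumes "0 \<le> \<gamma>" "\<gamma> \<le> 1" "x \<in> frac_dom S \<gamma>"
  shows "norm x \<le> norm (frac_power S \<gamma> x) / (1 - exp (- l))"
proof -
  have "norm x \<le> norm (S 1 x) + norm (S 1 x - x)"
    by norm
  also have "norm (S 1 x) \<le> exp (- l) * norm x"
    using norm_blinfun[of "S 1" x] norm_S_le_exp[of 1] mult_right_mono[of "norm (S 1)" "exp (-l)" "norm x"]
    by simp
  also have "norm (S 1 x - x) \<le> norm (frac_power S \<gamma> x)"
    using norm_S_diff_le[OF assms(1,2) _ assms(3), of 1] by simp
  finally have "norm x * (1 - exp (- l)) \<le> norm (frac_power S \<gamma> x)"
    by (simp add: algebra_simps)
  moreover have "1 - exp (- l) > 0" using l_pos by simp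
  ultimately show ?thesis by (simp add: pos_le_divide_eq)
qed

text \<open>An interpolation argument that avoids the semigroup law of fractional powers.  From
  \<open>A S(s) x - A S(2s) x = A S(s)(x - S(s) x)\<close>, the bound \<open>2/s\<close> on \<open>A S(s)\<close> and \<open>|S(s) x - x| \<le> s\<^sup>\<gamma> q\<close>
  with \<open>q = |(-A)\<^sup>\<gamma> x|\<close>, one doubling of the time costs \<open>2 s\<^sup>\<gamma>\<^sup>-\<^sup>1 q\<close>.  Along \<open>t, 2t, 4t, \<dots>\<close> these costs
  form a geometric series with ratio \<open>2\<^sup>\<gamma>\<^sup>-\<^sup>1 < 1\<close>, while \<open>A S(2\<^sup>n t) x\<close> tends to zero.\<close>

lemma norm_dS_frac_le:
  assumes \<gamma>: "0 < \<gamma>" "\<gamma> < 1" and t: "t > 0" and x: "x \<in> frac_dom S \<gamma>"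
  shows "norm (dS t x) \<le> 2 / (1 - 2 powr (\<gamma> - 1)) * t powr (\<gamma> - 1) * norm (frac_power S \<gamma> x)"
proof -
  define \<theta> where "\<theta> = (2 :: real) powr (\<gamma> - 1)"
  define q where "q = norm (frac_power S \<gamma> x)"
  have \<theta>: "0 < \<theta>" "\<theta> < 1"
    using \<gamma> powr_less_mono[of "\<gamma> - 1" 0 2] by (auto simp: \<theta>_def)
  have step: "norm (dS s x) \<le> norm (dS (2 * s) x) + 2 * s powr (\<gamma> - 1) * q" if s: "s > 0" for s
  proof -
    have eq: "dS s x = dS (2 * s) x - dS s (S s x - x)"
      using dS_add'[of s s x] s by (simp add: blinfun.diff_right)
    have "norm (dS s x) \<le> norm (dS (2 * s) x) + norm (dS s (S s x - x))"
      by (subst eq) (rule norm_triangle_ineq4)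
    also have "norm (dS s (S s x - x)) \<le> 2 * norm (S s x - x) / s"
      by (rule norm_dS_le[OF s])
    also have "\<dots> \<le> 2 * (s powr \<gamma> * q) / s"
      using norm_S_diff_le[of \<gamma> s x] \<gamma> s x
      by (intro divide_right_mono mult_left_mono) (auto simp: q_def)
    also have "\<dots> = 2 * s powr (\<gamma> - 1) * q"
      using s by (simp add: powr_diff)
    finally show ?thesis by simp
  qed
  have iter: "norm (dS t x) \<le> norm (dS (2 ^ n * t) x) + 2 * t powr (\<gamma> - 1) * q * (\<Sum>k<n. \<theta> ^ k)" for n
  proof (induction n)
    case (Suc n)
    have "(2 ^ n * t) powr (\<gamma> - 1) = \<theta> ^ n * t powr (\<gamma> - 1)"
    proof -
      have "(2 ^ n :: real) powr (\<gamma> - 1) = (2 powr real n) powr (\<gamma> - 1)"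
        by (simp add: powr_realpow)
      also have "\<dots> = 2 powr ((\<gamma> - 1) * real n)"
        by (simp only: powr_powr mult.commute)
      also have "\<dots> = \<theta> ^ n"
        by (simp add: \<theta>_def powr_power mult.commute)
      finally show ?thesis using t by (simp add: powr_mult)
    qed
    with step[of "2 ^ n * t"] t
    have "norm (dS (2 ^ n * t) x) \<le> norm (dS (2 ^ Suc n * t) x) + 2 * (\<theta> ^ n * t powr (\<gamma> - 1)) * q"
      by (simp add: mult.assoc)
    with Suc show ?case by (simp add: algebra_simps)
  qed simp
  have bound: "norm (dS t x) \<le> 2 * norm x / t * (1 / 2) ^ n + 2 * t powr (\<gamma> - 1) * q / (1 - \<theta>)" for n
  proof -
    have "(\<Sum>k<n. \<theta> ^ k) \<le> 1 / (1 - \<theta>)"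
      using \<theta> by (simp add: sum_gp_strict divide_right_mono)
    then have "2 * t powr (\<gamma> - 1) * q * (\<Sum>k<n. \<theta> ^ k) \<le> 2 * t powr (\<gamma> - 1) * q * (1 / (1 - \<theta>))"
      by (intro mult_left_mono) (auto simp: q_def)
    moreover have "norm (dS (2 ^ n * t) x) \<le> 2 * norm x / t * (1 / 2) ^ n"
      using norm_dS_le[of "2 ^ n * t" x] t by (simp add: power_divide field_simps)
    ultimately show ?thesis using iter[of n] by simp
  qed
  have "(\<lambda>n. 2 * norm x / t * (1 / 2) ^ n + 2 * t powr (\<gamma> - 1) * q / (1 - \<theta>))
      \<longlonglongrightarrow> 2 * norm x / t * 0 + 2 * t powr (\<gamma> - 1) * q / (1 - \<theta>)"
    by (intro tendsto_intros LIMSEQ_power_zero) auto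
  then have "norm (dS t x) \<le> 2 * norm x / t * 0 + 2 * t powr (\<gamma> - 1) * q / (1 - \<theta>)"
    by (rule LIMSEQ_le_const) (use bound in auto)
  then show ?thesis by (simp add: \<theta>_def q_def mult.assoc)
qed

end

section \<open>Convolution integrals with a singular kernel\<close>

lemma set_integral_reflect_interval:
  fixes f :: "real \<Rightarrow> 'a::{banach, second_countable_topology}"
  shows "(LINT r:{0..t}|lborel. f (t - r)) = (LINT s:{0..t}|lborel. f s)"
proof -
  have "(LINT s:{0..t}|lborel. f s) = (LINT r|lborel. indicator {0..t} (t + (- 1) * r) *\<^sub>R f (t + (- 1) * r))"
    unfolding set_lebesgue_integral_def by (subst lborel_integral_real_affine[where c = "- 1" and t = t]) auto
  also have "\<dots> = (LINT r:{0..t}|lborel. f (t - r))"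
    unfolding set_lebesgue_integral_def
    by (intro Bochner_Integration.integral_cong) (auto simp: indicator_def)
  finally show ?thesis by simp
qed

lemma set_integrable_reflect_interval:
  fixes f :: "real \<Rightarrow> 'a::{banach, second_countable_topology}"
  assumes "set_integrable lborel {0..t} f"
  shows "set_integrable lborel {0..t} (\<lambda>r. f (t - r))"
proof -
  have "integrable lborel (\<lambda>r. indicator {0..t} (t + (- 1) * r) *\<^sub>R f (t + (- 1) * r))"
    using lborel_integrable_real_affine[where c = "- 1" and t = t] assms
    unfolding set_integrable_def by fastforce
  also have "(\<lambda>r. indicator {0..t} (t + (- 1) * r) *\<^sub>R f (t + (- 1) * r))
      = (\<lambda>r. indicator {0..t} r *\<^sub>R f (t - r))"
    by (auto simp: indicator_def)
  finally show ?thesis unfolding set_integrable_def .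
qed

text \<open>The integrand is continuous except at the single point \<open>r = t\<close>, where the first argument of \<open>h\<close>
  is \<open>0\<close> and the kernel may be singular; the integrable kernel \<open>k\<close>
  dominates it near that point.\<close>

lemma convolution_integrable:
  fixes h :: "real \<Rightarrow> real \<Rightarrow> 'a::{banach, second_countable_topology}"
  assumes cont: "continuous_on ({0<..} \<times> {0..}) (\<lambda>(s, r). h s r)"
    and k: "set_integrable lborel {0..t} k"
    and bound: "\<And>s r. 0 < s \<Longrightarrow> 0 \<le> r \<Longrightarrow> s + r = t \<Longrightarrow> norm (h s r) \<le> C * k s"
  shows "set_integrable lborel {0..t} (\<lambda>r. h (t - r) r)"
proof (rule set_integrable_bound)
  show "set_integrable lborel {0..t} (\<lambda>r. C * k (t - r))"
    by (intro set_integrable_mult_right set_integrable_reflect_interval k)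
  show "set_borel_measurable lborel {0..t} (\<lambda>r. h (t - r) r)"
  proof (cases "t \<ge> 0")
    case True
    have "continuous_on {0..<t} (\<lambda>r. (\<lambda>(s, r). h s r) (t - r, r))"
      by (rule continuous_on_compose2[OF cont]) (auto intro!: continuous_intros)
    then have "continuous_on {0..<t} (\<lambda>r. h (t - r) r)" by simp
    from borel_measurable_continuous_on_indicator[OF _ this]
    have "(\<lambda>r. indicator {0..<t} r *\<^sub>R h (t - r) r + indicator {t} r *\<^sub>R h 0 t) \<in> borel_measurable borel"
      by (intro borel_measurable_add) auto
    also have "(\<lambda>r. indicator {0..<t} r *\<^sub>R h (t - r) r + indicator {t} r *\<^sub>R h 0 t)
        = (\<lambda>r. indicator {0..t} r *\<^sub>R h (t - r) r)"
      using True by (auto simp: fun_eq_iff indicator_def)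
    finally show ?thesis unfolding set_borel_measurable_def by simp
  qed (simp add: set_borel_measurable_def)
  show "AE r in lborel. r \<in> {0..t} \<longrightarrow> norm (h (t - r) r) \<le> norm (C * k (t - r))"
    using AE_lborel_singleton[of t]
  proof eventually_elim
    case (elim r)
    show ?case
    proof
      assume "r \<in> {0..t}"
      with elim have "norm (h (t - r) r) \<le> C * k (t - r)" by (intro bound) auto
      then show "norm (h (t - r) r) \<le> norm (C * k (t - r))" by simp
    qed
  qed
qed

text \<open>In the form \<open>\<integral>\<^sub>0\<^sup>t h(s, t - s) ds\<close> the singularity stays at \<open>s = 0\<close> when \<open>t\<close> varies, so dominated
  convergence with the fixed dominating function \<open>C k\<close> applies.\<close>

lemma convolution_continuous:
  fixes h :: "real \<Rightarrow> real \<Rightarrow> 'a::{banach, second_countable_topology}"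
  assumes cont: "continuous_on ({0<..} \<times> {0..}) (\<lambda>(s, r). h s r)"
    and k: "\<And>T. set_integrable lborel {0..T} k"
    and bound: "\<And>T. \<exists>C\<ge>0. \<forall>s\<in>{0<..T}. \<forall>r\<in>{0..T}. norm (h s r) \<le> C * k s"
  shows "continuous_on {0..} (\<lambda>t. LINT r:{0..t}|lborel. h (t - r) r)"
proof -
  have refl: "(LINT r:{0..t}|lborel. h (t - r) r) = (LINT s|lborel. indicator {0..t} s *\<^sub>R h s (t - s))" for t
    using set_integral_reflect_interval[of t "\<lambda>s. h s (t - s)"] by (simp add: set_lebesgue_integral_def)
  have int: "integrable lborel (\<lambda>s. indicator {0..t} s *\<^sub>R h s (t - s))" for t
  proof -
    obtain C where "\<forall>s\<in>{0<..t}. \<forall>r\<in>{0..t}. norm (h s r) \<le> C * k s" using bound by blast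
    then have "set_integrable lborel {0..t} (\<lambda>r. h (t - r) r)"
      by (intro convolution_integrable[OF cont k, where C = C]) auto
    from set_integrable_reflect_interval[OF this] show ?thesis
      by (simp add: set_integrable_def)
  qed
  have "(\<lambda>n. LINT s|lborel. indicator {0..x n} s *\<^sub>R h s (x n - s))
      \<longlonglongrightarrow> (LINT s|lborel. indicator {0..a} s *\<^sub>R h s (a - s))"
    if x: "\<And>n. x n \<ge> 0" "a \<ge> 0" "x \<longlonglongrightarrow> a" for x a
  proof -
    obtain T where T: "\<And>n. x n \<le> T"
      using convergent_imp_Bseq[of x] x(3) by (auto simp: convergent_def Bseq_def abs_le_iff)
    obtain C where C: "C \<ge> 0" "\<And>s r. 0 < s \<Longrightarrow> s \<le> T \<Longrightarrow> 0 \<le> r \<Longrightarrow> r \<le> T \<Longrightarrow> norm (h s r) \<le> C * k s"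
      using bound[of T] by auto
    show ?thesis
    proof (rule integral_dominated_convergence)
      show "(\<lambda>s. indicator {0..a} s *\<^sub>R h s (a - s)) \<in> borel_measurable lborel"
        "\<And>n. (\<lambda>s. indicator {0..x n} s *\<^sub>R h s (x n - s)) \<in> borel_measurable lborel"
        by (intro borel_measurable_integrable int)+
      show "integrable lborel (\<lambda>s. indicator {0..T} s *\<^sub>R (C * k s))"
        using set_integrable_mult_right[OF k[of T], of C] by (simp add: set_integrable_def)
      show "AE s in lborel. (\<lambda>n. indicator {0..x n} s *\<^sub>R h s (x n - s))
          \<longlonglongrightarrow> indicator {0..a} s *\<^sub>R h s (a - s)"
        using AE_lborel_singleton[of 0] AE_lborel_singleton[of a]
      proof eventually_elim
        case (elim s)
        \<comment> \<open>The indicator of \<open>[0, x\<^sub>n]\<close> converges except possibly at \<open>s = a\<close>, and \<open>h\<close> is continuous except at \<open>s = 0\<close>.\<close>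
        consider "s < 0" | "s > a" | "0 < s" "s < a" using elim by force
        then show ?case
        proof cases
          case 1
          then show ?thesis by simp
        next
          case 2
          then have "\<forall>\<^sub>F n in sequentially. x n < s"
            by (rule order_tendstoD(2)[OF x(3)])
          then have "\<forall>\<^sub>F n in sequentially. indicator {0..x n} s *\<^sub>R h s (x n - s) = 0"
            by eventually_elim auto
          with 2 show ?thesis by (simp add: tendsto_eventually)
        next
          case 3
          then have ev: "\<forall>\<^sub>F n in sequentially. x n > s"
            by (intro order_tendstoD(1)[OF x(3)])
          have "(\<lambda>n. (\<lambda>(s, r). h s r) (s, x n - s)) \<longlonglongrightarrow> (\<lambda>(s, r). h s r) (s, a - s)"
            by (rule continuous_on_tendsto_compose[OF cont])
              (use 3 ev in \<open>auto intro!: tendsto_intros x(3) elim!: eventually_mono\<close>)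
          then have "(\<lambda>n. h s (x n - s)) \<longlonglongrightarrow> h s (a - s)" by simp
          moreover have "\<forall>\<^sub>F n in sequentially. h s (x n - s) = indicator {0..x n} s *\<^sub>R h s (x n - s)"
            using ev by eventually_elim (use 3 in auto)
          ultimately have "(\<lambda>n. indicator {0..x n} s *\<^sub>R h s (x n - s)) \<longlonglongrightarrow> h s (a - s)"
            by (rule Lim_transform_eventually)
          then show ?thesis using 3 by simp
        qed
      qed
      show "AE s in lborel. norm (indicator {0..x n} s *\<^sub>R h s (x n - s)) \<le> indicator {0..T} s *\<^sub>R (C * k s)"
        for n
        using AE_lborel_singleton[of 0]
      proof eventually_elim
        case (elim s)
        show ?case
        proof (cases "0 \<le> s \<and> s \<le> x n")
          case True
          then show ?thesis using C(2)[of s "x n - s"] T[of n] elim x(1)[of n] by auto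
        next
          case False
          have "0 \<le> C * k s" if "0 \<le> s" "s \<le> T"
            using C(2)[of s 0] elim that norm_ge_zero[of "h s 0"]
            by (smt (verit))
          then show ?thesis using False by (auto simp: indicator_def)
        qed
      qed
    qed
  qed
  then show ?thesis
    unfolding refl by (intro continuous_on_sequentiallyI) auto
qed

lemma set_integral_mono_interval:
  fixes f :: "real \<Rightarrow> real"
  assumes "set_integrable lborel {0..T} f" "t \<le> T" "\<And>x. f x \<ge> 0"
  shows "(LINT s:{0..t}|lborel. f s) \<le> (LINT s:{0..T}|lborel. f s)"
proof -
  have "set_integrable lborel {0..t} f"
    by (rule set_integrable_subset[OF assms(1)]) (use assms(2) in auto)
  then show ?thesis
    using assms unfolding set_lebesgue_integral_def set_integrable_def
    by (intro integral_mono) (auto simp: indicator_def)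
qed

text \<open>The exponential weight factors through a convolution: \<open>\<integral>\<^sub>0\<^sup>t k(t - r) e\<^bsup>\<rho>r\<^esup> dr\<close> equals
  \<open>e\<^bsup>\<rho>t\<^esup> \<integral>\<^sub>0\<^sup>t k(s) e\<^bsup>-\<rho>s\<^esup> ds\<close>.  Separating a constant part \<open>b\<close> of the bound from the growing part
  \<open>m e\<^bsup>\<rho>r\<^esup>\<close> makes the estimate serve both for the contraction and for the dependence on data.\<close>

lemma convolution_norm_le:
  fixes f :: "real \<Rightarrow> 'a::{banach, second_countable_topology}"
  assumes f: "set_integrable lborel {0..t} f"
    and k: "set_integrable lborel {0..T} k" "\<And>s. k s \<ge> 0"
    and t: "0 \<le> t" "t \<le> T" and bm: "b \<ge> 0" "m \<ge> 0"
    and bound: "\<And>r. 0 \<le> r \<Longrightarrow> r < t \<Longrightarrow> norm (f r) \<le> k (t - r) * (b + m * exp (\<rho> * r))"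
  shows "norm (LINT r:{0..t}|lborel. f r)
    \<le> b * (LINT s:{0..T}|lborel. k s) + m * exp (\<rho> * t) * (LINT s:{0..T}|lborel. k s * exp (- \<rho> * s))"
proof -
  have kT: "set_integrable lborel {0..T} (\<lambda>s. k s * exp (- \<rho> * s))"
  proof (rule set_integrable_bound)
    show "set_integrable lborel {0..T} (\<lambda>s. k s * exp (\<bar>\<rho>\<bar> * T))"
      using k(1) by simp
    show "set_borel_measurable lborel {0..T} (\<lambda>s. k s * exp (- \<rho> * s))"
    proof -
      have "(\<lambda>s. (indicator {0..T} s *\<^sub>R k s) * exp (- \<rho> * s)) \<in> borel_measurable lborel"
        using k(1) unfolding set_integrable_def by (intro borel_measurable_times) auto
      then show ?thesis unfolding set_borel_measurable_def by (simp add: mult.assoc)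
    qed
    have "- \<rho> * s \<le> \<bar>\<rho>\<bar> * T" if "0 \<le> s" "s \<le> T" for s
      using mult_mono[of "- \<rho>" "\<bar>\<rho>\<bar>" s T] that by auto
    then show "AE s in lborel. s \<in> {0..T} \<longrightarrow> norm (k s * exp (- \<rho> * s)) \<le> norm (k s * exp (\<bar>\<rho>\<bar> * T))"
      using k(2) by (auto intro!: AE_I2 mult_left_mono simp: abs_mult)
  qed
  have sub: "{0..t} \<subseteq> {0..T}" using t by auto
  have kt: "set_integrable lborel {0..t} k" "set_integrable lborel {0..t} (\<lambda>s. k s * exp (- \<rho> * s))"
    using k(1) kT sub by (auto intro: set_integrable_subset)
  have 1: "set_integrable lborel {0..t} (\<lambda>r. b * k (t - r))"
    using set_integrable_reflect_interval[OF kt(1)] by simp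
  have 2: "set_integrable lborel {0..t} (\<lambda>r. (m * exp (\<rho> * t)) * (k (t - r) * exp (- \<rho> * (t - r))))"
    using set_integrable_reflect_interval[OF kt(2)] by (intro set_integrable_mult_right) auto
  have "norm (LINT r:{0..t}|lborel. f r) \<le> (LINT r:{0..t}|lborel. norm (f r))"
    by (rule set_integral_norm_bound[OF f])
  also have "\<dots> \<le> (LINT r:{0..t}|lborel. b * k (t - r)
      + (m * exp (\<rho> * t)) * (k (t - r) * exp (- \<rho> * (t - r))))"
  proof (rule set_integral_mono_AE)
    show "set_integrable lborel {0..t} (\<lambda>r. norm (f r))" by (rule set_integrable_norm[OF f])
    show "set_integrable lborel {0..t} (\<lambda>r. b * k (t - r)
      + (m * exp (\<rho> * t)) * (k (t - r) * exp (- \<rho> * (t - r))))"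
      by (rule set_integral_add(1)[OF 1 2])
    show "AE r\<in>{0..t} in lborel. norm (f r) \<le> b * k (t - r)
      + (m * exp (\<rho> * t)) * (k (t - r) * exp (- \<rho> * (t - r)))"
      using AE_lborel_singleton[of t]
    proof eventually_elim
      case (elim r)
      have "exp (\<rho> * t) * exp (- \<rho> * (t - r)) = exp (\<rho> * r)"
        by (simp add: exp_add[symmetric] algebra_simps)
      then show ?case using bound[of r] elim by (auto simp: algebra_simps)
    qed
  qed
  also have "\<dots> = b * (LINT s:{0..t}|lborel. k s)
      + m * exp (\<rho> * t) * (LINT s:{0..t}|lborel. k s * exp (- \<rho> * s))"
    using set_integral_reflect_interval[of t k]
      set_integral_reflect_interval[of t "\<lambda>s. k s * exp (- \<rho> * s)"]
    by (subst set_integral_add(2)[OF 1 2]) simp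
  also have "\<dots> \<le> b * (LINT s:{0..T}|lborel. k s)
      + m * exp (\<rho> * t) * (LINT s:{0..T}|lborel. k s * exp (- \<rho> * s))"
    using bm k(2) sub by (intro add_mono mult_left_mono set_integral_mono_interval[OF k(1)]
      set_integral_mono_interval[OF kT]) (auto simp: t)
  finally show ?thesis .
qed

lemma exponential_weight_small:
  fixes k :: "real \<Rightarrow> real"
  assumes k: "set_integrable lborel {0..T} k" and "\<epsilon> > 0"
  shows "\<exists>\<rho>\<ge>0. (LINT s:{0..T}|lborel. k s * exp (- \<rho> * s)) \<le> \<epsilon>"
proof -
  have meas: "(\<lambda>s. indicator {0..T} s *\<^sub>R (k s * exp (- \<rho> * s))) \<in> borel_measurable lborel" for \<rho>
  proof -
    have "(\<lambda>s. (indicator {0..T} s *\<^sub>R k s) * exp (- \<rho> * s)) \<in> borel_measurable lborel"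
      using k(1) unfolding set_integrable_def by (intro borel_measurable_times) auto
    then show ?thesis by (simp add: mult.assoc)
  qed
  have "(\<lambda>n. LINT s|lborel. indicator {0..T} s *\<^sub>R (k s * exp (- real n * s)))
      \<longlonglongrightarrow> (LINT s::real|lborel. 0::real)"
  proof (rule integral_dominated_convergence)
    show "integrable lborel (\<lambda>s. norm (indicator {0..T} s *\<^sub>R k s))"
      using k unfolding set_integrable_def by (rule integrable_norm)
    show "AE s in lborel. (\<lambda>n. indicator {0..T} s *\<^sub>R (k s * exp (- real n * s))) \<longlonglongrightarrow> 0"
      using AE_lborel_singleton[of 0]
    proof eventually_elim
      case (elim s)
      show ?case
      proof (cases "s > 0")
        case True
        then have "(\<lambda>n. exp (- s) ^ n) \<longlonglongrightarrow> 0"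
          by (intro LIMSEQ_power_zero) auto
        then have "(\<lambda>n. exp (- real n * s)) \<longlonglongrightarrow> 0"
          by (simp add: exp_of_nat_mult[symmetric] mult.commute)
        then have "(\<lambda>n. indicator {0..T} s *\<^sub>R (k s * exp (- real n * s))) \<longlonglongrightarrow> indicator {0..T} s *\<^sub>R (k s * 0)"
          by (intro tendsto_intros)
        then show ?thesis by simp
      qed (use elim in auto)
    qed
    show "AE s in lborel. norm (indicator {0..T} s *\<^sub>R (k s * exp (- real n * s)))
        \<le> norm (indicator {0..T} s *\<^sub>R k s)" for n
      by (auto intro!: AE_I2 mult_left_le simp: indicator_def abs_mult)
  qed (use meas in auto)
  then have "(\<lambda>n. LINT s:{0..T}|lborel. k s * exp (- real n * s)) \<longlonglongrightarrow> 0"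
    by (simp add: set_lebesgue_integral_def)
  from order_tendstoD(2)[OF this \<open>\<epsilon> > 0\<close>]
  obtain n where "(LINT s:{0..T}|lborel. k s * exp (- real n * s)) < \<epsilon>"
    by (auto simp: eventually_sequentially)
  then show ?thesis by (intro exI[of _ "real n"]) auto
qed

lemma set_integrable_powr_kernel:
  fixes \<gamma> :: real
  assumes "\<gamma> > 0"
  shows "set_integrable lborel {0..T} (\<lambda>s. 1 + s powr (\<gamma> - 1))"
proof (cases "T \<ge> 0")
  case True
  have "(\<lambda>s. s powr (\<gamma> - 1)) absolutely_integrable_on {0..T}"
    using integrable_on_powr_from_0[of "\<gamma> - 1" T] assms True
    by (subst absolutely_integrable_on_iff_nonneg) auto
  then have "set_integrable lborel {0..T} (\<lambda>s. s powr (\<gamma> - 1))"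
    unfolding set_integrable_def by (subst (asm) integrable_completion) (auto intro!: measurable_If)
  moreover have "set_integrable lborel {0..T} (\<lambda>s. 1::real)"
    by (intro borel_integrable_atLeastAtMost') auto
  ultimately show ?thesis
    by (intro set_integral_add(1))
qed (simp add: set_integrable_def)

text \<open>For a derivative that may be unbounded at \<open>t\<close> the Bochner integral is compared with the gauge
  integral, for which the fundamental theorem needs the derivative only in the interior.  Pairing with
  an arbitrary vector reduces the claim to real-valued functions.\<close>

lemma set_integral_FTC:
  fixes f :: "real \<Rightarrow> 'a::{real_inner, banach, second_countable_topology}"
  assumes t: "0 \<le> t" and cont: "continuous_on {0..t} f"
    and der: "\<And>r. 0 < r \<Longrightarrow> r < t \<Longrightarrow> (f has_vector_derivative f' r) (at r)"
    and int: "set_integrable lborel {0..t} f'"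
  shows "(LINT r:{0..t}|lborel. f' r) = f t - f 0"
proof (subst vector_eq_ldot[symmetric], rule allI)
  fix z
  have "((\<lambda>r. inner z (f' r)) has_integral inner z (f t) - inner z (f 0)) {0..t}"
  proof (rule fundamental_theorem_of_calculus_interior[OF t])
    show "continuous_on {0..t} (\<lambda>r. inner z (f r))"
      by (intro continuous_intros cont)
    show "((\<lambda>r. inner z (f r)) has_vector_derivative inner z (f' r)) (at r)" if "r \<in> {0<..<t}" for r
      using bounded_linear.has_vector_derivative[OF bounded_linear_inner_right der] that by auto
  qed
  then have "integral {0..t} (\<lambda>r. inner z (f' r)) = inner z (f t) - inner z (f 0)"
    by (rule integral_unique)
  moreover have "set_integrable lborel {0..t} (\<lambda>r. inner z (f' r))"
    using integrable_inner_right[OF int[unfolded set_integrable_def], of z]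
    by (simp add: set_integrable_def)
  ultimately have "(LINT r:{0..t}|lborel. inner z (f' r)) = inner z (f t) - inner z (f 0)"
    by (simp add: set_borel_integral_eq_integral(2))
  then show "inner z (LINT r:{0..t}|lborel. f' r) = inner z (f t - f 0)"
    using integral_inner_right[OF int[unfolded set_integrable_def], of z]
    by (simp add: set_lebesgue_integral_def inner_diff_right)
qed

lemma set_integral_Icc_Ico:
  fixes f :: "real \<Rightarrow> 'a::{banach, second_countable_topology}"
  shows "(LINT r:{a..b}|lborel. f r) = (LINT r:{a..<b}|lborel. f r)"
  by (rule set_integral_discrete_difference[where X = "{b}"]) auto

lemma set_integrable_Icc_Ico:
  fixes f :: "real \<Rightarrow> 'a::{banach, second_countable_topology}"
  shows "set_integrable lborel {a..b} f \<longleftrightarrow> set_integrable lborel {a..<b} f"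
  by (rule set_integrable_discrete_difference[where X = "{b}"]) auto

lemma set_integral_split_shift:
  fixes f :: "real \<Rightarrow> 'a::{banach, second_countable_topology}"
  assumes "0 \<le> a" "0 \<le> t" and f: "set_integrable lborel {0..a + t} f"
  shows "(LINT r:{0..a + t}|lborel. f r) = (LINT r:{0..a}|lborel. f r) + (LINT r:{0..t}|lborel. f (r + a))"
proof -
  have sub: "{0..<a} \<subseteq> {0..a + t}" "{a..a + t} \<subseteq> {0..a + t}" using assms by auto
  have "(LINT r:{0..<a} \<union> {a..a + t}|lborel. f r) = (LINT r:{0..<a}|lborel. f r) + (LINT r:{a..a + t}|lborel. f r)"
    using sub by (intro set_integral_Un set_integrable_subset[OF f]) auto
  also have "{0..<a} \<union> {a..a + t} = {0..a + t}" using assms by auto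
  also have "(LINT r:{a..a + t}|lborel. f r) = (LINT r:{0..t}|lborel. f (r + a))"
    unfolding set_lebesgue_integral_def
    by (subst lborel_integral_real_affine[where c = 1 and t = a])
      (auto intro!: Bochner_Integration.integral_cong simp: indicator_def add.commute)
  finally show ?thesis by (simp add: set_integral_Icc_Ico[symmetric])
qed

lemma blinfun_set_integral:
  fixes T :: "'a::{banach, second_countable_topology} \<Rightarrow>\<^sub>L 'b::{banach, second_countable_topology}"
  assumes "set_integrable lborel X f"
  shows "T (LINT r:X|lborel. f r) = (LINT r:X|lborel. T (f r))"
  using integral_bounded_linear[OF blinfun.bounded_linear_right assms[unfolded set_integrable_def], of T]
  by (simp add: set_lebesgue_integral_def blinfun.bilinear_simps)

section \<open>The delay space\<close>

text \<open>Continuous functions on the compact interval \<open>[-\<mu>, 0]\<close> are bounded.\<close>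

lemma mspace_delay_space:
  "x \<in> mspace (delay_space \<mu>) \<longleftrightarrow> x \<in> extensional {-\<mu>..0} \<and> continuous_on {-\<mu>..0} x"
proof -
  have "compactin (top_of_set {-\<mu>..0}) (topspace (top_of_set {-\<mu>..0}))"
    by (simp add: compactin_subtopology)
  from compactin_mspace_cfunspace[OF this] show ?thesis
    unfolding delay_space_def
    by (auto simp: compact_imp_bounded compact_continuous_image)
qed

lemma mdist_delay_space_le:
  assumes "\<mu> \<ge> 0" "x \<in> mspace (delay_space \<mu>)" "y \<in> mspace (delay_space \<mu>)"
  shows "mdist (delay_space \<mu>) x y \<le> a \<longleftrightarrow> (\<forall>s\<in>{-\<mu>..0}. dist (x s) (y s) \<le> a)"
  using assms unfolding delay_space_def by (subst cfunspace_mdist_le) auto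

lemma dist_le_mdist_delay_space:
  assumes "\<mu> \<ge> 0" "x \<in> mspace (delay_space \<mu>)" "y \<in> mspace (delay_space \<mu>)" "s \<in> {-\<mu>..0}"
  shows "dist (x s) (y s) \<le> mdist (delay_space \<mu>) x y"
  using mdist_delay_space_le[OF assms(1-3), of "mdist (delay_space \<mu>) x y"] assms(4) by simp

lemma segment_apply: "s \<in> {-\<mu>..0} \<Longrightarrow> segment \<mu> u t s = u (t + s)"
  by (simp add: segment_def)

lemma segment_in_delay_space:
  fixes u :: "real \<Rightarrow> 'a::metric_space"
  assumes "continuous_on {t - \<mu>..t} u"
  shows "segment \<mu> u t \<in> mspace (delay_space \<mu>)"
proof -
  have "continuous_on {-\<mu>..0} (\<lambda>s. u (t + s))"
    by (rule continuous_on_compose2[OF assms]) (auto intro!: continuous_intros)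
  then show ?thesis
    unfolding mspace_delay_space segment_def by (auto intro: continuous_on_eq)
qed

lemma segment_zero: "x \<in> extensional {-\<mu>..0} \<Longrightarrow> (\<And>s. s \<in> {-\<mu>..0} \<Longrightarrow> u s = x s) \<Longrightarrow> segment \<mu> u 0 = x"
  by (auto simp: segment_def extensional_def restrict_def fun_eq_iff)

text \<open>Uniform continuity of \<open>u\<close> on the compact interval \<open>[-\<mu>, t + 1]\<close>.\<close>

lemma mdist_segment_continuous:
  fixes u :: "real \<Rightarrow> 'a::metric_space"
  assumes \<mu>: "\<mu> \<ge> 0" and u: "continuous_on {-\<mu>..} u" and t: "t \<ge> 0" and e: "e > 0"
  shows "\<exists>d>0. \<forall>t'\<ge>0. \<bar>t' - t\<bar> < d \<longrightarrow>
    mdist (delay_space \<mu>) (segment \<mu> u t') (segment \<mu> u t) \<le> e"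
proof -
  have seg: "segment \<mu> u t \<in> mspace (delay_space \<mu>)" if "t \<ge> 0" for t
    using that by (intro segment_in_delay_space continuous_on_subset[OF u]) auto
  have "uniformly_continuous_on {-\<mu>..t + 1} u"
    by (intro compact_uniformly_continuous continuous_on_subset[OF u]) auto
  then obtain d where d: "d > 0"
    "\<And>x x'. x \<in> {-\<mu>..t + 1} \<Longrightarrow> x' \<in> {-\<mu>..t + 1} \<Longrightarrow> dist x' x < d \<Longrightarrow> dist (u x') (u x) < e"
    using e unfolding uniformly_continuous_on_def by metis
  show ?thesis
  proof (intro exI[of _ "min d 1"] conjI allI impI)
    fix t' assume t': "t' \<ge> 0" "\<bar>t' - t\<bar> < min d 1"
    then show "mdist (delay_space \<mu>) (segment \<mu> u t') (segment \<mu> u t) \<le> e"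
      using t d(2) by (auto simp: mdist_delay_space_le[OF \<mu> seg seg] segment_apply dist_real_def
          intro!: less_imp_le)
  qed (use d in auto)
qed

lemma continuous_on_along_segments:
  fixes u :: "real \<Rightarrow> 'a::metric_space" and f :: "_ \<Rightarrow> 'b::metric_space"
  assumes \<mu>: "\<mu> \<ge> 0" and u: "continuous_on {-\<mu>..} u"
    and f: "\<And>x y. x \<in> mspace (delay_space \<mu>) \<Longrightarrow> y \<in> mspace (delay_space \<mu>) \<Longrightarrow>
        dist (f x) (f y) \<le> c * mdist (delay_space \<mu>) x y"
  shows "continuous_on {0..} (\<lambda>t. f (segment \<mu> u t))"
  unfolding continuous_on_iff
proof (intro ballI allI impI)
  fix t e :: real assume t: "t \<in> {0..}" and e: "e > 0"
  have seg: "segment \<mu> u t \<in> mspace (delay_space \<mu>)" if "t \<ge> 0" for t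
    using that by (intro segment_in_delay_space continuous_on_subset[OF u]) auto
  define e' where "e' = e / (2 * (\<bar>c\<bar> + 1))"
  have e': "e' > 0" using e by (simp add: e'_def)
  obtain d where d: "d > 0" "\<And>t'. t' \<ge> 0 \<Longrightarrow> \<bar>t' - t\<bar> < d \<Longrightarrow>
    mdist (delay_space \<mu>) (segment \<mu> u t') (segment \<mu> u t) \<le> e'"
    using mdist_segment_continuous[OF \<mu> u _ e'] t by auto
  show "\<exists>d>0. \<forall>x'\<in>{0..}. dist x' t < d \<longrightarrow> dist (f (segment \<mu> u x')) (f (segment \<mu> u t)) < e"
  proof (intro exI[of _ d] conjI ballI impI)
    fix x' assume x': "x' \<in> {0..}" "dist x' t < d"
    have "dist (f (segment \<mu> u x')) (f (segment \<mu> u t))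
        \<le> c * mdist (delay_space \<mu>) (segment \<mu> u x') (segment \<mu> u t)"
      using x' t by (intro f seg) auto
    also have "\<dots> \<le> (\<bar>c\<bar> + 1) * e'"
      using d(2)[of x'] x' by (intro mult_mono) (auto simp: dist_real_def)
    also have "\<dots> < e" using e by (simp add: e'_def field_simps add_pos_nonneg)
    finally show "dist (f (segment \<mu> u x')) (f (segment \<mu> u t)) < e" .
  qed (use d in auto)
qed

section \<open>The abstract delay equation\<close>

lemma continuous_on_Ici_if_Icc:
  fixes f :: "real \<Rightarrow> 'a::topological_space"
  assumes "\<And>T. continuous_on {a..T} f"
  shows "continuous_on {a..} f"
  unfolding continuous_on_eq_continuous_within
proof
  fix x assume x: "x \<in> {a..}"
  have "continuous (at x within {a..x + 1}) f"
    using assms[of "x + 1"] x by (simp add: continuous_on_eq_continuous_within)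
  moreover have "at x within {a..x + 1} = at x within {a..}"
    by (rule at_within_nhd[of _ "{..<x + 1}"]) auto
  ultimately show "continuous (at x within {a..}) f" by simp
qed

text \<open>The properties of the semigroup and the coefficients from which existence, uniqueness, the cocycle
  property and measurability follow, with all Lipschitz constants merged into one \<open>c\<close>.  The operator
  \<open>dS t\<close> stands for \<open>A S(t)\<close>; fractional powers are present only through the exponent \<open>\<nu> - 1\<close> of the
  singularity of \<open>dS t (G x v)\<close>.\<close>

locale delay_equation =
  fixes \<mu> \<nu> c :: real
    and A :: "'h::{real_inner, banach, second_countable_topology} \<Rightarrow> 'h"
    and S dS :: "real \<Rightarrow> 'h \<Rightarrow>\<^sub>L 'h"
    and F :: "(real \<Rightarrow> 'h) \<Rightarrow> 'h"
    and G K :: "(real \<Rightarrow> 'h) \<Rightarrow> 'u::{real_inner, banach, second_countable_topology} \<Rightarrow>\<^sub>L 'h"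
  assumes mu: "\<mu> > 0" and nu: "\<nu> > 0" and c_nonneg: "c \<ge> 0"
    and S_0: "S 0 = id_blinfun"
    and S_add: "\<And>s t x. s \<ge> 0 \<Longrightarrow> t \<ge> 0 \<Longrightarrow> S (s + t) x = S s (S t x)"
    and norm_S: "\<And>t. t \<ge> 0 \<Longrightarrow> norm (S t) \<le> 1"
    and S_cont: "\<And>x. continuous_on {0..} (\<lambda>t. S t x)"
    and S_deriv: "\<And>t. t > 0 \<Longrightarrow> (S has_vector_derivative dS t) (at t)"
    and dS_cont: "continuous_on {0<..} dS"
    and A_S: "\<And>t x. t > 0 \<Longrightarrow> A (S t x) = dS t x"
    and dS_add: "\<And>s t x. s > 0 \<Longrightarrow> t \<ge> 0 \<Longrightarrow> dS (t + s) x = S t (dS s x)"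
    and F_lip: "\<And>x y. x \<in> mspace (delay_space \<mu>) \<Longrightarrow> y \<in> mspace (delay_space \<mu>) \<Longrightarrow>
          norm (F x - F y) \<le> c * mdist (delay_space \<mu>) x y"
    and K_lip: "\<And>x y. x \<in> mspace (delay_space \<mu>) \<Longrightarrow> y \<in> mspace (delay_space \<mu>) \<Longrightarrow>
          norm (K x - K y) \<le> c * mdist (delay_space \<mu>) x y"
    and G_lip: "\<And>x y. x \<in> mspace (delay_space \<mu>) \<Longrightarrow> y \<in> mspace (delay_space \<mu>) \<Longrightarrow>
          norm (G x - G y) \<le> c * mdist (delay_space \<mu>) x y"
    and dS_G_lip: "\<And>x y t v. x \<in> mspace (delay_space \<mu>) \<Longrightarrow> y \<in> mspace (delay_space \<mu>) \<Longrightarrow> t > 0 \<Longrightarrow>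
          norm (dS t ((G x - G y) v)) \<le> c * t powr (\<nu> - 1) * mdist (delay_space \<mu>) x y * norm v"
    and dS_G_bound: "\<And>x. x \<in> mspace (delay_space \<mu>) \<Longrightarrow>
          \<exists>M. \<forall>t>0. \<forall>v. norm (dS t (G x v)) \<le> M * t powr (\<nu> - 1) * norm v"
    and G_C1: "\<And>T u. T > 0 \<Longrightarrow> continuous_on {-\<mu>..T} u \<Longrightarrow>
          (\<forall>t\<in>{0..T}. ((\<lambda>t. G (segment \<mu> u t)) has_vector_derivative K (segment \<mu> u t))
             (at t within {0..T}))"
begin

abbreviation V :: "(real \<Rightarrow> 'h) metric" where "V \<equiv> delay_space \<mu>"
abbreviation seg :: "(real \<Rightarrow> 'h) \<Rightarrow> real \<Rightarrow> (real \<Rightarrow> 'h)" where "seg \<equiv> segment \<mu>"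
abbreviation "rhs \<equiv> mild_rhs \<mu> A S F G K"
abbreviation "sol \<equiv> global_mild_solution \<mu> A S F G K"

text \<open>The common kernel of all Volterra terms: the constant \<open>1\<close> dominates those with \<open>S\<close>, the power those
  with \<open>A S\<close>.\<close>

definition kern :: "real \<Rightarrow> real" where "kern s = 1 + s powr (\<nu> - 1)"

lemma kern_ge: "kern s \<ge> 1" "kern s \<ge> 0" "kern s \<ge> s powr (\<nu> - 1)"
  by (simp_all add: kern_def)

lemma kern_integrable: "set_integrable lborel {0..T} kern"
  unfolding kern_def[abs_def] by (rule set_integrable_powr_kernel[OF nu])

lemma seg_in_V: "continuous_on {-\<mu>..} u \<Longrightarrow> t \<ge> 0 \<Longrightarrow> seg u t \<in> mspace V"
  by (rule segment_in_delay_space, erule continuous_on_subset) auto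

lemma norm_S_apply: "t \<ge> 0 \<Longrightarrow> norm (S t x) \<le> norm x"
  using norm_blinfun[of "S t" x] norm_S[of t] mult_right_mono[of "norm (S t)" 1 "norm x"]
  by simp

lemma S_cont_pos: "continuous_on {0<..} S"
  by (intro continuous_at_imp_continuous_on ballI has_vector_derivative_continuous)
     (auto intro: S_deriv)

lemma F_cont: "continuous_on {-\<mu>..} u \<Longrightarrow> continuous_on {0..} (\<lambda>t. F (seg u t))"
  using mu F_lip by (intro continuous_on_along_segments[where c = c]) (auto simp: dist_norm)

lemma G_cont: "continuous_on {-\<mu>..} u \<Longrightarrow> continuous_on {0..} (\<lambda>t. G (seg u t))"
  using mu G_lip by (intro continuous_on_along_segments[where c = c]) (auto simp: dist_norm)

lemma K_cont: "continuous_on {-\<mu>..} u \<Longrightarrow> continuous_on {0..} (\<lambda>t. K (seg u t))"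
  using mu K_lip by (intro continuous_on_along_segments[where c = c]) (auto simp: dist_norm)

lemma G_deriv:
  assumes u: "continuous_on {-\<mu>..} u" and t: "t > 0"
  shows "((\<lambda>t. G (seg u t)) has_vector_derivative K (seg u t)) (at t)"
proof -
  have "((\<lambda>t. G (seg u t)) has_vector_derivative K (seg u t)) (at t within {0..t + 1})"
    using G_C1[of "t + 1" u] continuous_on_subset[OF u, of "{-\<mu>..t+1}"] t by auto
  then show ?thesis
    using t by (simp add: at_within_Icc_at)
qed

lemma bounded_on_interval:
  assumes "continuous_on {0..} f" shows "\<exists>M\<ge>0. \<forall>r\<in>{0..T::real}. norm (f r :: 'b::real_normed_vector) \<le> M"
proof -
  have "bounded (f ` {0..T})"
    by (intro compact_imp_bounded compact_continuous_image continuous_on_subset[OF assms]) auto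
  then obtain M where "M > 0" "\<forall>x\<in>f ` {0..T}. norm x \<le> M"
    unfolding bounded_pos by blast
  then show ?thesis by (intro exI[of _ M]) auto
qed

text \<open>The bound on \<open>dS s (G(u\<^sub>r) v)\<close> is uniform in \<open>r\<close> because it holds at \<open>r = 0\<close> and is Lipschitz in the
  segment, whose distance to the initial segment is bounded on \<open>[0, T]\<close>.\<close>

lemma path_bounds:
  assumes u: "continuous_on {-\<mu>..} u"
  shows "\<exists>M\<ge>0. \<forall>r\<in>{0..T}. norm (G (seg u r)) \<le> M \<and> norm (K (seg u r)) \<le> M \<and>
    (\<forall>s>0. \<forall>v. norm (dS s (G (seg u r) v)) \<le> M * s powr (\<nu> - 1) * norm v)"
proof -
  obtain M2 where M2: "M2 \<ge> 0" "\<And>r. r \<in> {0..T} \<Longrightarrow> norm (G (seg u r)) \<le> M2"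
    using bounded_on_interval[OF G_cont[OF u], of T] by auto
  obtain M3 where M3: "M3 \<ge> 0" "\<And>r. r \<in> {0..T} \<Longrightarrow> norm (K (seg u r)) \<le> M3"
    using bounded_on_interval[OF K_cont[OF u], of T] by auto
  obtain M4 where M4: "\<And>t v. t > 0 \<Longrightarrow> norm (dS t (G (seg u 0) v)) \<le> M4 * t powr (\<nu> - 1) * norm v"
    using dS_G_bound[OF seg_in_V[OF u, of 0]] by auto
  have "bounded (u ` {-\<mu>..T})"
    by (intro compact_imp_bounded compact_continuous_image continuous_on_subset[OF u]) auto
  then obtain b where b: "b > 0" "\<And>x. x \<in> {-\<mu>..T} \<Longrightarrow> norm (u x) \<le> b"
    unfolding bounded_pos by auto
  have d: "mdist V (seg u r) (seg u 0) \<le> 2 * b" if "r \<in> {0..T}" for r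
  proof (subst mdist_delay_space_le)
    show "\<forall>s\<in>{-\<mu>..0}. dist (seg u r s) (seg u 0 s) \<le> 2 * b"
    proof
      fix s assume s: "s \<in> {-\<mu>..0}"
      have "norm (u (r + s) - u s) \<le> norm (u (r + s)) + norm (u s)"
        by (rule norm_triangle_ineq4)
      also have "\<dots> \<le> b + b" using that s by (intro add_mono b) auto
      finally show "dist (seg u r s) (seg u 0 s) \<le> 2 * b"
        using s by (simp add: segment_apply dist_norm)
    qed
  qed (use mu that in \<open>auto intro!: seg_in_V u\<close>)
  have dSG: "norm (dS s (G (seg u r) v)) \<le> (c * (2 * b) + \<bar>M4\<bar>) * s powr (\<nu> - 1) * norm v"
    if "r \<in> {0..T}" "s > 0" for r s v
  proof -
    have eq: "dS s (G (seg u r) v) = dS s ((G (seg u r) - G (seg u 0)) v) + dS s (G (seg u 0) v)"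
      by (simp add: blinfun.bilinear_simps)
    have "norm (dS s (G (seg u r) v)) \<le> norm (dS s ((G (seg u r) - G (seg u 0)) v)) + norm (dS s (G (seg u 0) v))"
      by (subst eq) (rule norm_triangle_ineq)
    also have "\<dots> \<le> c * s powr (\<nu> - 1) * mdist V (seg u r) (seg u 0) * norm v + M4 * s powr (\<nu> - 1) * norm v"
      using that by (intro add_mono dS_G_lip M4 seg_in_V u) auto
    also have "\<dots> \<le> c * s powr (\<nu> - 1) * (2 * b) * norm v + \<bar>M4\<bar> * s powr (\<nu> - 1) * norm v"
      using d[OF that(1)] c_nonneg by (intro add_mono mult_right_mono mult_left_mono) auto
    finally show ?thesis by (simp add: algebra_simps)
  qed
  define M where "M = M2 + M3 + (c * (2 * b) + \<bar>M4\<bar>)"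
  have M: "M \<ge> M2" "M \<ge> M3" "M \<ge> c * (2 * b) + \<bar>M4\<bar>" "M \<ge> 0"
    using M2 M3 c_nonneg b by (auto simp: M_def)
  show ?thesis
  proof (intro exI[of _ M] conjI ballI allI impI)
    fix r assume r: "r \<in> {0..T}"
    show "norm (G (seg u r)) \<le> M" "norm (K (seg u r)) \<le> M"
      using M2(2)[OF r] M3(2)[OF r] M by auto
    fix s :: real and v assume "s > 0"
    from dSG[OF r this, of v] show "norm (dS s (G (seg u r) v)) \<le> M * s powr (\<nu> - 1) * norm v"
      by (rule order_trans) (intro mult_right_mono M, auto)
  qed (use M in auto)
qed

lemma S_conv_cont:
  assumes "continuous_on {0..} x"
  shows "continuous_on ({0<..} \<times> {0..}) (\<lambda>(s, r). S s (x r))"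
  unfolding case_prod_beta
  by (intro continuous_intros continuous_on_compose2[OF S_cont_pos] continuous_on_compose2[OF assms])
    auto

lemma dS_conv_cont:
  "continuous_on {0..} x \<Longrightarrow> continuous_on ({0<..} \<times> {0..}) (\<lambda>(s, r). A (S s (x r)))"
proof -
  assume x: "continuous_on {0..} x"
  have "continuous_on ({0<..} \<times> {0..}) (\<lambda>(s, r). dS s (x r))"
    unfolding case_prod_beta
    by (intro continuous_intros continuous_on_compose2[OF dS_cont] continuous_on_compose2[OF x])
      auto
  then show ?thesis
    by (rule continuous_on_eq) (auto simp: A_S)
qed

lemma S_conv_bound:
  assumes "continuous_on {0..} x"
  shows "\<exists>C\<ge>0. \<forall>s\<in>{0<..T}. \<forall>r\<in>{0..T}. norm (S s (x r)) \<le> C * kern s"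
proof -
  obtain M where M: "M \<ge> 0" "\<And>r. r \<in> {0..T} \<Longrightarrow> norm (x r) \<le> M"
    using bounded_on_interval[OF assms, of T] by auto
  have "norm (S s (x r)) \<le> M * kern s" if "s \<in> {0<..T}" "r \<in> {0..T}" for s r
  proof -
    have "norm (S s (x r)) \<le> norm (x r)" using that by (intro norm_S_apply) auto
    also have "\<dots> \<le> M * 1" using M that by auto
    also have "\<dots> \<le> M * kern s" using M kern_ge by (intro mult_left_mono) auto
    finally show ?thesis .
  qed
  then show ?thesis using M(1) by blast
qed

lemma dS_conv_bound:
  assumes u: "continuous_on {-\<mu>..} u" and w: "continuous_on {0..} w"
  shows "\<exists>C\<ge>0. \<forall>s\<in>{0<..T}. \<forall>r\<in>{0..T}. norm (A (S s (G (seg u r) (w r)))) \<le> C * kern s"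
proof -
  obtain M where M: "M \<ge> 0" "\<And>r s v. r \<in> {0..T} \<Longrightarrow> s > 0 \<Longrightarrow>
      norm (dS s (G (seg u r) v)) \<le> M * s powr (\<nu> - 1) * norm v"
    using path_bounds[OF u, of T] by blast
  obtain R where R: "R \<ge> 0" "\<And>r. r \<in> {0..T} \<Longrightarrow> norm (w r) \<le> R"
    using bounded_on_interval[OF w, of T] by auto
  have "norm (A (S s (G (seg u r) (w r)))) \<le> (M * R) * kern s" if "s \<in> {0<..T}" "r \<in> {0..T}" for s r
  proof -
    have "norm (A (S s (G (seg u r) (w r)))) \<le> M * s powr (\<nu> - 1) * norm (w r)"
      using that M(2) by (simp add: A_S)
    also have "\<dots> \<le> M * kern s * R"
      using M(1) R that kern_ge by (intro mult_mono) auto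
    finally show ?thesis by (simp add: mult_ac)
  qed
  then show ?thesis using M(1) R(1) by (intro exI[of _ "M * R"]) auto
qed

context
  fixes u :: "real \<Rightarrow> 'h" and w :: "real \<Rightarrow> 'u"
  assumes u: "continuous_on {-\<mu>..} u" and w: "continuous_on {0..} w"
begin

lemma G_w_cont: "continuous_on {0..} (\<lambda>r. G (seg u r) (w r))"
  by (intro continuous_intros G_cont u w)

lemma K_w_cont: "continuous_on {0..} (\<lambda>r. K (seg u r) (w r))"
  by (intro continuous_intros K_cont u w)

lemma S_conv_integrable:
  assumes x: "continuous_on {0..} x"
  shows "set_integrable lborel {0..t} (\<lambda>r. S (t - r) (x r))"
proof -
  obtain C where "\<forall>s\<in>{0<..t}. \<forall>r\<in>{0..t}. norm (S s (x r)) \<le> C * kern s"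
    using S_conv_bound[OF x, of t] by blast
  then show ?thesis
    by (intro convolution_integrable[OF S_conv_cont[OF x] kern_integrable, where C = C]) auto
qed

lemma A_conv_integrable:
  "set_integrable lborel {0..t} (\<lambda>r. A (S (t - r) (G (seg u r) (w r))))"
proof -
  obtain C where "\<forall>s\<in>{0<..t}. \<forall>r\<in>{0..t}. norm (A (S s (G (seg u r) (w r)))) \<le> C * kern s"
    using dS_conv_bound[OF u w, of t] by blast
  then show ?thesis
    by (intro convolution_integrable[OF dS_conv_cont[OF G_w_cont] kern_integrable, where C = C]) auto
qed

lemma rhs_cont: "continuous_on {0..} (rhs w \<xi> u)"
  unfolding mild_rhs_def
  by (intro continuous_intros S_cont G_cont u w
      convolution_continuous[OF S_conv_cont[OF F_cont[OF u]] kern_integrable S_conv_bound[OF F_cont[OF u]]]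
      convolution_continuous[OF S_conv_cont[OF K_w_cont] kern_integrable S_conv_bound[OF K_w_cont]]
      convolution_continuous[OF dS_conv_cont[OF G_w_cont] kern_integrable dS_conv_bound[OF u w]])

end

lemma rhs_0:
  assumes "w 0 = 0" shows "rhs w \<xi> u 0 = \<xi> 0"
proof -
  have "(LINT r:{0..0}|lborel. f r) = 0" for f :: "real \<Rightarrow> 'h"
    unfolding set_lebesgue_integral_def
    by (rule integral_eq_zero_AE) (use AE_lborel_singleton[of 0] in eventually_elim, auto)
  then show ?thesis using assms by (simp add: mild_rhs_def S_0)
qed

text \<open>The integrability conditions in the notion of solution hold for every continuous path, so only the
  fixed point equation remains.\<close>

lemma sol_iff:
  assumes w: "continuous_on {0..} w"
  shows "sol w \<xi> u \<longleftrightarrow> u \<in> extensional {-\<mu>..} \<and> continuous_on {-\<mu>..} u \<and>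
    (\<forall>s\<in>{-\<mu>..0}. u s = \<xi> s) \<and> (\<forall>t\<ge>0. u t = rhs w \<xi> u t)"
  unfolding global_mild_solution_def
  using S_conv_integrable F_cont A_conv_integrable K_w_cont w by blast

text \<open>The step that makes the equation a Volterra equation: after the values at time \<open>0\<close> are split off, the
  difference \<open>G(u\<^sub>t) - G(v\<^sub>t)\<close> is an integral over the past of \<open>[0, t]\<close>.\<close>

lemma G_increment_diff:
  assumes u: "continuous_on {-\<mu>..} u" and v: "continuous_on {-\<mu>..} v" and t: "t \<ge> 0"
  shows "set_integrable lborel {0..t} (\<lambda>r. (K (seg u r) - K (seg v r)) y)"
    and "(G (seg u t) - G (seg v t)) y
      = (G (seg u 0) - G (seg v 0)) y + (LINT r:{0..t}|lborel. (K (seg u r) - K (seg v r)) y)"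
proof -
  show int: "set_integrable lborel {0..t} (\<lambda>r. (K (seg u r) - K (seg v r)) y)"
    by (intro borel_integrable_atLeastAtMost' continuous_intros
        continuous_on_subset[OF K_cont[OF u]] continuous_on_subset[OF K_cont[OF v]]) auto
  have "(LINT r:{0..t}|lborel. (K (seg u r) - K (seg v r)) y)
      = (G (seg u t) - G (seg v t)) y - (G (seg u 0) - G (seg v 0)) y"
  proof (rule set_integral_FTC[OF t _ _ int])
    show "continuous_on {0..t} (\<lambda>r. (G (seg u r) - G (seg v r)) y)"
      by (intro continuous_intros
        continuous_on_subset[OF G_cont[OF u]] continuous_on_subset[OF G_cont[OF v]]) auto
    show "((\<lambda>r. (G (seg u r) - G (seg v r)) y) has_vector_derivative (K (seg u r) - K (seg v r)) y) (at r)"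
      if "0 < r" for r
      by (intro bounded_linear.has_vector_derivative[OF blinfun.bounded_linear_left]
          has_vector_derivative_diff G_deriv u v that)
  qed
  then show "(G (seg u t) - G (seg v t)) y
      = (G (seg u 0) - G (seg v 0)) y + (LINT r:{0..t}|lborel. (K (seg u r) - K (seg v r)) y)"
    by simp
qed

section \<open>Dependence on data, uniqueness and existence\<close>

lemma norm_triangle_seven:
  fixes x1 :: "'a::real_normed_vector"
  shows "norm (x1 + x2 + (x3 + x4) + x5 + x6 - x7)
    \<le> norm x1 + norm x2 + (norm x3 + norm x4) + norm x5 + norm x6 + norm x7"
  by norm

text \<open>The central inequality.  Here \<open>a\<close> bounds the difference of the histories, \<open>\<delta>\<close> that of the noise
  paths and \<open>m e\<^bsup>\<rho>r\<^esup>\<close> that of the unknowns, \<open>R\<close> bounds the noise \<open>w'\<close> and \<open>M\<close> the coefficients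
  along \<open>u\<close> only.  Every product is split as \<open>X w - X' w' = (X - X') w' + X (w - w')\<close> so that the coefficients
  are evaluated along \<open>u\<close> or occur as differences.  The four Volterra terms \<open>DF\<close>, \<open>DA\<close>, \<open>DK\<close>, \<open>DG\<close> contribute \<open>c + 3 c R\<close> to the factor in
  front of \<open>\<epsilon> m e\<^bsup>\<rho>t\<^esup>\<close>, which is small when \<open>\<rho>\<close> is large.\<close>

lemma rhs_diff_le:
  assumes u: "continuous_on {-\<mu>..} u" and u': "continuous_on {-\<mu>..} u'"
    and w: "continuous_on {0..} w" and w': "continuous_on {0..} w'"
    and t: "0 \<le> t" "t \<le> T" and nonneg: "a \<ge> 0" "m \<ge> 0" "\<delta> \<ge> 0" "M \<ge> 0" "R \<ge> 0"
    and dist: "\<And>r. 0 \<le> r \<Longrightarrow> r \<le> t \<Longrightarrow> mdist V (seg u r) (seg u' r) \<le> a + m * exp (\<rho> * r)"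
    and dist0: "mdist V (seg u 0) (seg u' 0) \<le> a" and init: "norm (\<xi> 0 - \<xi>' 0) \<le> a"
    and noise: "\<And>r. r \<in> {0..T} \<Longrightarrow> norm (w' r) \<le> R" "\<And>r. r \<in> {0..T} \<Longrightarrow> norm (w r - w' r) \<le> \<delta>"
    and M: "\<And>r. r \<in> {0..T} \<Longrightarrow> norm (G (seg u r)) \<le> M" "\<And>r. r \<in> {0..T} \<Longrightarrow> norm (K (seg u r)) \<le> M"
      "\<And>r s v. r \<in> {0..T} \<Longrightarrow> s > 0 \<Longrightarrow> norm (dS s (G (seg u r) v)) \<le> M * s powr (\<nu> - 1) * norm v"
    and \<epsilon>: "(LINT s:{0..T}|lborel. kern s * exp (- \<rho> * s)) \<le> \<epsilon>"
  defines "I \<equiv> LINT s:{0..T}|lborel. kern s"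
  shows "norm (rhs w \<xi> u t - rhs w' \<xi>' u' t)
    \<le> (1 + c * R + (c + 3 * (c * R)) * I) * a + (1 + 2 * I) * (M * \<delta>)
      + (c + 3 * (c * R)) * \<epsilon> * m * exp (\<rho> * t)"
proof -
  define e where "e r = a + m * exp (\<rho> * r)" for r
  have e: "e r \<ge> 0" for r using nonneg by (simp add: e_def)
  have pos: "0 \<le> c * e r" "0 \<le> c * e r * R" "0 \<le> M * \<delta>" for r
    using e nonneg c_nonneg by auto
  have conv: "norm (LINT r:{0..t}|lborel. f r) \<le> b * I + n * exp (\<rho> * t) * \<epsilon>"
    if f: "set_integrable lborel {0..t} f" and bn: "b \<ge> 0" "n \<ge> 0"
      and bound: "\<And>r. 0 \<le> r \<Longrightarrow> r < t \<Longrightarrow> norm (f r) \<le> kern (t - r) * (b + n * exp (\<rho> * r))" for f :: "real \<Rightarrow> 'h" and b n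
  proof -
    have "norm (LINT r:{0..t}|lborel. f r)
      \<le> b * I + n * exp (\<rho> * t) * (LINT s:{0..T}|lborel. kern s * exp (- \<rho> * s))"
      unfolding I_def by (intro convolution_norm_le[OF f kern_integrable kern_ge(2)] t bn bound)
    also have "\<dots> \<le> b * I + n * exp (\<rho> * t) * \<epsilon>"
      using \<epsilon> bn by (intro add_left_mono mult_left_mono) auto
    finally show ?thesis .
  qed
  have kern_mult: "x \<le> kern s * y" if "x \<le> y" "0 \<le> y" for x y s
    using that mult_right_mono[OF kern_ge(1)[of s] that(2)] by simp
  have seg: "seg u r \<in> mspace V" "seg u' r \<in> mspace V" if "r \<ge> 0" for r
    using seg_in_V u u' that by auto
  have inT: "r \<in> {0..T}" if "0 \<le> r" "r \<le> t" for r using that t by auto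
  have w'_le: "norm (w' r) \<le> R" and w_le: "norm (w r - w' r) \<le> \<delta>" if "0 \<le> r" "r \<le> t" for r
    using noise inT[OF that] by auto
  have lip: "norm (f (seg u r) - f (seg u' r)) \<le> c * e r"
    if "\<And>x y. x \<in> mspace V \<Longrightarrow> y \<in> mspace V \<Longrightarrow> norm (f x - f y) \<le> c * mdist V x y" "0 \<le> r" "r \<le> t"
    for f :: "_ \<Rightarrow> 'x::real_normed_vector" and r
    using order_trans[OF that(1)[OF seg[OF that(2)]] mult_left_mono[OF dist[OF that(2,3)] c_nonneg]]
    by (simp add: e_def)
  have K_term: "norm (K (seg u r) (w r) - K (seg u' r) (w' r)) \<le> c * e r * R + M * \<delta>"
    if r: "0 \<le> r" "r \<le> t" for r
  proof -
    have eq: "K (seg u r) (w r) - K (seg u' r) (w' r)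
        = (K (seg u r) - K (seg u' r)) (w' r) + K (seg u r) (w r - w' r)"
      by (simp add: blinfun.bilinear_simps)
    have "norm (K (seg u r) (w r) - K (seg u' r) (w' r))
        \<le> norm (K (seg u r) - K (seg u' r)) * norm (w' r) + norm (K (seg u r)) * norm (w r - w' r)"
      unfolding eq by (intro norm_triangle_mono norm_blinfun)
    also have "\<dots> \<le> c * e r * R + M * \<delta>"
      by (intro add_mono mult_mono lip[OF K_lip r] M(2)[OF inT[OF r]] w'_le[OF r] w_le[OF r]
          mult_nonneg_nonneg nonneg c_nonneg e norm_ge_zero)
    finally show ?thesis .
  qed
  have A_term: "norm (dS (t - r) (G (seg u r) (w r)) - dS (t - r) (G (seg u' r) (w' r)))
      \<le> kern (t - r) * (c * e r * R + M * \<delta>)"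
    if r: "0 \<le> r" "r < t" for r
  proof -
    let ?s = "t - r"
    have s: "?s > 0" using r by simp
    have eq: "dS ?s (G (seg u r) (w r)) - dS ?s (G (seg u' r) (w' r))
        = dS ?s ((G (seg u r) - G (seg u' r)) (w' r)) + dS ?s (G (seg u r) (w r - w' r))"
      by (simp add: blinfun.bilinear_simps)
    have "norm (dS ?s (G (seg u r) (w r)) - dS ?s (G (seg u' r) (w' r)))
        \<le> c * ?s powr (\<nu> - 1) * mdist V (seg u r) (seg u' r) * norm (w' r)
        + M * ?s powr (\<nu> - 1) * norm (w r - w' r)"
      unfolding eq using r inT[of r] by (intro norm_triangle_mono dS_G_lip M(3) s seg) auto
    also have "\<dots> \<le> c * kern ?s * e r * R + M * kern ?s * \<delta>"
      using r
      by (intro add_mono mult_mono dist[of r, folded e_def] w'_le[of r] w_le[of r] nonneg c_nonneg e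
          kern_ge mult_nonneg_nonneg order_refl norm_ge_zero powr_ge_zero mdist_nonneg) auto
    finally show ?thesis by (simp add: algebra_simps)
  qed
  have F_int: "set_integrable lborel {0..t} (\<lambda>r. S (t - r) (F (seg u r)))"
      "set_integrable lborel {0..t} (\<lambda>r. S (t - r) (F (seg u' r)))"
    using S_conv_integrable[OF u w F_cont[OF u]] S_conv_integrable[OF u' w' F_cont[OF u']] by auto
  have K_int: "set_integrable lborel {0..t} (\<lambda>r. S (t - r) (K (seg u r) (w r)))"
      "set_integrable lborel {0..t} (\<lambda>r. S (t - r) (K (seg u' r) (w' r)))"
    using S_conv_integrable[OF u w K_w_cont[OF u w]] S_conv_integrable[OF u' w' K_w_cont[OF u' w']] by auto
  note A_int = A_conv_integrable[OF u w, of t] A_conv_integrable[OF u' w', of t]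
  define DF where "DF = (LINT r:{0..t}|lborel. S (t - r) (F (seg u r)) - S (t - r) (F (seg u' r)))"
  define DA where "DA = (LINT r:{0..t}|lborel. A (S (t - r) (G (seg u r) (w r))) - A (S (t - r) (G (seg u' r) (w' r))))"
  define DK where "DK = (LINT r:{0..t}|lborel. S (t - r) (K (seg u r) (w r)) - S (t - r) (K (seg u' r) (w' r)))"
  define DG where "DG = (LINT r:{0..t}|lborel. (K (seg u r) - K (seg u' r)) (w' t))"
  have DF_le: "norm DF \<le> (c * a) * I + (c * m) * exp (\<rho> * t) * \<epsilon>"
    unfolding DF_def
  proof (rule conv[OF set_integral_diff(1)[OF F_int]])
    fix r assume r: "0 \<le> r" "r < t"
    have "norm (S (t - r) (F (seg u r)) - S (t - r) (F (seg u' r))) \<le> norm (F (seg u r) - F (seg u' r))"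
      using norm_S_apply[of "t - r" "F (seg u r) - F (seg u' r)"] r by (simp add: blinfun.bilinear_simps)
    also have "\<dots> \<le> c * e r" using r by (intro lip F_lip) auto
    finally show "norm (S (t - r) (F (seg u r)) - S (t - r) (F (seg u' r)))
        \<le> kern (t - r) * (c * a + c * m * exp (\<rho> * r))"
      using pos(1)[of r] by (intro kern_mult) (auto simp: e_def algebra_simps)
  qed (use c_nonneg nonneg in auto)
  have DA_le: "norm DA \<le> (c * R * a + M * \<delta>) * I + (c * R * m) * exp (\<rho> * t) * \<epsilon>"
    unfolding DA_def
  proof (rule conv[OF set_integral_diff(1)[OF A_int]])
    fix r assume r: "0 \<le> r" "r < t"
    then show "norm (A (S (t - r) (G (seg u r) (w r))) - A (S (t - r) (G (seg u' r) (w' r))))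
      \<le> kern (t - r) * (c * R * a + M * \<delta> + c * R * m * exp (\<rho> * r))"
      using A_term[OF r] by (simp add: A_S e_def algebra_simps)
  qed (use c_nonneg nonneg in auto)
  have DK_le: "norm DK \<le> (c * R * a + M * \<delta>) * I + (c * R * m) * exp (\<rho> * t) * \<epsilon>"
    unfolding DK_def
  proof (rule conv[OF set_integral_diff(1)[OF K_int]])
    fix r assume r: "0 \<le> r" "r < t"
    have "norm (S (t - r) (K (seg u r) (w r)) - S (t - r) (K (seg u' r) (w' r)))
        \<le> norm (K (seg u r) (w r) - K (seg u' r) (w' r))"
      using norm_S_apply[of "t - r" "K (seg u r) (w r) - K (seg u' r) (w' r)"] r by (simp add: blinfun.bilinear_simps)
    also have "\<dots> \<le> c * e r * R + M * \<delta>" using r by (intro K_term) auto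
    finally show "norm (S (t - r) (K (seg u r) (w r)) - S (t - r) (K (seg u' r) (w' r)))
      \<le> kern (t - r) * (c * R * a + M * \<delta> + c * R * m * exp (\<rho> * r))"
      using pos(2)[of r] pos(3) by (intro kern_mult) (auto simp: e_def algebra_simps)
  qed (use c_nonneg nonneg in auto)
  have DG_le: "norm DG \<le> (c * R * a) * I + (c * R * m) * exp (\<rho> * t) * \<epsilon>"
    unfolding DG_def
  proof (rule conv[OF G_increment_diff(1)[OF u u' t(1)]])
    fix r assume r: "0 \<le> r" "r < t"
    have "norm ((K (seg u r) - K (seg u' r)) (w' t)) \<le> norm (K (seg u r) - K (seg u' r)) * norm (w' t)"
      by (rule norm_blinfun)
    also have "\<dots> \<le> c * e r * R"
      using r t w'_le[of t] nonneg c_nonneg e by (intro mult_mono lip K_lip) auto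
    finally show "norm ((K (seg u r) - K (seg u' r)) (w' t))
      \<le> kern (t - r) * (c * R * a + c * R * m * exp (\<rho> * r))"
      using pos(2)[of r] pos(3) by (intro kern_mult) (auto simp: e_def algebra_simps)
  qed (use c_nonneg nonneg in auto)
  have init_le: "norm (S t (\<xi> 0 - \<xi>' 0)) \<le> a"
    using norm_S_apply[OF t(1)] init by (rule order_trans)
  have G0_le: "norm ((G (seg u 0) - G (seg u' 0)) (w' t)) \<le> c * a * R"
  proof -
    have "norm ((G (seg u 0) - G (seg u' 0)) (w' t)) \<le> norm (G (seg u 0) - G (seg u' 0)) * norm (w' t)"
      by (rule norm_blinfun)
    also have "\<dots> \<le> (c * a) * R"
      using w'_le[of t] t nonneg c_nonneg order_trans[OF G_lip[OF seg[of 0]] mult_left_mono[OF dist0 c_nonneg]]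
      by (intro mult_mono) auto
    finally show ?thesis .
  qed
  have Gw_le: "norm (G (seg u t) (w t - w' t)) \<le> M * \<delta>"
  proof -
    have "norm (G (seg u t) (w t - w' t)) \<le> norm (G (seg u t)) * norm (w t - w' t)"
      by (rule norm_blinfun)
    also have "\<dots> \<le> M * \<delta>" using M(1)[of t] w_le[of t] t nonneg by (intro mult_mono) auto
    finally show ?thesis .
  qed
  have eq: "rhs w \<xi> u t - rhs w' \<xi>' u' t
      = S t (\<xi> 0 - \<xi>' 0) + DF + ((G (seg u 0) - G (seg u' 0)) (w' t) + DG)
        + G (seg u t) (w t - w' t) + DA - DK"
  proof -
    have eG: "(G (seg u 0) - G (seg u' 0)) (w' t) + DG = (G (seg u t) - G (seg u' t)) (w' t)"
      unfolding DG_def using G_increment_diff(2)[OF u u' t(1)] by simp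
    have eF: "DF = (LINT r:{0..t}|lborel. S (t - r) (F (seg u r))) - (LINT r:{0..t}|lborel. S (t - r) (F (seg u' r)))"
      unfolding DF_def by (rule set_integral_diff(2)[OF F_int])
    have eK: "DK = (LINT r:{0..t}|lborel. S (t - r) (K (seg u r) (w r))) - (LINT r:{0..t}|lborel. S (t - r) (K (seg u' r) (w' r)))"
      unfolding DK_def by (rule set_integral_diff(2)[OF K_int])
    have eA: "DA = (LINT r:{0..t}|lborel. A (S (t - r) (G (seg u r) (w r)))) - (LINT r:{0..t}|lborel. A (S (t - r) (G (seg u' r) (w' r))))"
      unfolding DA_def by (rule set_integral_diff(2)[OF A_int])
    show ?thesis
      unfolding mild_rhs_def eG eF eK eA by (simp add: blinfun.bilinear_simps)
  qed
  have "norm (rhs w \<xi> u t - rhs w' \<xi>' u' t)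
    \<le> a + ((c * a) * I + (c * m) * exp (\<rho> * t) * \<epsilon>)
      + (c * a * R + ((c * R * a) * I + (c * R * m) * exp (\<rho> * t) * \<epsilon>)) + M * \<delta>
      + ((c * R * a + M * \<delta>) * I + (c * R * m) * exp (\<rho> * t) * \<epsilon>)
      + ((c * R * a + M * \<delta>) * I + (c * R * m) * exp (\<rho> * t) * \<epsilon>)"
    unfolding eq by (rule order_trans[OF norm_triangle_seven])
      (intro add_mono DF_le DA_le DK_le DG_le init_le G0_le Gw_le)
  then show ?thesis by (simp add: algebra_simps)
qed

lemma kern_integral_nonneg: "(LINT s:{0..T}|lborel. kern s) \<ge> 0"
  unfolding set_lebesgue_integral_def
  by (intro integral_nonneg_AE AE_I2) (auto simp: kern_ge intro!: scaleR_nonneg_nonneg)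

text \<open>The weight depends on \<open>T\<close> and the bound \<open>R\<close> of the noise alone.\<close>

lemma contraction_weight:
  assumes "R \<ge> 0"
  shows "\<exists>\<rho>\<ge>0. \<exists>\<epsilon>. (LINT s:{0..T}|lborel. kern s * exp (- \<rho> * s)) \<le> \<epsilon> \<and> (c + 3 * (c * R)) * \<epsilon> \<le> 1 / 2"
proof -
  define N where "N = c + 3 * (c * R)"
  have N: "N \<ge> 0" using c_nonneg assms by (simp add: N_def)
  have "1 / (2 * N + 1) > 0" using N by simp
  from exponential_weight_small[OF kern_integrable this]
  obtain \<rho> where "\<rho> \<ge> 0" "(LINT s:{0..T}|lborel. kern s * exp (- \<rho> * s)) \<le> 1 / (2 * N + 1)"
    by blast
  moreover have "N * (1 / (2 * N + 1)) \<le> 1 / 2" using N by (simp add: field_simps)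
  ultimately show ?thesis unfolding N_def by blast
qed

lemma mdist_seg_le:
  assumes u: "continuous_on {-\<mu>..} u" and u': "continuous_on {-\<mu>..} u'" and r: "0 \<le> r"
    and le: "\<And>s. - \<mu> \<le> s \<Longrightarrow> s \<le> r \<Longrightarrow> norm (u s - u' s) \<le> b"
  shows "mdist V (seg u r) (seg u' r) \<le> b"
  by (subst mdist_delay_space_le)
    (use mu r le in \<open>auto intro!: seg_in_V u u' simp: segment_apply dist_norm\<close>)

lemma sol_continuous: "sol w \<xi> u \<Longrightarrow> continuous_on {-\<mu>..} u"
  and sol_init: "sol w \<xi> u \<Longrightarrow> s \<in> {-\<mu>..0} \<Longrightarrow> u s = \<xi> s"
  and sol_rhs: "sol w \<xi> u \<Longrightarrow> t \<ge> 0 \<Longrightarrow> u t = rhs w \<xi> u t"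
  by (simp_all add: global_mild_solution_def)

lemma sol_seg_0: "sol w \<xi> u \<Longrightarrow> \<xi> \<in> mspace V \<Longrightarrow> seg u 0 = \<xi>"
  using sol_init by (intro segment_zero) (auto simp: mspace_delay_space)

text \<open>Let \<open>m\<close> be the maximum of \<open>e\<^bsup>-\<rho>r\<^esup> |u(r) - u'(r)|\<close> over \<open>[0, T]\<close>, attained at \<open>r0\<close>.  The central
  inequality at \<open>r0\<close> reads \<open>m \<le> const (a + M \<delta>) + m/2\<close>, which bounds \<open>m\<close>.  The constant \<open>C\<close> is
  chosen before the data, and \<open>M\<close> refers to one of the solutions only; so \<open>u\<close> can be kept fixed while
  \<open>u'\<close> varies.\<close>

lemma solution_estimate:
  assumes T: "T \<ge> 0" and R: "R \<ge> 0"
  shows "\<exists>C\<ge>0. \<forall>w w' \<xi> \<xi>' u u' M \<delta>.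
    continuous_on {0..} w \<longrightarrow> continuous_on {0..} w' \<longrightarrow> \<xi> \<in> mspace V \<longrightarrow> \<xi>' \<in> mspace V \<longrightarrow>
    sol w \<xi> u \<longrightarrow> sol w' \<xi>' u' \<longrightarrow> M \<ge> 0 \<longrightarrow> \<delta> \<ge> 0 \<longrightarrow>
    (\<forall>r\<in>{0..T}. norm (w' r) \<le> R \<and> norm (w r - w' r) \<le> \<delta> \<and>
      norm (G (seg u r)) \<le> M \<and> norm (K (seg u r)) \<le> M \<and>
      (\<forall>s>0. \<forall>v. norm (dS s (G (seg u r) v)) \<le> M * s powr (\<nu> - 1) * norm v)) \<longrightarrow>
    (\<forall>t\<in>{-\<mu>..T}. norm (u t - u' t) \<le> C * (mdist V \<xi> \<xi>' + M * \<delta>))"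
proof -
  obtain \<rho> \<epsilon> where \<rho>: "\<rho> \<ge> 0" and \<epsilon>: "(LINT s:{0..T}|lborel. kern s * exp (- \<rho> * s)) \<le> \<epsilon>"
    and half: "(c + 3 * (c * R)) * \<epsilon> \<le> 1 / 2"
    using contraction_weight[OF R] by blast
  define I where "I = (LINT s:{0..T}|lborel. kern s)"
  have I: "I \<ge> 0" unfolding I_def by (rule kern_integral_nonneg)
  define P where "P = (1 + c * R + (c + 3 * (c * R)) * I) + (1 + 2 * I)"
  have P: "1 + c * R + (c + 3 * (c * R)) * I \<le> P" "1 + 2 * I \<le> P" "P \<ge> 0"
    using I c_nonneg R by (auto simp: P_def)
  define C where "C = 1 + 2 * P * exp (\<rho> * T)"
  have C: "C \<ge> 1" using P by (simp add: C_def)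
  show ?thesis
  proof (intro exI[of _ C] conjI allI impI ballI)
    fix w w' \<xi> \<xi>' u u' M \<delta> t
    assume w: "continuous_on {0..} w" and w': "continuous_on {0..} w'"
      and \<xi>: "\<xi> \<in> mspace V" "\<xi>' \<in> mspace V" and sol: "sol w \<xi> u" "sol w' \<xi>' u'"
      and M: "0 \<le> M" "0 \<le> \<delta>"
      and bd: "\<forall>r\<in>{0..T}. norm (w' r) \<le> R \<and> norm (w r - w' r) \<le> \<delta> \<and>
        norm (G (seg u r)) \<le> M \<and> norm (K (seg u r)) \<le> M \<and>
        (\<forall>s>0. \<forall>v. norm (dS s (G (seg u r) v)) \<le> M * s powr (\<nu> - 1) * norm v)"
      and t: "t \<in> {-\<mu>..T}"
    note u = sol_continuous[OF sol(1)] and u' = sol_continuous[OF sol(2)]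
    define a where "a = mdist V \<xi> \<xi>'"
    have a: "a \<ge> 0" by (simp add: a_def)
    have init: "norm (\<xi> s - \<xi>' s) \<le> a" if "s \<in> {-\<mu>..0}" for s
      using dist_le_mdist_delay_space[OF _ \<xi> that] mu by (simp add: a_def dist_norm)
    define g where "g r = exp (- \<rho> * r) * norm (u r - u' r)" for r
    have "continuous_on {0..T} g"
      unfolding g_def using mu
      by (intro continuous_intros continuous_on_subset[OF u] continuous_on_subset[OF u']) auto
    then obtain r0 where r0: "r0 \<in> {0..T}" "\<And>r. r \<in> {0..T} \<Longrightarrow> g r \<le> g r0"
      using continuous_attains_sup[of "{0..T}" g] T by auto
    define m where "m = g r0"
    have m: "m \<ge> 0" by (simp add: m_def g_def)
    have le_m: "norm (u r - u' r) \<le> m * exp (\<rho> * r)" if "r \<in> {0..T}" for r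
    proof -
      have "g r \<le> m" unfolding m_def by (rule r0(2)[OF that])
      then show ?thesis by (simp add: g_def exp_minus field_simps)
    qed
    have dist: "mdist V (seg u r) (seg u' r) \<le> a + m * exp (\<rho> * r)" if r: "0 \<le> r" "r \<le> r0" for r
    proof (rule mdist_seg_le[OF u u' r(1)])
      fix s assume s: "- \<mu> \<le> s" "s \<le> r"
      show "norm (u s - u' s) \<le> a + m * exp (\<rho> * r)"
      proof (cases "s \<le> 0")
        case True
        then have "norm (u s - u' s) \<le> a"
          using init[of s] sol_init[OF sol(1)] sol_init[OF sol(2)] s by simp
        then show ?thesis using m by (simp add: add_increasing2)
      next
        case False
        then have "norm (u s - u' s) \<le> m * exp (\<rho> * s)"
          using s r r0 by (intro le_m) auto
        also have "\<dots> \<le> m * exp (\<rho> * r)"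
          using m \<rho> s by (intro mult_left_mono) (auto intro: mult_left_mono)
        finally show ?thesis using a by simp
      qed
    qed
    have r0': "0 \<le> r0" "r0 \<le> T" using r0 by auto
    have "norm (rhs w \<xi> u r0 - rhs w' \<xi>' u' r0)
      \<le> (1 + c * R + (c + 3 * (c * R)) * I) * a + (1 + 2 * I) * (M * \<delta>)
        + (c + 3 * (c * R)) * \<epsilon> * m * exp (\<rho> * r0)"
      unfolding I_def
    proof (rule rhs_diff_le[OF u u' w w' r0' a m M(2,1) R dist _ _ _ _ _ _ _ \<epsilon>])
      show "mdist V (seg u 0) (seg u' 0) \<le> a"
        using sol_seg_0[OF sol(1) \<xi>(1)] sol_seg_0[OF sol(2) \<xi>(2)] by (simp add: a_def)
      show "norm (\<xi> 0 - \<xi>' 0) \<le> a" using mu by (intro init) auto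
    qed (use bd in auto)
    also have "\<dots> \<le> P * a + P * (M * \<delta>) + 1 / 2 * (m * exp (\<rho> * r0))"
      using P half a m M mult_right_mono[OF half, of "m * exp (\<rho> * r0)"]
      by (intro add_mono mult_right_mono) (auto simp: mult.assoc)
    finally have "norm (u r0 - u' r0) \<le> P * (a + M * \<delta>) + 1 / 2 * (m * exp (\<rho> * r0))"
      using sol_rhs[OF sol(1) r0'(1)] sol_rhs[OF sol(2) r0'(1)] by (simp add: algebra_simps)
    moreover have "norm (u r0 - u' r0) = m * exp (\<rho> * r0)"
      by (simp add: m_def g_def exp_minus field_simps)
    ultimately have "m * exp (\<rho> * r0) \<le> 2 * P * (a + M * \<delta>)" by simp
    moreover have "m * 1 \<le> m * exp (\<rho> * r0)" using m \<rho> r0' by (intro mult_left_mono) auto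
    ultimately have m_le: "m \<le> 2 * P * (a + M * \<delta>)" by simp
    have aM: "0 \<le> a + M * \<delta>" using a M by simp
    show "norm (u t - u' t) \<le> C * (mdist V \<xi> \<xi>' + M * \<delta>)"
    proof (cases "t \<le> 0")
      case True
      then have "norm (u t - u' t) \<le> a"
        using init[of t] sol_init[OF sol(1)] sol_init[OF sol(2)] t by simp
      also have "\<dots> \<le> 1 * (a + M * \<delta>)" using M by simp
      also have "\<dots> \<le> C * (a + M * \<delta>)" using C aM by (rule mult_right_mono)
      finally show ?thesis by (simp add: a_def)
    next
      case False
      then have "norm (u t - u' t) \<le> m * exp (\<rho> * t)" using t by (intro le_m) auto
      also have "\<dots> \<le> (2 * P * (a + M * \<delta>)) * exp (\<rho> * T)"
        using m_le m \<rho> t aM P by (intro mult_mono) (auto intro: mult_left_mono)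
      also have "\<dots> = (2 * P * exp (\<rho> * T)) * (a + M * \<delta>)" by simp
      also have "\<dots> \<le> C * (a + M * \<delta>)" using aM by (intro mult_right_mono) (auto simp: C_def)
      finally show ?thesis by (simp add: a_def)
    qed
  qed (use C in auto)
qed

lemma solution_lipschitz:
  assumes T: "T \<ge> 0" and w: "continuous_on {0..} w"
  shows "\<exists>C\<ge>0. \<forall>\<xi> \<xi>' u u'. \<xi> \<in> mspace V \<longrightarrow> \<xi>' \<in> mspace V \<longrightarrow> sol w \<xi> u \<longrightarrow> sol w \<xi>' u' \<longrightarrow>
    (\<forall>t\<in>{-\<mu>..T}. norm (u t - u' t) \<le> C * mdist V \<xi> \<xi>')"
proof -
  obtain R where R: "R \<ge> 0" "\<And>r. r \<in> {0..T} \<Longrightarrow> norm (w r) \<le> R"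
    using bounded_on_interval[OF w, of T] by auto
  obtain C where C: "C \<ge> 0" and est: "\<And>w w' \<xi> \<xi>' u u' M \<delta>.
    continuous_on {0..} w \<Longrightarrow> continuous_on {0..} w' \<Longrightarrow> \<xi> \<in> mspace V \<Longrightarrow> \<xi>' \<in> mspace V \<Longrightarrow>
    sol w \<xi> u \<Longrightarrow> sol w' \<xi>' u' \<Longrightarrow> M \<ge> 0 \<Longrightarrow> \<delta> \<ge> 0 \<Longrightarrow>
    (\<forall>r\<in>{0..T}. norm (w' r) \<le> R \<and> norm (w r - w' r) \<le> \<delta> \<and>
      norm (G (seg u r)) \<le> M \<and> norm (K (seg u r)) \<le> M \<and>
      (\<forall>s>0. \<forall>v. norm (dS s (G (seg u r) v)) \<le> M * s powr (\<nu> - 1) * norm v)) \<Longrightarrow>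
    (\<forall>t\<in>{-\<mu>..T}. norm (u t - u' t) \<le> C * (mdist V \<xi> \<xi>' + M * \<delta>))"
    using solution_estimate[OF T R(1)] by blast
  show ?thesis
  proof (intro exI[of _ C] conjI allI impI C)
    fix \<xi> \<xi>' u u' assume A: "\<xi> \<in> mspace V" "\<xi>' \<in> mspace V" "sol w \<xi> u" "sol w \<xi>' u'"
    obtain M where M: "M \<ge> 0" "\<forall>r\<in>{0..T}. norm (G (seg u r)) \<le> M \<and> norm (K (seg u r)) \<le> M \<and>
        (\<forall>s>0. \<forall>v. norm (dS s (G (seg u r) v)) \<le> M * s powr (\<nu> - 1) * norm v)"
      using path_bounds[OF sol_continuous[OF A(3)], of T] by blast
    have "\<forall>t\<in>{-\<mu>..T}. norm (u t - u' t) \<le> C * (mdist V \<xi> \<xi>' + M * 0)"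
      by (rule est[OF w w A M(1)]) (use M(2) R(2) in auto)
    then show "\<forall>t\<in>{-\<mu>..T}. norm (u t - u' t) \<le> C * mdist V \<xi> \<xi>'" by simp
  qed
qed

lemma solution_unique:
  assumes w: "continuous_on {0..} w" and \<xi>: "\<xi> \<in> mspace V" and sol: "sol w \<xi> u" "sol w \<xi> u'"
  shows "u = u'"
proof (rule extensionalityI)
  show "u \<in> extensional {-\<mu>..}" "u' \<in> extensional {-\<mu>..}"
    using sol by (auto simp: global_mild_solution_def)
  fix t assume t: "t \<in> {-\<mu>..}"
  have "max t 0 \<ge> 0" by simp
  from solution_lipschitz[OF this w] \<xi> sol
  have "norm (u t - u' t) \<le> 0"
    using t mdist_zero by fastforce
  then show "u t = u' t" by simp
qed

text \<open>Picard iteration for the right-hand side, continued by \<open>\<xi>\<close> to negative times.  Successive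
  differences decay like \<open>2\<^sup>-\<^sup>n\<close> on each \<open>[-\<mu>, T]\<close> in the norm with weight \<open>exp(-\<rho> max(t, 0))\<close>.
  Although \<open>\<rho>\<close> depends on \<open>T\<close>, the iterates do not; so the limit is defined on all of \<open>[-\<mu>, \<infinity>)\<close>
  at once and no gluing of local solutions is necessary.\<close>

lemma solution_exists:
  assumes w: "continuous_on {0..} w" "w 0 = 0" and \<xi>: "\<xi> \<in> mspace V"
  shows "\<exists>u. sol w \<xi> u"
proof -
  define X where "X = {u. continuous_on {-\<mu>..} u \<and> (\<forall>s\<in>{-\<mu>..0}. u s = \<xi> s)}"
  define \<Psi> where "\<Psi> u t = (if t \<le> 0 then \<xi> t else rhs w \<xi> u t)" for u t
  have X_cont: "continuous_on {-\<mu>..} u" if "u \<in> X" for u using that by (simp add: X_def)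
  have \<Psi>_rhs: "\<Psi> u t = rhs w \<xi> u t" if "t \<ge> 0" for u t
    using that rhs_0[of w, OF w(2)] by (auto simp: \<Psi>_def)
  have \<Psi>_X: "\<Psi> u \<in> X" if "u \<in> X" for u
  proof -
    have "continuous_on ({-\<mu>..0} \<union> {0..}) (\<Psi> u)"
      unfolding \<Psi>_def
    proof (rule continuous_on_If)
      show "continuous_on {-\<mu>..0} \<xi>" using \<xi> by (simp add: mspace_delay_space)
      show "continuous_on {0..} (rhs w \<xi> u)"
        by (rule rhs_cont[OF X_cont[OF that] w(1)])
    qed (use rhs_0[of w \<xi> u, OF w(2)] in auto)
    moreover have "{-\<mu>..0} \<union> {0..} = {-\<mu>..}" using mu by auto
    ultimately show ?thesis by (simp add: X_def \<Psi>_def)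
  qed
  have contr: "\<exists>\<rho>\<ge>0. \<forall>u\<in>X. \<forall>v\<in>X. \<forall>m\<ge>0. (\<forall>t\<in>{-\<mu>..T}. norm (u t - v t) \<le> m * exp (\<rho> * max t 0)) \<longrightarrow>
      (\<forall>t\<in>{-\<mu>..T}. norm (\<Psi> u t - \<Psi> v t) \<le> m / 2 * exp (\<rho> * max t 0))" for T
  proof -
    obtain R where R: "R \<ge> 0" "\<And>r. r \<in> {0..T} \<Longrightarrow> norm (w r) \<le> R"
      using bounded_on_interval[OF w(1), of T] by auto
    obtain \<rho> \<epsilon> where \<rho>: "\<rho> \<ge> 0" and \<epsilon>: "(LINT s:{0..T}|lborel. kern s * exp (- \<rho> * s)) \<le> \<epsilon>"
      and half: "(c + 3 * (c * R)) * \<epsilon> \<le> 1 / 2"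
      using contraction_weight[OF R(1)] by blast
    show ?thesis
    proof (intro exI[of _ \<rho>] conjI \<rho> ballI allI impI)
      fix u v m t
      assume uv: "u \<in> X" "v \<in> X" and m: "0 \<le> m"
        and le: "\<forall>t\<in>{-\<mu>..T}. norm (u t - v t) \<le> m * exp (\<rho> * max t 0)" and t: "t \<in> {-\<mu>..T}"
      note u = X_cont[OF uv(1)] and v = X_cont[OF uv(2)]
      show "norm (\<Psi> u t - \<Psi> v t) \<le> m / 2 * exp (\<rho> * max t 0)"
      proof (cases "t \<le> 0")
        case True
        then show ?thesis using m by (simp add: \<Psi>_def)
      next
        case False
        then have t': "0 \<le> t" "t \<le> T" using t by auto
        obtain M where M: "M \<ge> 0" "\<forall>r\<in>{0..T}. norm (G (seg u r)) \<le> M \<and> norm (K (seg u r)) \<le> M \<and>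
            (\<forall>s>0. \<forall>v. norm (dS s (G (seg u r) v)) \<le> M * s powr (\<nu> - 1) * norm v)"
          using path_bounds[OF u, of T] by blast
        have eq: "seg u 0 = seg v 0"
          using uv by (auto simp: segment_def X_def restrict_def fun_eq_iff)
        have "norm (rhs w \<xi> u t - rhs w \<xi> v t)
          \<le> (1 + c * R + (c + 3 * (c * R)) * (LINT s:{0..T}|lborel. kern s)) * 0
            + (1 + 2 * (LINT s:{0..T}|lborel. kern s)) * (M * 0)
            + (c + 3 * (c * R)) * \<epsilon> * m * exp (\<rho> * t)"
        proof (rule rhs_diff_le[OF u v w(1) w(1) t' order_refl m order_refl M(1) R(1) _ _ _ _ _ _ _ _ \<epsilon>])
          fix r assume r: "0 \<le> r" "r \<le> t"
          show "mdist V (seg u r) (seg v r) \<le> 0 + m * exp (\<rho> * r)"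
          proof (rule mdist_seg_le[OF u v r(1)])
            fix s assume s: "- \<mu> \<le> s" "s \<le> r"
            then have "norm (u s - v s) \<le> m * exp (\<rho> * max s 0)"
              using le r t' by auto
            also have "\<dots> \<le> 0 + m * exp (\<rho> * r)"
              using m \<rho> s r by (auto intro!: mult_left_mono)
            finally show "norm (u s - v s) \<le> 0 + m * exp (\<rho> * r)" .
          qed
        next
          show "mdist V (seg u 0) (seg v 0) \<le> 0"
            unfolding eq using mu by (subst mdist_delay_space_le) (auto intro!: seg_in_V v)
        qed (use M(2) R(2) in auto)
        also have "\<dots> \<le> 1 / 2 * (m * exp (\<rho> * t))"
          using mult_right_mono[OF half, of "m * exp (\<rho> * t)"] m by (simp add: mult.assoc)
        finally show ?thesis using t' by (simp add: \<Psi>_rhs)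
      qed
    qed
  qed
  define U where "U n = (\<Psi> ^^ n) (\<lambda>t. \<xi> (min t 0))" for n
  have U0: "(\<lambda>t. \<xi> (min t 0)) \<in> X"
  proof -
    have "continuous_on {-\<mu>..} (\<lambda>t. \<xi> (min t 0))"
      by (rule continuous_on_compose2[of "{-\<mu>..0}" \<xi>])
        (use \<xi> mu in \<open>auto simp: mspace_delay_space intro!: continuous_intros\<close>)
    then show ?thesis by (simp add: X_def min_def)
  qed
  have U_Suc: "U (Suc n) = \<Psi> (U n)" for n by (simp add: U_def)
  have U_X: "U n \<in> X" for n
    by (induction n) (auto simp: U_Suc \<Psi>_X, simp add: U_def U0)
  define u where "u t = U 0 t + (\<Sum>i. U (Suc i) t - U i t)" for t
  have unif: "uniform_limit {-\<mu>..T} U u sequentially" for T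
  proof -
    obtain \<rho> where \<rho>: "\<rho> \<ge> 0" and step: "\<And>u v m t. u \<in> X \<Longrightarrow> v \<in> X \<Longrightarrow> m \<ge> 0 \<Longrightarrow>
      (\<forall>t\<in>{-\<mu>..T}. norm (u t - v t) \<le> m * exp (\<rho> * max t 0)) \<Longrightarrow>
      (\<forall>t\<in>{-\<mu>..T}. norm (\<Psi> u t - \<Psi> v t) \<le> m / 2 * exp (\<rho> * max t 0))"
      using contr[of T] by blast
    have "continuous_on {-\<mu>..T} (\<lambda>t. U 1 t - U 0 t)"
      by (intro continuous_intros continuous_on_subset[OF X_cont[OF U_X]]) auto
    then have "bounded ((\<lambda>t. U 1 t - U 0 t) ` {-\<mu>..T})"
      by (intro compact_imp_bounded compact_continuous_image) auto
    then obtain B where B: "B > 0" "\<And>t. t \<in> {-\<mu>..T} \<Longrightarrow> norm (U 1 t - U 0 t) \<le> B"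
      unfolding bounded_pos by auto
    have dec: "\<forall>t\<in>{-\<mu>..T}. norm (U (Suc n) t - U n t) \<le> B * (1 / 2) ^ n * exp (\<rho> * max t 0)" for n
    proof (induction n)
      case 0
      show ?case
      proof
        fix t assume "t \<in> {-\<mu>..T}"
        then have "norm (U 1 t - U 0 t) \<le> B * 1" using B by simp
        also have "\<dots> \<le> B * exp (\<rho> * max t 0)" using B(1) \<rho> by (intro mult_left_mono) auto
        finally show "norm (U (Suc 0) t - U 0 t) \<le> B * (1 / 2) ^ 0 * exp (\<rho> * max t 0)" by simp
      qed
    next
      case (Suc n)
      have "\<forall>t\<in>{-\<mu>..T}. norm (\<Psi> (U (Suc n)) t - \<Psi> (U n) t) \<le> B * (1 / 2) ^ n / 2 * exp (\<rho> * max t 0)"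
        using B(1) Suc by (intro step U_X) auto
      then show ?case by (simp add: U_Suc)
    qed
    have "uniform_limit {-\<mu>..T} (\<lambda>n t. \<Sum>i<n. U (Suc i) t - U i t) (\<lambda>t. \<Sum>i. U (Suc i) t - U i t) sequentially"
    proof (rule Weierstrass_m_test)
      show "summable (\<lambda>n. B * exp (\<rho> * max T 0) * (1 / 2) ^ n)"
        by (intro summable_mult summable_geometric) auto
      fix n t assume t: "t \<in> {-\<mu>..T}"
      then have "norm (U (Suc n) t - U n t) \<le> B * (1 / 2) ^ n * exp (\<rho> * max t 0)"
        using dec by blast
      also have "\<dots> \<le> B * (1 / 2) ^ n * exp (\<rho> * max T 0)"
        using B(1) \<rho> t by (intro mult_left_mono) (auto intro!: mult_left_mono)
      finally show "norm (U (Suc n) t - U n t) \<le> B * exp (\<rho> * max T 0) * (1 / 2) ^ n"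
        by (simp add: mult_ac)
    qed
    then have "uniform_limit {-\<mu>..T} (\<lambda>n t. U 0 t + (\<Sum>i<n. U (Suc i) t - U i t)) u sequentially"
      unfolding u_def by (intro uniform_limit_intros)
    moreover have "U 0 t + (\<Sum>i<n. U (Suc i) t - U i t) = U n t" for n t
      using sum_lessThan_telescope[of "\<lambda>i. U i t" n] by simp
    ultimately show ?thesis by simp
  qed
  have u_X: "u \<in> X"
  proof -
    have "continuous_on {-\<mu>..T} u" for T
      by (rule uniform_limit_theorem[OF _ unif])
        (auto intro!: always_eventually continuous_on_subset[OF X_cont[OF U_X]])
    then have "continuous_on {-\<mu>..} u" by (rule continuous_on_Ici_if_Icc)
    moreover have "u s = \<xi> s" if "s \<in> {-\<mu>..0}" for s
      using U_X that by (simp add: u_def X_def)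
    ultimately show ?thesis by (simp add: X_def)
  qed
  have fixpoint: "u t = \<Psi> u t" if t: "t \<ge> 0" for t
  proof -
    have tI: "t \<in> {-\<mu>..t}" using t mu by auto
    obtain \<rho> where \<rho>: "\<rho> \<ge> 0" and step: "\<And>u v m. u \<in> X \<Longrightarrow> v \<in> X \<Longrightarrow> m \<ge> 0 \<Longrightarrow>
      (\<forall>r\<in>{-\<mu>..t}. norm (u r - v r) \<le> m * exp (\<rho> * max r 0)) \<Longrightarrow>
      (\<forall>r\<in>{-\<mu>..t}. norm (\<Psi> u r - \<Psi> v r) \<le> m / 2 * exp (\<rho> * max r 0))"
      using contr[of t] by blast
    have "(\<lambda>n. \<Psi> (U n) t) \<longlonglongrightarrow> \<Psi> u t"
    proof (rule tendstoI)
      fix e :: real assume e: "e > 0"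
      define m where "m = e / exp (\<rho> * t)"
      have m: "m > 0" using e by (simp add: m_def)
      have "\<forall>\<^sub>F n in sequentially. \<forall>r\<in>{-\<mu>..t}. dist (U n r) (u r) < m"
        using uniform_limitD[OF unif m] .
      then show "\<forall>\<^sub>F n in sequentially. dist (\<Psi> (U n) t) (\<Psi> u t) < e"
      proof eventually_elim
        case (elim n)
        have "norm (U n r - u r) \<le> m * exp (\<rho> * max r 0)" if "r \<in> {-\<mu>..t}" for r
        proof -
          have "norm (U n r - u r) \<le> m * 1" using elim that by (auto simp: dist_norm less_imp_le)
          also have "\<dots> \<le> m * exp (\<rho> * max r 0)" using m \<rho> by (intro mult_left_mono) auto
          finally show ?thesis .
        qed
        then have "norm (\<Psi> (U n) t - \<Psi> u t) \<le> m / 2 * exp (\<rho> * max t 0)"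
          using step[OF U_X u_X, of m n] m tI by auto
        also have "\<dots> = e / 2" using t by (simp add: m_def)
        also have "\<dots> < e" using e by simp
        finally show ?case by (simp add: dist_norm)
      qed
    qed
    moreover have "(\<lambda>n. U (Suc n) t) \<longlonglongrightarrow> u t"
      using LIMSEQ_Suc[OF tendsto_uniform_limitI[OF unif tI]] .
    ultimately show ?thesis unfolding U_Suc by (metis LIMSEQ_unique)
  qed
  \<comment> \<open>The iterates are total functions; restriction produces the required extensional one and leaves all segments unchanged.\<close>
  define u' where "u' = restrict u {-\<mu>..}"
  have seg_eq: "seg u' t = seg u t" if "t \<ge> 0" for t
    using that by (auto simp: segment_def u'_def restrict_def fun_eq_iff)
  have "sol w \<xi> u'"
    unfolding sol_iff[OF w(1)]
  proof (intro conjI ballI allI impI)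
    show "u' \<in> extensional {-\<mu>..}" by (simp add: u'_def)
    show "continuous_on {-\<mu>..} u'"
      using X_cont[OF u_X] unfolding u'_def by (rule continuous_on_eq) auto
    show "u' s = \<xi> s" if "s \<in> {-\<mu>..0}" for s
      using u_X that by (simp add: u'_def X_def)
    fix t :: real assume t: "t \<ge> 0"
    have "rhs w \<xi> u' t = rhs w \<xi> u t"
      unfolding mild_rhs_def using t
      by (intro arg_cong2[where f = "(+)"] arg_cong2[where f = "(-)"] refl set_lebesgue_integral_cong)
        (auto simp: seg_eq)
    then show "u' t = rhs w \<xi> u' t"
      using fixpoint[OF t] t mu by (simp add: u'_def \<Psi>_rhs)
  qed
  then show ?thesis by blast
qed

section \<open>The cocycle property\<close>

text \<open>At \<open>r = t\<close> the integrand is \<open>A (S 0 (x t))\<close>, where \<open>x t\<close> need not lie in the domain of \<open>A\<close>; a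
  single point does not change the integral.\<close>

lemma A_conv_eq:
  "(LINT r:{0..t}|lborel. A (S (t - r) (x r))) = (LINT r:{0..t}|lborel. dS (t - r) (x r))"
  unfolding set_integral_Icc_Ico
  by (rule set_lebesgue_integral_cong) (auto simp: A_S)

lemma dS_conv_integrable:
  assumes "continuous_on {-\<mu>..} u" "continuous_on {0..} w"
  shows "set_integrable lborel {0..t} (\<lambda>r. dS (t - r) (G (seg u r) (w r)))"
proof -
  have "set_integrable lborel {0..<t} (\<lambda>r. A (S (t - r) (G (seg u r) (w r))))"
    using A_conv_integrable[OF assms, of t] by (simp add: set_integrable_Icc_Ico)
  also have "?this \<longleftrightarrow> set_integrable lborel {0..<t} (\<lambda>r. dS (t - r) (G (seg u r) (w r)))"
    by (rule set_integrable_cong) (auto simp: A_S)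
  finally show ?thesis by (simp add: set_integrable_Icc_Ico)
qed

text \<open>Strong continuity and contractivity together give joint continuity.\<close>

lemma S_jointly_continuous:
  assumes f: "continuous_on X f" and f_nonneg: "\<And>r. r \<in> X \<Longrightarrow> f r \<ge> (0::real)" and x: "continuous_on X x"
  shows "continuous_on X (\<lambda>r. S (f r) (x r))"
  unfolding continuous_on_def
proof
  fix r0 assume r0: "r0 \<in> X"
  have "((\<lambda>r. S (f r) (x r - x r0)) \<longlongrightarrow> 0) (at r0 within X)"
  proof (rule Lim_null_comparison)
    show "\<forall>\<^sub>F r in at r0 within X. norm (S (f r) (x r - x r0)) \<le> norm (x r - x r0)"
      using f_nonneg by (auto simp: eventually_at_filter intro!: always_eventually norm_S_apply)
    show "((\<lambda>r. norm (x r - x r0)) \<longlongrightarrow> 0) (at r0 within X)"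
      using x r0 by (intro tendsto_norm_zero LIM_zero) (auto simp: continuous_on_def)
  qed
  moreover have "((\<lambda>r. S (f r) (x r0)) \<longlongrightarrow> S (f r0) (x r0)) (at r0 within X)"
  proof -
    have "continuous_on X (\<lambda>r. S (f r) (x r0))"
      by (rule continuous_on_compose2[OF S_cont f]) (use f_nonneg in auto)
    then show ?thesis using r0 by (simp add: continuous_on_def)
  qed
  ultimately have "((\<lambda>r. S (f r) (x r - x r0) + S (f r) (x r0)) \<longlongrightarrow> 0 + S (f r0) (x r0)) (at r0 within X)"
    by (rule tendsto_add)
  then show "((\<lambda>r. S (f r) (x r)) \<longlongrightarrow> S (f r0) (x r0)) (at r0 within X)"
    by (simp add: blinfun.bilinear_simps)
qed

text \<open>The derivative of \<open>r \<mapsto> S(t - r) G(v\<^sub>r) y\<close> on \<open>(0, t)\<close> is \<open>S(t - r) K(v\<^sub>r) y - A S(t - r) G(v\<^sub>r) y\<close>; it is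
  singular at \<open>r = t\<close> but integrable.\<close>

lemma integration_by_parts:
  assumes v: "continuous_on {-\<mu>..} v" and t: "t \<ge> 0"
  shows "S t (G (seg v 0) y) = G (seg v t) y
      + (LINT r:{0..t}|lborel. dS (t - r) (G (seg v r) y))
      - (LINT r:{0..t}|lborel. S (t - r) (K (seg v r) y))"
proof -
  have cy: "continuous_on {0..} (\<lambda>_. y)" by simp
  have int1: "set_integrable lborel {0..t} (\<lambda>r. dS (t - r) (G (seg v r) y))"
    by (rule dS_conv_integrable[OF v cy])
  have int2: "set_integrable lborel {0..t} (\<lambda>r. S (t - r) (K (seg v r) y))"
    by (rule S_conv_integrable[OF v cy K_w_cont[OF v cy]])
  have "(LINT r:{0..t}|lborel. S (t - r) (K (seg v r) y) - dS (t - r) (G (seg v r) y))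
      = S (t - t) (G (seg v t) y) - S (t - 0) (G (seg v 0) y)"
  proof (rule set_integral_FTC[OF t _ _ set_integral_diff(1)[OF int2 int1]])
    show "continuous_on {0..t} (\<lambda>r. S (t - r) (G (seg v r) y))"
      by (intro S_jointly_continuous continuous_on_subset[OF G_w_cont[OF v cy]])
        (auto intro!: continuous_intros)
    fix r assume r: "0 < r" "r < t"
    have "((\<lambda>r. S (t - r)) has_vector_derivative (- 1) *\<^sub>R dS (t - r)) (at r)"
      using vector_diff_chain_at[of "\<lambda>r. t - r" "- 1" r S, OF _ S_deriv]
        has_vector_derivative_diff[OF has_vector_derivative_const[of t] has_vector_derivative_id] r
      by (simp add: o_def)
    moreover have "((\<lambda>r. G (seg v r) y) has_vector_derivative K (seg v r) y) (at r)"
      by (intro bounded_linear.has_vector_derivative[OF blinfun.bounded_linear_left] G_deriv v r)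
    ultimately show "((\<lambda>r. S (t - r) (G (seg v r) y)) has_vector_derivative
        S (t - r) (K (seg v r) y) - dS (t - r) (G (seg v r) y)) (at r)"
      using bounded_bilinear.has_vector_derivative[OF bounded_bilinear_blinfun_apply, of
          "\<lambda>r. S (t - r)" "(- 1) *\<^sub>R dS (t - r)" r UNIV "\<lambda>r. G (seg v r) y" "K (seg v r) y"]
      by (simp add: blinfun.bilinear_simps)
  qed
  then show ?thesis
    by (simp add: set_integral_diff(2)[OF int2 int1] S_0 algebra_simps)
qed

text \<open>Splitting the integrals at \<open>\<tau>\<close> and pulling \<open>S(t)\<close> out of the parts over \<open>[0, \<tau>]\<close> expresses
  \<open>u(\<tau> + t)\<close> through \<open>u(\<tau>)\<close>, except that the noise is \<open>w(r + \<tau>)\<close> and that \<open>u(\<tau>)\<close> occurs without its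
  term \<open>G(u\<^sub>\<tau>) w(\<tau>)\<close>.  Integration by parts with the constant vector \<open>w(\<tau>)\<close> shows that this term is
  exactly the effect of passing to the shifted noise \<open>w(r + \<tau>) - w(\<tau>)\<close>.\<close>

lemma solution_shift:
  assumes w: "continuous_on {0..} w" and \<tau>: "\<tau> \<ge> 0" and sol: "sol w \<xi> u"
  defines "v \<equiv> restrict (\<lambda>s. u (s + \<tau>)) {-\<mu>..}"
  shows "sol (wiener_shift \<tau> w) (seg u \<tau>) v"
proof -
  have u: "continuous_on {-\<mu>..} u" using sol by (simp add: global_mild_solution_def)
  have u_rhs: "u t = rhs w \<xi> u t" if "t \<ge> 0" for t using sol that by (simp add: global_mild_solution_def)
  have v: "continuous_on {-\<mu>..} v"
  proof -
    have "continuous_on {-\<mu>..} (\<lambda>s. u (s + \<tau>))"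
      by (rule continuous_on_compose2[OF u]) (use \<tau> in \<open>auto intro!: continuous_intros\<close>)
    then show ?thesis unfolding v_def by (rule continuous_on_eq) auto
  qed
  have w_shift: "continuous_on {0..} (\<lambda>r. w (r + \<tau>))"
    by (rule continuous_on_compose2[OF w]) (use \<tau> in \<open>auto intro!: continuous_intros\<close>)
  have w': "continuous_on {0..} (wiener_shift \<tau> w)"
    unfolding wiener_shift_def by (intro continuous_intros w_shift)
  have cy: "continuous_on {0..} (\<lambda>_. w \<tau>)" by simp
  have seg_v: "seg v r = seg u (r + \<tau>)" if "r \<ge> 0" for r
    using that by (auto simp: v_def segment_def restrict_def fun_eq_iff add_ac)
  have rhs_v: "v t = rhs (wiener_shift \<tau> w) (seg u \<tau>) v t" if t: "t \<ge> 0" for t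
  proof -
    have tt: "\<tau> + t \<ge> 0" using t \<tau> by simp
    \<comment> \<open>\<open>J\<close>: integrals after time \<open>\<tau>\<close>, primed with the constant noise \<open>w \<tau>\<close>; \<open>I\<close>: integrals up to time \<open>\<tau>\<close>.\<close>
    define JF where "JF = (LINT r:{0..t}|lborel. S (t - r) (F (seg v r)))"
    define JA where "JA = (LINT r:{0..t}|lborel. dS (t - r) (G (seg v r) (w (r + \<tau>))))"
    define JK where "JK = (LINT r:{0..t}|lborel. S (t - r) (K (seg v r) (w (r + \<tau>))))"
    define JA' where "JA' = (LINT r:{0..t}|lborel. dS (t - r) (G (seg v r) (w \<tau>)))"
    define JK' where "JK' = (LINT r:{0..t}|lborel. S (t - r) (K (seg v r) (w \<tau>)))"
    define IF where "IF = (LINT r:{0..\<tau>}|lborel. S (\<tau> - r) (F (seg u r)))"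
    define IA where "IA = (LINT r:{0..\<tau>}|lborel. dS (\<tau> - r) (G (seg u r) (w r)))"
    define IK where "IK = (LINT r:{0..\<tau>}|lborel. S (\<tau> - r) (K (seg u r) (w r)))"
    have split_S: "(LINT r:{0..\<tau> + t}|lborel. S (\<tau> + t - r) (x r))
        = S t (LINT r:{0..\<tau>}|lborel. S (\<tau> - r) (x r)) + (LINT r:{0..t}|lborel. S (t - r) (x (r + \<tau>)))"
      if x: "continuous_on {0..} x" for x
    proof -
      have "S t (LINT r:{0..\<tau>}|lborel. S (\<tau> - r) (x r)) = (LINT r:{0..\<tau>}|lborel. S (\<tau> + t - r) (x r))"
        unfolding blinfun_set_integral[OF S_conv_integrable[OF u w x]]
        by (rule set_lebesgue_integral_cong) (use t in \<open>auto simp: S_add[symmetric] algebra_simps\<close>)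
      then show ?thesis
        using set_integral_split_shift[OF \<tau> t S_conv_integrable[OF u w x]] by (simp add: algebra_simps)
    qed
    have split_A: "(LINT r:{0..\<tau> + t}|lborel. dS (\<tau> + t - r) (x r))
        = S t (LINT r:{0..\<tau>}|lborel. dS (\<tau> - r) (x r)) + (LINT r:{0..t}|lborel. dS (t - r) (x (r + \<tau>)))"
      if x: "\<And>t. set_integrable lborel {0..t} (\<lambda>r. dS (t - r) (x r))" for x
    proof -
      have "S t (LINT r:{0..\<tau>}|lborel. dS (\<tau> - r) (x r)) = (LINT r:{0..\<tau>}|lborel. dS (\<tau> + t - r) (x r))"
        unfolding blinfun_set_integral[OF x] unfolding set_integral_Icc_Ico
        by (rule set_lebesgue_integral_cong) (use t in \<open>auto simp: dS_add[symmetric] algebra_simps\<close>)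
      then show ?thesis
        using set_integral_split_shift[OF \<tau> t x] by (simp add: algebra_simps)
    qed
    have cong: "(LINT r:{0..t}|lborel. f (seg u (r + \<tau>)) r) = (LINT r:{0..t}|lborel. f (seg v r) r)"
      for f :: "_ \<Rightarrow> real \<Rightarrow> 'h"
      by (rule set_lebesgue_integral_cong) (auto simp: seg_v)
    have intA: "set_integrable lborel {0..t} (\<lambda>r. dS (t - r) (G (seg u r) (w r)))" for t
      by (rule dS_conv_integrable[OF u w])
    have "u (\<tau> + t) = S (\<tau> + t) (\<xi> 0) + (S t IF + JF) + G (seg v t) (w (\<tau> + t)) + (S t IA + JA) - (S t IK + JK)"
      unfolding u_rhs[OF tt] mild_rhs_def A_conv_eq split_S[OF F_cont[OF u]] split_S[OF K_w_cont[OF u w]]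
        split_A[OF intA] cong[of "\<lambda>x r. S (t - r) (F x)"]
        cong[of "\<lambda>x r. S (t - r) (K x (w (r + \<tau>)))"] cong[of "\<lambda>x r. dS (t - r) (G x (w (r + \<tau>)))"]
        JF_def JA_def JK_def IF_def IA_def IK_def seg_v[OF t] add.commute[of t \<tau>] ..
    moreover have "u \<tau> = S \<tau> (\<xi> 0) + IF + G (seg u \<tau>) (w \<tau>) + IA - IK"
      unfolding IF_def IA_def IK_def A_conv_eq[symmetric]
      using u_rhs[OF \<tau>] unfolding mild_rhs_def .
    then have "S t (u \<tau>) = S (\<tau> + t) (\<xi> 0) + S t IF + S t (G (seg u \<tau>) (w \<tau>)) + S t IA - S t IK"
      using S_add[OF t \<tau>, of "\<xi> 0"] by (simp add: blinfun.bilinear_simps add.commute)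
    moreover have "S t (G (seg u \<tau>) (w \<tau>)) = G (seg v t) (w \<tau>) + JA' - JK'"
      using integration_by_parts[OF v t, of "w \<tau>"] seg_v[of 0] by (simp add: JA'_def JK'_def)
    moreover have "rhs (wiener_shift \<tau> w) (seg u \<tau>) v t
        = S t (u \<tau>) + JF + G (seg v t) (w (\<tau> + t) - w \<tau>) + (JA - JA') - (JK - JK')"
    proof -
      have intA1: "set_integrable lborel {0..t} (\<lambda>r. dS (t - r) (G (seg v r) (w (r + \<tau>))))"
        by (rule dS_conv_integrable[OF v w_shift])
      have intA2: "set_integrable lborel {0..t} (\<lambda>r. dS (t - r) (G (seg v r) (w \<tau>)))"
            by (rule dS_conv_integrable[OF v cy])
      have eA: "JA - JA' = (LINT r:{0..t}|lborel. A (S (t - r) (G (seg v r) (wiener_shift \<tau> w r))))"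
        unfolding JA_def JA'_def set_integral_diff(2)[OF intA1 intA2, symmetric] A_conv_eq
        by (simp add: wiener_shift_def blinfun.bilinear_simps)
      have eK: "JK - JK' = (LINT r:{0..t}|lborel. S (t - r) (K (seg v r) (wiener_shift \<tau> w r)))"
        unfolding JK_def JK'_def
          set_integral_diff(2)[OF S_conv_integrable[OF v w K_w_cont[OF v w_shift]]
            S_conv_integrable[OF v w K_w_cont[OF v cy]], symmetric]
        by (simp add: wiener_shift_def blinfun.bilinear_simps)
      show ?thesis
        unfolding mild_rhs_def eA eK JF_def using mu
        by (simp add: segment_apply wiener_shift_def add.commute)
    qed
    ultimately have "u (\<tau> + t) = rhs (wiener_shift \<tau> w) (seg u \<tau>) v t"
      by (simp add: blinfun.bilinear_simps)
    then show ?thesis using t mu by (simp add: v_def add.commute)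
  qed
  show ?thesis
    unfolding sol_iff[OF w']
    using v rhs_v by (auto simp: v_def segment_apply add.commute)
qed

end

section \<open>Piecewise linear interpolation and Borel sets of path spaces\<close>

definition hat :: "real \<Rightarrow> real" where "hat x = max 0 (1 - \<bar>x\<bar>)"

text \<open>The piecewise linear function on \<open>[0, N]\<close> with value \<open>a k\<close> at the node \<open>k\<close>.\<close>

definition hat_interp :: "(nat \<Rightarrow> 'a::real_normed_vector) \<Rightarrow> nat \<Rightarrow> real \<Rightarrow> 'a" where
  "hat_interp a N y = (\<Sum>k\<le>N. hat (y - real k) *\<^sub>R a k)"

lemma hat_nonneg: "hat x \<ge> 0" and hat_le_1: "hat x \<le> 1" and hat_eq_0: "\<bar>x\<bar> \<ge> 1 \<Longrightarrow> hat x = 0"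
  by (auto simp: hat_def)

lemma sum_hat: "0 \<le> y \<Longrightarrow> y \<le> real N \<Longrightarrow> (\<Sum>k\<le>N. hat (y - real k)) = 1"
proof (induction N)
  case (Suc N)
  show ?case
  proof (cases "y \<le> real N")
    case True
    then show ?thesis using Suc by (simp add: hat_eq_0)
  next
    case False
    then have "(\<Sum>k<N. hat (y - real k)) = 0"
      by (intro sum.neutral) (auto intro!: hat_eq_0)
    moreover have "hat (y - real N) + hat (y - real (Suc N)) = 1"
      using False Suc.prems by (simp add: hat_def)
    ultimately show ?thesis
      by (simp add: lessThan_Suc_atMost[symmetric])
  qed
qed (simp add: hat_def)

lemma continuous_on_hat_interp [continuous_intros]:
  "continuous_on X f \<Longrightarrow> continuous_on X (\<lambda>x. hat_interp a N (f x))"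
  unfolding hat_interp_def hat_def by (intro continuous_intros)

text \<open>The hat functions are a partition of unity, so the interpolant at \<open>y\<close> is an average of the values at
  the nodes at distance less than \<open>1\<close> from \<open>y\<close>.\<close>

lemma hat_interp_approx:
  assumes y: "0 \<le> y" "y \<le> real N"
    and a: "\<And>k. k \<le> N \<Longrightarrow> \<bar>y - real k\<bar> < 1 \<Longrightarrow> norm (a k - z) \<le> e"
  shows "norm (hat_interp a N y - z) \<le> e"
proof -
  have "hat_interp a N y - z = (\<Sum>k\<le>N. hat (y - real k) *\<^sub>R (a k - z))"
    using sum_hat[OF y] by (simp add: hat_interp_def scaleR_diff_right sum_subtractf scaleR_left.sum[symmetric])
  also have "norm \<dots> \<le> (\<Sum>k\<le>N. hat (y - real k) * e)"
  proof (rule sum_norm_le)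
    fix k assume "k \<in> {..N}"
    then show "norm (hat (y - real k) *\<^sub>R (a k - z)) \<le> hat (y - real k) * e"
      using a[of k] hat_eq_0[of "y - real k"] hat_nonneg[of "y - real k"]
      by (cases "\<bar>y - real k\<bar> < 1") (auto intro: mult_left_mono)
  qed
  also have "\<dots> = e" using sum_hat[OF y] by (simp add: sum_distrib_right[symmetric])
  finally show ?thesis .
qed

lemma hat_interp_diff_le:
  "norm (hat_interp a N y - hat_interp b N y) \<le> (\<Sum>k\<le>N. norm (a k - b k))"
proof -
  have "hat_interp a N y - hat_interp b N y = (\<Sum>k\<le>N. hat (y - real k) *\<^sub>R (a k - b k))"
    by (simp add: hat_interp_def scaleR_diff_right sum_subtractf)
  also have "norm \<dots> \<le> (\<Sum>k\<le>N. norm (a k - b k))"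
    by (rule sum_norm_le) (simp add: hat_nonneg hat_le_1 mult_left_le_one_le)
  finally show ?thesis .
qed

text \<open>The mesh is \<open>1/n\<close> and the nodes fill \<open>[0, n]\<close>, hence every bounded interval for large \<open>n\<close>.  The value at
  time \<open>0\<close> is forced to be \<open>0\<close>, so that arbitrary coefficients give an admissible noise path.\<close>

definition interp_noise :: "nat \<Rightarrow> (nat \<Rightarrow> 'a::real_normed_vector) \<Rightarrow> real \<Rightarrow> 'a" where
  "interp_noise n a t = hat_interp (a(0 := 0)) (n * n) (real n * t)"

text \<open>The affine map \<open>s \<mapsto> n (s + \<mu>) / \<mu>\<close> sends \<open>[-\<mu>, 0]\<close> onto \<open>[0, n]\<close>.\<close>

definition interp_history :: "real \<Rightarrow> nat \<Rightarrow> (nat \<Rightarrow> 'a::real_normed_vector) \<Rightarrow> real \<Rightarrow> 'a" where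
  "interp_history \<mu> n b = restrict (\<lambda>s. hat_interp b n (real n * (s + \<mu>) / \<mu>)) {-\<mu>..0}"

lemma interp_noise_continuous: "continuous_on X (interp_noise n a)"
  unfolding interp_noise_def by (intro continuous_intros)

lemma interp_noise_0: "interp_noise n a 0 = 0"
  unfolding interp_noise_def hat_interp_def
  by (intro sum.neutral) (auto simp: hat_def)

lemma interp_history_in: "\<mu> > 0 \<Longrightarrow> interp_history \<mu> n b \<in> mspace (delay_space \<mu>)"
proof -
  assume "\<mu> > 0"
  then have "continuous_on {-\<mu>..0} (\<lambda>s. hat_interp b n (real n * (s + \<mu>) / \<mu>))"
    by (intro continuous_intros) auto
  then show ?thesis
    unfolding mspace_delay_space interp_history_def by (auto intro: continuous_on_eq)
qed

lemma interp_noise_converges: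
  fixes w :: "real \<Rightarrow> 'a::real_normed_vector"
  assumes w: "continuous_on {0..} w" "w 0 = 0" and e: "e > 0"
  shows "\<forall>\<^sub>F n in sequentially. \<forall>t\<in>{0..T}. norm (interp_noise n (\<lambda>k. w (real k / real n)) t - w t) \<le> e"
proof -
  have "uniformly_continuous_on {0..T + 1} w"
    by (intro compact_uniformly_continuous continuous_on_subset[OF w(1)]) auto
  then obtain d where d: "d > 0"
    "\<And>x x'. x \<in> {0..T + 1} \<Longrightarrow> x' \<in> {0..T + 1} \<Longrightarrow> dist x' x < d \<Longrightarrow> dist (w x') (w x) < e"
    using e unfolding uniformly_continuous_on_def by metis
  obtain n0 :: nat where n0: "real n0 > max (max T (1 / d)) 1"
    using reals_Archimedean2 by blast
  show ?thesis
    unfolding eventually_sequentially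
  proof (intro exI[of _ n0] allI impI ballI)
    fix n t assume n: "n0 \<le> n" and t: "t \<in> {0..T}"
    then have n': "real n > T" "real n > 1 / d" "real n > 1" using n0 by auto
    then have inv: "1 / real n < d" "1 / real n < 1" using d by (auto simp: field_simps)
    show "norm (interp_noise n (\<lambda>k. w (real k / real n)) t - w t) \<le> e"
      unfolding interp_noise_def
    proof (rule hat_interp_approx)
      show "0 \<le> real n * t" using t by simp
      show "real n * t \<le> real (n * n)" using t n' by (simp add: mult_left_mono)
      fix k assume k: "\<bar>real n * t - real k\<bar> < 1"
      have "((\<lambda>k. w (real k / real n))(0 := 0)) k = w (real k / real n)"
        using w(2) by simp
      moreover have "\<bar>real k / real n - t\<bar> = \<bar>real n * t - real k\<bar> / real n"
        using n' by (simp add: field_simps abs_if)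
      then have kt: "\<bar>real k / real n - t\<bar> < 1 / real n"
        using k n' by (simp add: divide_strict_right_mono)
      then have "dist (w (real k / real n)) (w t) < e"
        using t inv by (intro d(2)) (auto simp: dist_real_def abs_less_iff)
      ultimately show "norm (((\<lambda>k. w (real k / real n))(0 := 0)) k - w t) \<le> e"
        by (simp add: dist_norm)
    qed
  qed
qed

text \<open>The coefficients need only be close to the values of \<open>\<xi>\<close> at the nodes: exact values give the
  approximation of \<open>\<xi>\<close>, values from a countable dense set give separability.\<close>

lemma interp_history_approx:
  fixes \<xi> :: "real \<Rightarrow> 'a::real_normed_vector"
  assumes \<mu>: "\<mu> > 0" and \<xi>: "\<xi> \<in> mspace (delay_space \<mu>)" and e: "e > 0"
  shows "\<forall>\<^sub>F n in sequentially. \<forall>b. (\<forall>k\<le>n. norm (b k - \<xi> (- \<mu> + real k * \<mu> / real n)) \<le> e / 2) \<longrightarrow>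
    mdist (delay_space \<mu>) (interp_history \<mu> n b) \<xi> \<le> e"
proof -
  have "uniformly_continuous_on {-\<mu>..0} \<xi>"
    using \<xi> by (intro compact_uniformly_continuous) (auto simp: mspace_delay_space)
  then obtain d where d: "d > 0"
    "\<And>x x'. x \<in> {-\<mu>..0} \<Longrightarrow> x' \<in> {-\<mu>..0} \<Longrightarrow> dist x' x < d \<Longrightarrow> dist (\<xi> x') (\<xi> x) < e / 2"
    using e unfolding uniformly_continuous_on_def by (metis half_gt_zero)
  obtain n0 :: nat where n0: "real n0 > \<mu> / d"
    using reals_Archimedean2 by blast
  show ?thesis
    unfolding eventually_sequentially
  proof (intro exI[of _ n0] allI impI)
    fix n b assume n: "n0 \<le> n" and b: "\<forall>k\<le>n. norm (b k - \<xi> (- \<mu> + real k * \<mu> / real n)) \<le> e / 2"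
    have "real n > \<mu> / d" using n n0 by linarith
    moreover have "0 < \<mu> / d" using \<mu> d(1) by simp
    ultimately have n': "real n > 0" by linarith
    then have "\<mu> / real n < d"
      using \<open>real n > \<mu> / d\<close> d(1) by (simp add: pos_divide_less_eq mult.commute)
    note n' = n' this
    show "mdist (delay_space \<mu>) (interp_history \<mu> n b) \<xi> \<le> e"
    proof (subst mdist_delay_space_le)
      show "\<forall>s\<in>{-\<mu>..0}. dist (interp_history \<mu> n b s) (\<xi> s) \<le> e"
      proof
        fix s assume s: "s \<in> {-\<mu>..0}"
        have "norm (hat_interp b n (real n * (s + \<mu>) / \<mu>) - \<xi> s) \<le> e"
        proof (rule hat_interp_approx)
          show "0 \<le> real n * (s + \<mu>) / \<mu>" using s \<mu> by simp
          show "real n * (s + \<mu>) / \<mu> \<le> real n"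
            using mult_left_mono[of "s + \<mu>" \<mu> "real n"] s \<mu> by (simp add: pos_divide_le_eq)
          fix k assume k: "k \<le> n" "\<bar>real n * (s + \<mu>) / \<mu> - real k\<bar> < 1"
          have "(- \<mu> + real k * \<mu> / real n) - s = - (real n * (s + \<mu>) / \<mu> - real k) * (\<mu> / real n)"
            using n' \<mu> by (simp add: field_simps)
          then have "\<bar>(- \<mu> + real k * \<mu> / real n) - s\<bar> = \<bar>real n * (s + \<mu>) / \<mu> - real k\<bar> * (\<mu> / real n)"
            using \<mu> n' by (simp add: abs_mult abs_minus_commute)
          also have "\<dots> < 1 * (\<mu> / real n)"
            using k(2) \<mu> n' by (intro mult_strict_right_mono) auto
          finally have ks: "\<bar>(- \<mu> + real k * \<mu> / real n) - s\<bar> < d" using n' by simp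
          have "real k * \<mu> / real n \<le> \<mu>"
            using k(1) \<mu> n' by (simp add: field_simps)
          then have "dist (\<xi> (- \<mu> + real k * \<mu> / real n)) (\<xi> s) < e / 2"
            using s ks \<mu> by (intro d(2)) (auto simp: dist_real_def)
          moreover have "dist (b k) (\<xi> (- \<mu> + real k * \<mu> / real n)) \<le> e / 2"
            using b k(1) by (simp add: dist_norm)
          ultimately show "norm (b k - \<xi> s) \<le> e"
            using dist_triangle[of "b k" "\<xi> s" "\<xi> (- \<mu> + real k * \<mu> / real n)"]
            by (simp add: dist_norm)
        qed
        then show "dist (interp_history \<mu> n b s) (\<xi> s) \<le> e"
          using s by (simp add: interp_history_def dist_norm)
      qed
    qed (use \<mu> \<xi> in \<open>auto intro: interp_history_in\<close>)
  qed
qed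

text \<open>Interpolants with coefficients in a countable dense set, encoded by finite lists.\<close>

lemma delay_space_separable:
  assumes \<mu>: "\<mu> > 0"
  obtains E :: "(real \<Rightarrow> 'a::{real_normed_vector, second_countable_topology}) set"
  where "countable E" "E \<subseteq> mspace (delay_space \<mu>)"
    "\<And>x e. x \<in> mspace (delay_space \<mu>) \<Longrightarrow> e > 0 \<Longrightarrow> \<exists>y\<in>E. mdist (delay_space \<mu>) y x \<le> e"
proof -
  obtain C :: "'a set" where C: "countable C" "\<And>X. open X \<Longrightarrow> X \<noteq> {} \<Longrightarrow> \<exists>c\<in>C. c \<in> X"
    using countable_dense_setE by metis
  define E where "E = (\<lambda>(n, xs). interp_history \<mu> n (\<lambda>k. if k < length xs then xs ! k else 0)) ` (UNIV \<times> lists C)"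
  have "countable E" unfolding E_def using C(1) by (intro countable_image countable_SIGMA) auto
  moreover have "E \<subseteq> mspace (delay_space \<mu>)" unfolding E_def using interp_history_in[OF \<mu>] by auto
  moreover have "\<exists>y\<in>E. mdist (delay_space \<mu>) y x \<le> e" if x: "x \<in> mspace (delay_space \<mu>)" and e: "e > 0" for x e
  proof -
    obtain n where n: "\<And>b. (\<forall>k\<le>n. norm (b k - x (- \<mu> + real k * \<mu> / real n)) \<le> e / 2) \<Longrightarrow>
        mdist (delay_space \<mu>) (interp_history \<mu> n b) x \<le> e"
      using interp_history_approx[OF \<mu> x e] unfolding eventually_sequentially by blast
    have "\<exists>c\<in>C. c \<in> ball (x (- \<mu> + real k * \<mu> / real n)) (e / 2)" for k
      using e by (intro C(2)) auto
    then obtain c where c: "\<And>k. c k \<in> C" "\<And>k. c k \<in> ball (x (- \<mu> + real k * \<mu> / real n)) (e / 2)"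
      by metis
    define xs where "xs = map c [0..<Suc n]"
    have "mdist (delay_space \<mu>) (interp_history \<mu> n (\<lambda>k. if k < length xs then xs ! k else 0)) x \<le> e"
    proof (rule n, intro allI impI)
      fix k assume "k \<le> n"
      then have "xs ! k = c k" "k < length xs"
        by (auto simp: xs_def simp del: upt_Suc)
      then show "norm ((if k < length xs then xs ! k else 0) - x (- \<mu> + real k * \<mu> / real n)) \<le> e / 2"
        using c(2)[of k] by (simp add: dist_norm norm_minus_commute less_imp_le)
    qed
    moreover have "xs \<in> lists C" using c(1) by (auto simp: xs_def)
    ultimately show ?thesis unfolding E_def by force
  qed
  ultimately show thesis by (rule that)
qed

lemma space_borel_of_topology [simp]: "space (borel_of_topology X) = topspace X"
  unfolding borel_of_topology_def by (rule space_measure_of) (auto dest: openin_subset)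

lemma open_in_borel_of_topology: "openin X U \<Longrightarrow> U \<in> sets (borel_of_topology X)"
  unfolding borel_of_topology_def by (subst sets_measure_of) (auto dest: openin_subset)

lemma continuous_map_borel_measurable:
  assumes "continuous_map X euclidean f" shows "f \<in> borel_measurable (borel_of_topology X)"
proof (rule borel_measurableI)
  fix U :: "'b set" assume "open U"
  then have "openin X {x \<in> topspace X. f x \<in> U}"
    using assms by (auto simp: continuous_map_def)
  moreover have "f -` U \<inter> space (borel_of_topology X) = {x \<in> topspace X. f x \<in> U}" by auto
  ultimately show "f -` U \<inter> space (borel_of_topology X) \<in> sets (borel_of_topology X)"
    by (simp add: open_in_borel_of_topology)
qed

lemma delay_space_eval_measurable:
  fixes \<mu> :: real
  assumes \<mu>: "\<mu> \<ge> 0" and s: "s \<in> {-\<mu>..0}"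
  shows "(\<lambda>x. x s :: 'a::metric_space) \<in> borel_measurable (borel_of_topology (mtopology_of (delay_space \<mu>)))"
proof (rule continuous_map_borel_measurable)
  have "Lipschitz_continuous_map (delay_space \<mu>) euclidean_metric (\<lambda>x. x s :: 'a)"
    unfolding Lipschitz_continuous_map_def
    using dist_le_mdist_delay_space[OF \<mu> _ _ s] by (auto intro!: exI[of _ 1])
  from Lipschitz_continuous_imp_continuous_map[OF this]
  show "continuous_map (mtopology_of (delay_space \<mu>)) euclidean (\<lambda>x. x s :: 'a)"
    by simp
qed

text \<open>By separability an open set is a countable union of closed balls with centres in a countable set and
  rational radii.  Membership in a closed ball is a condition on the values at countably many points,
  since both functions are continuous.\<close>

lemma delay_space_measurableI:
  fixes f :: "'b \<Rightarrow> real \<Rightarrow> 'a::{real_normed_vector, second_countable_topology}"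
  assumes \<mu>: "\<mu> > 0" and f: "\<And>x. x \<in> space M \<Longrightarrow> f x \<in> mspace (delay_space \<mu>)"
    and meas: "\<And>s. s \<in> {-\<mu>..0} \<Longrightarrow> (\<lambda>x. f x s) \<in> borel_measurable M"
  shows "f \<in> M \<rightarrow>\<^sub>M borel_of_topology (mtopology_of (delay_space \<mu>))"
proof -
  let ?V = "delay_space \<mu> :: (real \<Rightarrow> 'a) metric"
  interpret V: Metric_space "mspace ?V" "mdist ?V" by (rule Metric_space_mspace_mdist)
  obtain E :: "(real \<Rightarrow> 'a) set" where E: "countable E" "E \<subseteq> mspace ?V"
    "\<And>x e. x \<in> mspace ?V \<Longrightarrow> e > 0 \<Longrightarrow> \<exists>y\<in>E. mdist ?V y x \<le> e"
    using delay_space_separable[OF \<mu>] by blast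
  \<comment> \<open>The rationals clamped to \<open>[-\<mu>, 0]\<close>: dense in the interval and containing its end points.\<close>
  define P where "P = (\<lambda>r. max (- \<mu>) (min r 0)) ` \<rat>"
  have P: "countable P" "P \<subseteq> {-\<mu>..0}"
    unfolding P_def using \<mu> by (auto intro: countable_rat)
  have dense: "(\<forall>s\<in>{-\<mu>..0}. dist (y s) (x s) \<le> q) \<longleftrightarrow> (\<forall>s\<in>P. dist (y s) (x s) \<le> q)"
    if "x \<in> mspace ?V" "y \<in> mspace ?V" for x y q
  proof (intro iffI ballI)
    fix s assume *: "\<forall>s\<in>P. dist (y s) (x s) \<le> q" and s: "s \<in> {-\<mu>..0}"
    define h where "h r = dist (y (max (- \<mu>) (min r 0))) (x (max (- \<mu>) (min r 0)))" for r
    have clamp: "continuous_on UNIV (\<lambda>r. z (max (- \<mu>) (min r 0)))" if "z \<in> mspace ?V" for z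
      by (rule continuous_on_compose2[of "{-\<mu>..0}" z])
        (use that \<mu> in \<open>auto simp: mspace_delay_space intro!: continuous_intros\<close>)
    have "continuous_on UNIV h" unfolding h_def
      by (rule continuous_on_dist[OF clamp[OF that(2)] clamp[OF that(1)]])
    then have "closed {r. h r \<le> q}"
      using closed_Collect_le[of h "\<lambda>_. q"] by (auto intro: continuous_on_const)
    moreover have "\<rat> \<subseteq> {r. h r \<le> q}" using * by (auto simp: h_def P_def)
    ultimately have "closure \<rat> \<subseteq> {r. h r \<le> q}" by (rule closure_minimal[rotated])
    then have "h s \<le> q" using Rats_closure_real by auto
    then show "dist (y s) (x s) \<le> q" using s by (simp add: h_def min_def max_def split: if_splits)
  qed (use P in auto)
  define cb where "cb y q = {x \<in> mspace ?V. mdist ?V y x \<le> q}" for y q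
  have cb: "f -` cb y q \<inter> space M \<in> sets M" if y: "y \<in> E" for y q
  proof -
    have "f -` cb y q \<inter> space M = {x \<in> space M. \<forall>s\<in>P. dist (y s) (f x s) \<le> q}"
    proof -
      have "f x \<in> cb y q \<longleftrightarrow> (\<forall>s\<in>P. dist (y s) (f x s) \<le> q)" if "x \<in> space M" for x
        using f[OF that] E(2) y dense[OF f[OF that], of y q] mdist_delay_space_le[of \<mu> y "f x" q] \<mu>
        by (auto simp: cb_def)
      then show ?thesis by auto
    qed
    also have "\<dots> \<in> sets M"
      using P meas by (intro sets.sets_Collect_countable_All') (auto intro!: borel_measurable_le borel_measurable_dist)
    finally show ?thesis .
  qed
  show ?thesis
    unfolding borel_of_topology_def
  proof (rule measurable_measure_of)
    show "{U. openin (mtopology_of ?V) U} \<subseteq> Pow (topspace (mtopology_of ?V))"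
      using openin_subset by blast
    show "f \<in> space M \<rightarrow> topspace (mtopology_of ?V)" using f by auto
    fix U assume "U \<in> {U. openin (mtopology_of ?V) U}"
    then have U: "U \<subseteq> mspace ?V" "\<And>x. x \<in> U \<Longrightarrow> \<exists>r>0. V.mball x r \<subseteq> U"
      by (auto simp: mtopology_of_def V.openin_mtopology)
    define J where "J = {(y, q). y \<in> E \<and> q \<in> \<rat> \<and> cb y q \<subseteq> U}"
    have "U \<subseteq> (\<Union>(y, q)\<in>J. cb y q)"
    proof
      fix x assume x: "x \<in> U"
      then obtain r where r: "r > 0" "V.mball x r \<subseteq> U" using U by blast
      obtain q where q: "q \<in> \<rat>" "0 < q" "q < r / 2"
        using Rats_dense_in_real[of 0 "r / 2"] r by auto
      obtain y where y: "y \<in> E" "mdist ?V y x \<le> q" using E(3)[of x q] x U q by auto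
      have "cb y q \<subseteq> V.mball x r"
      proof
        fix z assume z: "z \<in> cb y q"
        have "mdist ?V x z \<le> mdist ?V x y + mdist ?V y z"
          using x z y U E(2) by (intro V.triangle) (auto simp: cb_def)
        also have "\<dots> \<le> q + q" using y z V.commute[of x y] by (intro add_mono) (auto simp: cb_def)
        finally show "z \<in> V.mball x r" using x z U q by (auto simp: cb_def)
      qed
      then have "(y, q) \<in> J" using r y q by (auto simp: J_def)
      moreover have "x \<in> cb y q" using x U y by (auto simp: cb_def)
      ultimately show "x \<in> (\<Union>(y, q)\<in>J. cb y q)" by blast
    qed
    then have "U = (\<Union>(y, q)\<in>J. cb y q)" by (auto simp: J_def)
    then have "f -` U \<inter> space M = (\<Union>(y, q)\<in>J. f -` cb y q \<inter> space M)" by auto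
    also have "\<dots> \<in> sets M"
    proof (rule sets.countable_UN')
      have "countable (E \<times> \<rat>)" using E(1) countable_rat by (rule countable_SIGMA)
      then show "countable J" by (rule countable_subset[rotated]) (auto simp: J_def)
    qed (use cb in \<open>auto simp: J_def\<close>)
    finally show "f -` U \<inter> space M \<in> sets M" .
  qed
qed

lemma topspace_C0_compact_open: "topspace (C0_compact_open :: (real \<Rightarrow> 'u::real_normed_vector) topology) = C0_paths"
  unfolding C0_compact_open_def topology_generated_by_topspace
proof (intro equalityI subsetI)
  fix w :: "real \<Rightarrow> 'u" assume "w \<in> C0_paths"
  then have "w \<in> {w \<in> C0_paths. w ` {} \<subseteq> UNIV}" by simp
  then show "w \<in> \<Union> {{w \<in> C0_paths. w ` C \<subseteq> V} | C V. compact C \<and> open V}"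
    using compact_empty open_UNIV by blast
qed auto

text \<open>Evaluation at \<open>r\<close> is continuous for the compact-open topology: take the compact set \<open>{r}\<close>.\<close>

lemma C0_eval_measurable:
  "(\<lambda>w. w r :: 'u::real_normed_vector) \<in> borel_measurable (borel_of_topology C0_compact_open)"
proof (rule continuous_map_borel_measurable)
  show "continuous_map C0_compact_open euclidean (\<lambda>w. w r :: 'u)"
    unfolding continuous_map_def
  proof (intro conjI allI impI)
    fix U :: "'u set" assume "openin euclidean U"
    then have "open U" by simp
    have "openin C0_compact_open {w \<in> C0_paths. w ` {r} \<subseteq> U}"
      unfolding C0_compact_open_def
      by (rule topology_generated_by_Basis) (use \<open>open U\<close> compact_sing in blast)
    then show "openin C0_compact_open {w \<in> topspace C0_compact_open. w r \<in> U}"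
      by (simp add: topspace_C0_compact_open)
  qed auto
qed

section \<open>Measurability and continuity of the solution map\<close>

context delay_equation
begin

abbreviation "mild \<equiv> the_mild_solution \<mu> A S F G K"

lemma mild_solution:
  assumes "continuous_on {0..} w" "w 0 = 0" "\<xi> \<in> mspace V"
  shows "sol w \<xi> (mild w \<xi>)"
  unfolding the_mild_solution_def
  using solution_exists[OF assms] solution_unique[OF assms(1,3)] by (metis theI')

lemma mild_eqI:
  assumes "continuous_on {0..} w" "\<xi> \<in> mspace V" "sol w \<xi> u"
  shows "mild w \<xi> = u"
  unfolding the_mild_solution_def
  using solution_unique[OF assms(1,2)] assms(3) by blast

text \<open>The times \<open>t' j\<close> may vary as well: the estimate is uniform on \<open>[-\<mu>, T]\<close> and the limit solution is
  continuous.\<close>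

lemma solution_converges:
  assumes w: "continuous_on {0..} w" and \<xi>: "\<xi> \<in> mspace V" and sol: "sol w \<xi> u"
    and w': "\<And>j. continuous_on {0..} (w' j)" and \<xi>': "\<And>j. \<xi>' j \<in> mspace V"
    and sol': "\<And>j. sol (w' j) (\<xi>' j) (u' j)"
    and lim_w: "\<And>T e. e > 0 \<Longrightarrow> \<forall>\<^sub>F j in sequentially. \<forall>r\<in>{0..T}. norm (w' j r - w r) \<le> e"
    and lim_\<xi>: "\<And>e. e > 0 \<Longrightarrow> \<forall>\<^sub>F j in sequentially. mdist V (\<xi>' j) \<xi> \<le> e"
    and t: "t \<ge> -\<mu>" and t': "\<And>j. t' j \<ge> -\<mu>" and lim_t: "t' \<longlonglongrightarrow> t"
  shows "(\<lambda>j. u' j (t' j)) \<longlonglongrightarrow> u t"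
proof -
  note u = sol_continuous[OF sol]
  define T where "T = \<bar>t\<bar> + 1"
  have T: "T \<ge> 0" "t < T" by (auto simp: T_def)
  obtain R where R: "R \<ge> 0" "\<And>r. r \<in> {0..T} \<Longrightarrow> norm (w r) \<le> R"
    using bounded_on_interval[OF w, of T] by auto
  obtain M where M: "M \<ge> 0" "\<forall>r\<in>{0..T}. norm (G (seg u r)) \<le> M \<and> norm (K (seg u r)) \<le> M \<and>
      (\<forall>s>0. \<forall>v. norm (dS s (G (seg u r) v)) \<le> M * s powr (\<nu> - 1) * norm v)"
    using path_bounds[OF u, of T] by blast
  have R1: "R + 1 \<ge> 0" using R by simp
  obtain C where C: "C \<ge> 0" and est: "\<And>w w' \<xi> \<xi>' u u' M \<delta>.
    continuous_on {0..} w \<Longrightarrow> continuous_on {0..} w' \<Longrightarrow> \<xi> \<in> mspace V \<Longrightarrow> \<xi>' \<in> mspace V \<Longrightarrow>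
    sol w \<xi> u \<Longrightarrow> sol w' \<xi>' u' \<Longrightarrow> M \<ge> 0 \<Longrightarrow> \<delta> \<ge> 0 \<Longrightarrow>
    (\<forall>r\<in>{0..T}. norm (w' r) \<le> R + 1 \<and> norm (w r - w' r) \<le> \<delta> \<and>
      norm (G (seg u r)) \<le> M \<and> norm (K (seg u r)) \<le> M \<and>
      (\<forall>s>0. \<forall>v. norm (dS s (G (seg u r) v)) \<le> M * s powr (\<nu> - 1) * norm v)) \<Longrightarrow>
    (\<forall>t\<in>{-\<mu>..T}. norm (u t - u' t) \<le> C * (mdist V \<xi> \<xi>' + M * \<delta>))"
    using solution_estimate[OF T(1) R1] by blast
  have "(\<lambda>j. u' j (t' j) - u (t' j)) \<longlonglongrightarrow> 0"
  proof (rule tendstoI)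
    fix e :: real assume e: "e > 0"
    define d where "d = min 1 (e / (2 * (C + 1) * (M + 1)))"
    have d: "d > 0" "d \<le> 1" "d * ((C + 1) * (M + 1)) \<le> e / 2"
    proof -
      show "d > 0" "d \<le> 1" using e C M by (auto simp: d_def intro!: divide_pos_pos mult_pos_pos)
      have "d * ((C + 1) * (M + 1)) \<le> e / (2 * (C + 1) * (M + 1)) * ((C + 1) * (M + 1))"
        using C M by (intro mult_right_mono) (auto simp: d_def)
      also have "\<dots> = e / 2" using C M by (simp add: field_simps add_nonneg_eq_0_iff)
      finally show "d * ((C + 1) * (M + 1)) \<le> e / 2" .
    qed
    have "\<forall>\<^sub>F j in sequentially. t' j < T"
      by (rule order_tendstoD(2)[OF lim_t T(2)])
    with lim_w[OF d(1), of T] lim_\<xi>[OF d(1)]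
    show "\<forall>\<^sub>F j in sequentially. dist (u' j (t' j) - u (t' j)) 0 < e"
    proof eventually_elim
      case (elim j)
      have "norm (w' j r) \<le> R + 1" if "r \<in> {0..T}" for r
      proof -
        have "norm (w' j r) \<le> norm (w r) + norm (w' j r - w r)" by norm
        also have "\<dots> \<le> R + 1" using R(2)[OF that] elim(1) that d(2) by (intro add_mono) force+
        finally show ?thesis .
      qed
      then have "\<forall>s\<in>{-\<mu>..T}. norm (u s - u' j s) \<le> C * (mdist V \<xi> (\<xi>' j) + M * d)"
        using elim(1) M(2) by (intro est[OF w w' \<xi> \<xi>' sol sol' M(1) less_imp_le[OF d(1)]])
          (auto simp: norm_minus_commute)
      then have "norm (u (t' j) - u' j (t' j)) \<le> C * (mdist V \<xi> (\<xi>' j) + M * d)"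
        using elim(3) t'[of j] by auto
      also have "\<dots> \<le> (C + 1) * (d + M * d)"
        using elim(2) C M d by (intro mult_mono add_mono) (auto simp: mdist_commute)
      also have "\<dots> = d * ((C + 1) * (M + 1))" by (simp add: algebra_simps)
      also have "\<dots> < e" using d(3) e by simp
      finally show ?case by (simp add: norm_minus_commute)
    qed
  qed
  moreover have "(\<lambda>j. u (t' j)) \<longlonglongrightarrow> u t"
    by (rule continuous_on_tendsto_compose[OF u lim_t]) (use t t' in auto)
  ultimately have "(\<lambda>j. (u' j (t' j) - u (t' j)) + u (t' j)) \<longlonglongrightarrow> 0 + u t"
    by (rule tendsto_add)
  then show ?thesis by simp
qed

text \<open>With \<open>n\<close> fixed only finitely many coefficients matter, so pointwise convergence of the coefficients
  gives uniform convergence of the interpolated data.  Countable product types carry second countable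
  topologies, which turns this continuity into Borel measurability.\<close>

lemma interpolated_solution_continuous:
  assumes s: "s \<in> {-\<mu>..0}"
  shows "continuous_on UNIV (\<lambda>(t, a, b). mild (interp_noise n a) (interp_history \<mu> n b) (max t 0 + s))"
proof (rule continuous_on_sequentiallyI)
  fix z :: "nat \<Rightarrow> real \<times> (nat \<Rightarrow> 'u) \<times> (nat \<Rightarrow> 'h)" and z0
  assume z: "z \<longlonglongrightarrow> z0"
  define t a b where "t j = fst (z j)" and "a j = fst (snd (z j))" and "b j = snd (snd (z j))" for j
  obtain t0 a0 b0 where z0: "z0 = (t0, a0, b0)" by (cases z0) auto
  have z_eq: "z j = (t j, a j, b j)" for j by (simp add: t_def a_def b_def)
  have t: "t \<longlonglongrightarrow> t0" using tendsto_fst[OF z] by (simp add: t_def[abs_def] z0)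
  have "a \<longlonglongrightarrow> a0" using tendsto_fst[OF tendsto_snd[OF z]] by (simp add: a_def[abs_def] z0)
  then have a: "(\<lambda>j. a j k) \<longlonglongrightarrow> a0 k" for k
    using continuous_on_tendsto_compose[OF continuous_on_product_coordinates, of a a0] by auto
  have "b \<longlonglongrightarrow> b0" using tendsto_snd[OF tendsto_snd[OF z]] by (simp add: b_def[abs_def] z0)
  then have b: "(\<lambda>j. b j k) \<longlonglongrightarrow> b0 k" for k
    using continuous_on_tendsto_compose[OF continuous_on_product_coordinates, of b b0] by auto
  note hist = interp_history_in[OF mu]
  have "(\<lambda>j. mild (interp_noise n (a j)) (interp_history \<mu> n (b j)) (max (t j) 0 + s))
      \<longlonglongrightarrow> mild (interp_noise n a0) (interp_history \<mu> n b0) (max t0 0 + s)"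
  proof (rule solution_converges[OF interp_noise_continuous hist mild_solution interp_noise_continuous hist mild_solution])
    fix T e :: real assume e: "e > 0"
    have "(\<lambda>j. \<Sum>k\<le>n * n. norm (((a j)(0 := 0)) k - (a0(0 := 0)) k)) \<longlonglongrightarrow> (\<Sum>k\<le>n * n. 0)"
    proof (rule tendsto_sum)
      fix k show "(\<lambda>j. norm (((a j)(0 := 0)) k - (a0(0 := 0)) k)) \<longlonglongrightarrow> 0"
        using a[of k] by (cases "k = 0") (auto intro!: tendsto_norm_zero LIM_zero)
    qed
    then have "\<forall>\<^sub>F j in sequentially. (\<Sum>k\<le>n * n. norm (((a j)(0 := 0)) k - (a0(0 := 0)) k)) < e"
      using e by (intro order_tendstoD(2)) auto
    then show "\<forall>\<^sub>F j in sequentially. \<forall>r\<in>{0..T}. norm (interp_noise n (a j) r - interp_noise n a0 r) \<le> e"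
      unfolding interp_noise_def
      by eventually_elim (auto intro: order_trans[OF hat_interp_diff_le])
  next
    fix e :: real assume e: "e > 0"
    have "(\<lambda>j. \<Sum>k\<le>n. norm (b j k - b0 k)) \<longlonglongrightarrow> (\<Sum>k\<le>n. 0)"
      by (intro tendsto_sum tendsto_norm_zero LIM_zero b)
    then have "\<forall>\<^sub>F j in sequentially. (\<Sum>k\<le>n. norm (b j k - b0 k)) < e"
      using e by (intro order_tendstoD(2)) auto
    then show "\<forall>\<^sub>F j in sequentially. mdist V (interp_history \<mu> n (b j)) (interp_history \<mu> n b0) \<le> e"
    proof eventually_elim
      case (elim j)
      show ?case
        using elim unfolding mdist_delay_space_le[OF less_imp_le[OF mu] hist hist]
        by (auto intro!: order_trans[OF hat_interp_diff_le] simp: interp_history_def dist_norm)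
    qed
  next
    show "(\<lambda>j. max (t j) 0 + s) \<longlonglongrightarrow> max t0 0 + s"
      by (intro tendsto_intros t)
  qed (use s in \<open>auto intro: interp_noise_continuous interp_noise_0 hist\<close>)
  then show "(\<lambda>j. (\<lambda>(t, a, b). mild (interp_noise n a) (interp_history \<mu> n b) (max t 0 + s)) (z j))
      \<longlonglongrightarrow> (\<lambda>(t, a, b). mild (interp_noise n a) (interp_history \<mu> n b) (max t 0 + s)) z0"
    by (simp add: z_eq z0)
qed

text \<open>The evaluated solution is the limit of its versions for interpolated data, each of which is a
  continuous function of \<open>t\<close> and of the values of \<open>w\<close> and \<open>\<xi>\<close> at the nodes.\<close>

lemma solution_eval_measurable:
  assumes s: "s \<in> {-\<mu>..0}"
    and M: "\<And>r. (\<lambda>w. w r) \<in> borel_measurable M" "\<And>w. w \<in> space M \<Longrightarrow> continuous_on {0..} w \<and> w 0 = 0"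
  shows "(\<lambda>(t, w, \<xi>). mild w \<xi> (t + s)) \<in> borel_measurable
    (restrict_space borel {0..} \<Otimes>\<^sub>M (M \<Otimes>\<^sub>M borel_of_topology (mtopology_of V)))"
    (is "_ \<in> borel_measurable ?N")
proof (rule borel_measurable_LIMSEQ_metric)
  \<comment> \<open>The index is cut off at \<open>n\<close> to keep the nodes inside \<open>[-\<mu>, 0]\<close>.\<close>
  let ?a = "\<lambda>n w k. w (real k / real n)" and ?b = "\<lambda>n \<xi> k. \<xi> (- \<mu> + real (min k n) * \<mu> / real n)"
  define f where "f n = (\<lambda>(t, w, \<xi>). mild (interp_noise n (?a n w)) (interp_history \<mu> n (?b n \<xi>)) (max t 0 + s))" for n
  have node: "- \<mu> + real (min k n) * \<mu> / real n \<in> {-\<mu>..0}" for k n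
  proof -
    have "real (min k n) * \<mu> / real n \<le> \<mu>"
      using mu by (cases "n = 0") (auto simp: field_simps)
    then show ?thesis using mu by auto
  qed
  show "f n \<in> borel_measurable ?N" for n
  proof -
    have 1: "fst \<in> borel_measurable ?N"
      by (rule measurable_compose[OF measurable_fst]) (simp add: measurable_restrict_space1)
    have 2: "(\<lambda>x. ?a n (fst (snd x))) \<in> borel_measurable ?N"
      by (rule measurable_coordinatewise_then_product)
        (rule measurable_compose[OF measurable_compose[OF measurable_snd measurable_fst] M(1)])
    have 3: "(\<lambda>x. ?b n (snd (snd x))) \<in> borel_measurable ?N"
      by (rule measurable_coordinatewise_then_product)
        (rule measurable_compose[OF measurable_compose[OF measurable_snd measurable_snd]
            delay_space_eval_measurable[OF less_imp_le[OF mu] node]])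
    have "(\<lambda>x. (fst x, ?a n (fst (snd x)), ?b n (snd (snd x)))) \<in> borel_measurable ?N"
      by (intro borel_measurable_Pair 1 2 3)
    from measurable_compose[OF this borel_measurable_continuous_onI[OF interpolated_solution_continuous[OF s, of n]]]
    show ?thesis by (simp add: f_def case_prod_beta)
  qed
  fix x assume "x \<in> space ?N"
  then obtain t w \<xi> where x: "x = (t, w, \<xi>)" and t: "t \<ge> 0" and w: "w \<in> space M" and \<xi>: "\<xi> \<in> mspace V"
    by (auto simp: space_pair_measure space_restrict_space)
  have wc: "continuous_on {0..} w" "w 0 = 0" using M(2)[OF w] by auto
  note hist = interp_history_in[OF mu]
  have "(\<lambda>n. mild (interp_noise n (?a n w)) (interp_history \<mu> n (?b n \<xi>)) (t + s)) \<longlonglongrightarrow> mild w \<xi> (t + s)"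
  proof (rule solution_converges[OF wc(1) \<xi> mild_solution[OF wc \<xi>] interp_noise_continuous hist mild_solution])
    show "\<forall>\<^sub>F n in sequentially. \<forall>r\<in>{0..T}. norm (interp_noise n (?a n w) r - w r) \<le> e" if "e > 0" for T e
      by (rule interp_noise_converges[OF wc that])
    show "\<forall>\<^sub>F n in sequentially. mdist V (interp_history \<mu> n (?b n \<xi>)) \<xi> \<le> e" if "e > 0" for e
      using interp_history_approx[OF mu \<xi> that]
    proof eventually_elim
      case (elim n)
      show ?case by (rule elim[rule_format]) (use that in auto)
    qed
  qed (use s t in \<open>auto intro: interp_noise_continuous interp_noise_0 hist\<close>)
  then show "(\<lambda>n. f n x) \<longlonglongrightarrow> (\<lambda>(t, w, \<xi>). mild w \<xi> (t + s)) x"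
    using t by (simp add: f_def x)
qed

lemma solution_segment_measurable:
  assumes M: "\<And>r. (\<lambda>w. w r) \<in> borel_measurable M" "\<And>w. w \<in> space M \<Longrightarrow> continuous_on {0..} w \<and> w 0 = 0"
  shows "(\<lambda>(t, w, \<xi>). seg (mild w \<xi>) t) \<in>
    restrict_space borel {0..} \<Otimes>\<^sub>M (M \<Otimes>\<^sub>M borel_of_topology (mtopology_of V))
      \<rightarrow>\<^sub>M borel_of_topology (mtopology_of V)"
proof (rule delay_space_measurableI[OF mu])
  show "(\<lambda>(t, w, \<xi>). seg (mild w \<xi>) t) x \<in> mspace V"
    if "x \<in> space (restrict_space borel {0..} \<Otimes>\<^sub>M (M \<Otimes>\<^sub>M borel_of_topology (mtopology_of V)))" for x
    using that M(2) by (auto simp: space_pair_measure space_restrict_space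
        intro!: seg_in_V sol_continuous[OF mild_solution])
  fix s assume s: "s \<in> {-\<mu>..0}"
  have "(\<lambda>x. (\<lambda>(t, w, \<xi>). seg (mild w \<xi>) t) x s) = (\<lambda>(t, w, \<xi>). mild w \<xi> (t + s))"
    using s by (auto simp: fun_eq_iff segment_apply)
  then show "(\<lambda>x. (\<lambda>(t, w, \<xi>). seg (mild w \<xi>) t) x s) \<in> borel_measurable
      (restrict_space borel {0..} \<Otimes>\<^sub>M (M \<Otimes>\<^sub>M borel_of_topology (mtopology_of V)))"
    using solution_eval_measurable[OF s M] by simp
qed

lemma solution_segment_continuous:
  assumes t: "t \<ge> 0" and w: "continuous_on {0..} w" "w 0 = 0"
  shows "continuous_map (mtopology_of V) (mtopology_of V) (\<lambda>\<xi>. seg (mild w \<xi>) t)"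
proof (rule Lipschitz_continuous_imp_continuous_map)
  obtain C where C: "\<And>\<xi> \<xi>'. \<xi> \<in> mspace V \<Longrightarrow> \<xi>' \<in> mspace V \<Longrightarrow>
    (\<forall>r\<in>{-\<mu>..t}. norm (mild w \<xi> r - mild w \<xi>' r) \<le> C * mdist V \<xi> \<xi>')"
    using solution_lipschitz[OF t w(1)] mild_solution[OF w] by blast
  note cont = sol_continuous[OF mild_solution[OF w]]
  show "Lipschitz_continuous_map V V (\<lambda>\<xi>. seg (mild w \<xi>) t)"
    unfolding Lipschitz_continuous_map_def
  proof (intro conjI exI[of _ C] ballI funcsetI)
    show "seg (mild w \<xi>) t \<in> mspace V" if "\<xi> \<in> mspace V" for \<xi>
      by (rule seg_in_V[OF cont[OF that] t])
    fix \<xi> \<xi>' assume \<xi>: "\<xi> \<in> mspace V" "\<xi>' \<in> mspace V"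
    show "mdist V (seg (mild w \<xi>) t) (seg (mild w \<xi>') t) \<le> C * mdist V \<xi> \<xi>'"
      by (rule mdist_seg_le[OF cont[OF \<xi>(1)] cont[OF \<xi>(2)] t]) (use C[OF \<xi>] in auto)
  qed
qed

end

section \<open>The random dynamical system\<close>

text \<open>A shift by \<open>t\<close> moves \<open>[-k, k]\<close> into \<open>[-n, n]\<close> as soon as \<open>n \<ge> k + |t|\<close>.\<close>

lemma wiener_shift_in_Holder_paths:
  assumes "w \<in> Holder_paths \<beta>"
  shows "wiener_shift t w \<in> Holder_paths \<beta>"
proof -
  have w: "continuous_on UNIV w" using assms by (simp add: Holder_paths_def C0_paths_def)
  have "continuous_on UNIV (\<lambda>r. w (r + t))"
    by (rule continuous_on_compose2[OF w]) (auto intro!: continuous_intros)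
  then have "wiener_shift t w \<in> C0_paths"
    unfolding C0_paths_def wiener_shift_def by (auto intro!: continuous_intros)
  moreover have "\<exists>C. \<forall>s\<in>{-real k..real k}. \<forall>s'\<in>{-real k..real k}.
      norm (wiener_shift t w s' - wiener_shift t w s) \<le> C * \<bar>s' - s\<bar> powr \<beta>" for k
  proof -
    obtain n :: nat where n: "real n \<ge> real k + \<bar>t\<bar>" using real_arch_simple by blast
    obtain C where C: "\<And>s s'. s \<in> {-real n..real n} \<Longrightarrow> s' \<in> {-real n..real n} \<Longrightarrow>
        norm (w s' - w s) \<le> C * \<bar>s' - s\<bar> powr \<beta>"
      using assms unfolding Holder_paths_def by blast
    show ?thesis
    proof (intro exI[of _ C] ballI)
      fix s s' assume "s \<in> {-real k..real k}" "s' \<in> {-real k..real k}"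
      then have "norm (w (s' + t) - w (s + t)) \<le> C * \<bar>(s' + t) - (s + t)\<bar> powr \<beta>"
        using n by (intro C) auto
      then show "norm (wiener_shift t w s' - wiener_shift t w s) \<le> C * \<bar>s' - s\<bar> powr \<beta>"
        by (simp add: wiener_shift_def)
    qed
  qed
  ultimately show ?thesis unfolding Holder_paths_def by blast
qed

lemma Holder_path_continuous:
  assumes "w \<in> Holder_paths \<beta>" shows "continuous_on {0..} w" "w 0 = 0"
  using assms by (auto simp: Holder_paths_def C0_paths_def intro: continuous_on_subset)

theorem theorem2p5:
  fixes D :: "'h::{real_inner, banach, second_countable_topology} set"
    and A :: "'h \<Rightarrow> 'h"
    and S :: "real \<Rightarrow> 'h \<Rightarrow>\<^sub>L 'h"
    and Q :: "'u::{real_inner, banach, second_countable_topology} \<Rightarrow>\<^sub>L 'u"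
    and W :: "(real \<Rightarrow> 'u) measure"
    and F :: "(real \<Rightarrow> 'h) \<Rightarrow> 'h"
    and G K :: "(real \<Rightarrow> 'h) \<Rightarrow> 'u \<Rightarrow>\<^sub>L 'h"
    and \<mu> \<beta> \<nu> l L :: real
  defines "\<Omega> \<equiv> Holder_paths \<beta> :: (real \<Rightarrow> 'u) set"
    and "V \<equiv> delay_space \<mu> :: (real \<Rightarrow> 'h) metric"
    and "\<phi> \<equiv> solution_cocycle \<mu> A S F G K"
  assumes mu: "\<mu> > 0"
    and A_self_adjoint: "self_adjoint_on D A"
    and A_positive: "strictly_positive_on D (\<lambda>x. - A x)"
    and A_compact: "has_compact_inverse D (\<lambda>x. - A x)"
    and A_generates: "generates D A S"
    and S_analytic: "analytic_semigroup S"
    and l: "l > 0"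
    and S_estimates: "semigroup_estimates S l"
    and Q: "trace_class_covariance Q"
    and W: "wiener_measure Q W"
    and beta: "0 < \<beta>" "\<beta> < 1 / 2"
    and F: "Lipschitz_continuous_map V euclidean_metric F"
    and nu: "0 < \<nu>" "\<nu> < 1"
    and G_range: "\<And>x. x \<in> mspace V \<Longrightarrow> G x \<in> L_frac_dom S \<nu>"
    and G_Lipschitz: "\<And>x y. x \<in> mspace V \<Longrightarrow> y \<in> mspace V \<Longrightarrow>
          L_frac_norm S \<nu> (G x - G y) \<le> L * mdist V x y"
    and K: "Lipschitz_continuous_map V euclidean_metric K"
    and G_C1: "\<And>T u. T > 0 \<Longrightarrow> continuous_on {-\<mu>..T} u \<Longrightarrow>
          (\<forall>t\<in>{0..T}. ((\<lambda>t. G (segment \<mu> u t)) has_vector_derivative K (segment \<mu> u t))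
             (at t within {0..T})) \<and>
          continuous_on {0..T} (\<lambda>t. K (segment \<mu> u t))"
  shows "(\<forall>w\<in>\<Omega>. \<forall>\<xi>\<in>mspace V. \<exists>!u. global_mild_solution \<mu> A S F G K w \<xi> u) \<and>
    (\<forall>t\<ge>0. \<forall>w\<in>\<Omega>. \<forall>\<xi>\<in>mspace V. \<forall>s\<in>{-\<mu>..0}.
       (t + s \<ge> 0 \<longrightarrow>
          \<phi> t w \<xi> s = mild_rhs \<mu> A S F G K w \<xi> (the_mild_solution \<mu> A S F G K w \<xi>) (t + s)) \<and>
       (t + s \<le> 0 \<longrightarrow> \<phi> t w \<xi> s = \<xi> (t + s))) \<and>
    random_dynamical_system (noise_space \<beta> W) wiener_shift V \<phi> \<and>
    (\<forall>t\<ge>0. \<forall>w\<in>\<Omega>. continuous_map (mtopology_of V) (mtopology_of V) (\<phi> t w))"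
proof -
  interpret semigroup: selfadjoint_semigroup D A S l
    using A_self_adjoint A_positive A_generates S_analytic l S_estimates
    by unfold_locales
  let ?dS = semigroup.dS
  \<comment> \<open>The constants of \<open>norm_dS_frac_le\<close> and \<open>norm_le_frac_power\<close>.\<close>
  define c0 where "c0 = 2 / (1 - 2 powr (\<nu> - 1))"
  have c0: "c0 \<ge> 0"
    using nu powr_less_mono[of "\<nu> - 1" 0 2] by (simp add: c0_def)
  define e0 where "e0 = 1 - exp (- l)"
  have e0: "e0 > 0" using l by (simp add: e0_def)
  obtain cF where cF: "cF > 0" "\<And>x y. x \<in> mspace V \<Longrightarrow> y \<in> mspace V \<Longrightarrow> norm (F x - F y) \<le> cF * mdist V x y"
    using F unfolding Lipschitz_continuous_map_pos by (auto simp: dist_norm)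
  obtain cK where cK: "cK > 0" "\<And>x y. x \<in> mspace V \<Longrightarrow> y \<in> mspace V \<Longrightarrow> norm (K x - K y) \<le> cK * mdist V x y"
    using K unfolding Lipschitz_continuous_map_pos by (auto simp: dist_norm)
  define c where "c = cF + cK + \<bar>L\<bar> / e0 + c0 * \<bar>L\<bar>"
  have c: "c \<ge> 0" "cF \<le> c" "cK \<le> c" "\<bar>L\<bar> / e0 \<le> c" "c0 * \<bar>L\<bar> \<le> c"
    using cF(1) cK(1) c0 e0 by (auto simp: c_def)
  have lip_mono: "x \<le> c * mdist V y z" if "x \<le> c' * mdist V y z" "c' \<le> c" for x c' y z
    using that mult_right_mono[OF that(2), of "mdist V y z"] by simp
  have G_diff: "G x - G y \<in> L_frac_dom S \<nu>" if "x \<in> mspace V" "y \<in> mspace V" for x y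
    using semigroup.L_frac_dom_diff[OF nu(1)] G_range that by blast
  have frac_in: "T v \<in> frac_dom S \<nu>" if "T \<in> L_frac_dom S \<nu>" for T :: "'u \<Rightarrow>\<^sub>L 'h" and v
    using that by (simp add: L_frac_dom_def)
  \<comment> \<open>The assumed constant \<open>L\<close> may be negative; its absolute value serves as a Lipschitz constant.\<close>
  have G_frac: "norm (frac_power S \<nu> ((G x - G y) v)) \<le> \<bar>L\<bar> * mdist V x y * norm v"
    if "x \<in> mspace V" "y \<in> mspace V" for x y v
  proof -
    have "norm (frac_power S \<nu> ((G x - G y) v)) \<le> L_frac_norm S \<nu> (G x - G y) * norm v"
      by (rule semigroup.norm_frac_power_le[OF G_diff[OF that]])
    also have "\<dots> \<le> (L * mdist V x y) * norm v"
      using G_Lipschitz[OF that] by (rule mult_right_mono) simp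
    also have "\<dots> \<le> \<bar>L\<bar> * mdist V x y * norm v"
      by (intro mult_right_mono) auto
    finally show ?thesis .
  qed
  interpret delay_equation \<mu> \<nu> c A S ?dS F G K
  proof
    show "norm (F x - F y) \<le> c * mdist (delay_space \<mu>) x y"
      "norm (K x - K y) \<le> c * mdist (delay_space \<mu>) x y"
      if "x \<in> mspace (delay_space \<mu>)" "y \<in> mspace (delay_space \<mu>)" for x y
      using cF(2) cK(2) lip_mono c that unfolding V_def by blast+
    show "norm (G x - G y) \<le> c * mdist (delay_space \<mu>) x y"
      if "x \<in> mspace (delay_space \<mu>)" "y \<in> mspace (delay_space \<mu>)" for x y
    proof -
      have xy: "x \<in> mspace V" "y \<in> mspace V" using that by (auto simp: V_def)
      have "norm (G x - G y) \<le> \<bar>L\<bar> * mdist V x y / e0"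
      proof (rule norm_blinfun_bound)
        show "0 \<le> \<bar>L\<bar> * mdist V x y / e0" using e0 by simp
        fix v
        have "norm ((G x - G y) v) \<le> norm (frac_power S \<nu> ((G x - G y) v)) / e0"
          unfolding e0_def using nu frac_in[OF G_diff[OF xy]]
          by (intro semigroup.norm_le_frac_power) auto
        also have "\<dots> \<le> \<bar>L\<bar> * mdist V x y * norm v / e0"
          using G_frac[OF xy] e0 by (intro divide_right_mono) auto
        finally show "norm ((G x - G y) v) \<le> \<bar>L\<bar> * mdist V x y / e0 * norm v" by simp
      qed
      then show ?thesis using lip_mono[of _ "\<bar>L\<bar> / e0"] c(4) by (simp add: V_def)
    qed
    have dS_bound: "norm (?dS t x) \<le> c0 * t powr (\<nu> - 1) * norm (frac_power S \<nu> x)"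
      if "t > 0" "x \<in> frac_dom S \<nu>" for t x
      unfolding c0_def by (rule semigroup.norm_dS_frac_le[OF nu that])
    show "norm (?dS t ((G x - G y) v)) \<le> c * t powr (\<nu> - 1) * mdist (delay_space \<mu>) x y * norm v"
      if "x \<in> mspace (delay_space \<mu>)" "y \<in> mspace (delay_space \<mu>)" "t > 0" for x y t v
    proof -
      have xy: "x \<in> mspace V" "y \<in> mspace V" using that by (auto simp: V_def)
      have "norm (?dS t ((G x - G y) v)) \<le> c0 * t powr (\<nu> - 1) * norm (frac_power S \<nu> ((G x - G y) v))"
        using that(3) frac_in[OF G_diff[OF xy]] by (rule dS_bound)
      also have "\<dots> \<le> c0 * t powr (\<nu> - 1) * (\<bar>L\<bar> * mdist V x y * norm v)"
        using c0 G_frac[OF xy] by (intro mult_left_mono) auto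
      also have "\<dots> = (c0 * \<bar>L\<bar>) * (t powr (\<nu> - 1) * mdist V x y * norm v)" by simp
      also have "\<dots> \<le> c * (t powr (\<nu> - 1) * mdist V x y * norm v)"
        using c(5) by (intro mult_right_mono) auto
      finally show ?thesis by (simp add: V_def mult.assoc)
    qed
    show "\<exists>M. \<forall>t>0. \<forall>v. norm (?dS t (G x v)) \<le> M * t powr (\<nu> - 1) * norm v"
      if "x \<in> mspace (delay_space \<mu>)" for x
    proof -
      have Gx: "G x \<in> L_frac_dom S \<nu>" using G_range that by (simp add: V_def)
      have "norm (?dS t (G x v)) \<le> (c0 * L_frac_norm S \<nu> (G x)) * t powr (\<nu> - 1) * norm v" if "t > 0" for t v
      proof -
        have "norm (?dS t (G x v)) \<le> c0 * t powr (\<nu> - 1) * norm (frac_power S \<nu> (G x v))"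
          using that frac_in[OF Gx] by (rule dS_bound)
        also have "\<dots> \<le> c0 * t powr (\<nu> - 1) * (L_frac_norm S \<nu> (G x) * norm v)"
          using c0 semigroup.norm_frac_power_le[OF Gx] by (intro mult_left_mono) auto
        finally show ?thesis by (simp add: mult_ac)
      qed
      then show ?thesis by blast
    qed
  qed (use mu nu c(1) semigroup.S_0 semigroup.S_add_apply semigroup.norm_S_le_1
      semigroup.S_strongly_continuous semigroup.S_has_derivative semigroup.dS_continuous
      semigroup.A_S semigroup.dS_add G_C1 in \<open>auto\<close>)
  have \<phi>: "\<phi> t w \<xi> = segment \<mu> (mild w \<xi>) t" for t w \<xi>
    by (simp add: \<phi>_def solution_cocycle_def)
  have \<Omega>: "continuous_on {0..} w" "w 0 = 0" if "w \<in> \<Omega>" for w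
    using Holder_path_continuous that by (auto simp: \<Omega>_def)
  have space: "space (noise_space \<beta> W) = \<Omega>"
    using W by (auto simp: noise_space_def space_restrict_space wiener_measure_def \<Omega>_def Holder_paths_def)
  have eval: "(\<lambda>w. w r) \<in> borel_measurable (noise_space \<beta> W)" for r
  proof -
    have "sets W = sets (borel_of_topology C0_compact_open)"
      using W by (simp add: wiener_measure_def)
    then have "(\<lambda>w. w r) \<in> borel_measurable W"
      using C0_eval_measurable measurable_cong_sets by blast
    then show ?thesis unfolding noise_space_def by (rule measurable_restrict_space1)
  qed
  note solves = mild_solution[folded V_def]
  have unique: "\<exists>!u. global_mild_solution \<mu> A S F G K w \<xi> u" if "w \<in> \<Omega>" "\<xi> \<in> mspace V" for w \<xi>
    using solves[OF \<Omega>[OF that(1)] that(2)] solution_unique[OF \<Omega>(1)[OF that(1)]] that(2)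
    unfolding V_def by blast
  have formula: "(t + s \<ge> 0 \<longrightarrow> \<phi> t w \<xi> s = mild_rhs \<mu> A S F G K w \<xi> (mild w \<xi>) (t + s)) \<and>
      (t + s \<le> 0 \<longrightarrow> \<phi> t w \<xi> s = \<xi> (t + s))"
    if "t \<ge> 0" "w \<in> \<Omega>" "\<xi> \<in> mspace V" "s \<in> {-\<mu>..0}" for t w \<xi> s
    using sol_rhs[OF solves[OF \<Omega>[OF that(2)] that(3)], of "t + s"]
      sol_init[OF solves[OF \<Omega>[OF that(2)] that(3)], of "t + s"] that
    by (simp add: \<phi> segment_apply)
  have cocycle: "\<phi> (t + \<tau>) w \<xi> = \<phi> t (wiener_shift \<tau> w) (\<phi> \<tau> w \<xi>)"
    if t: "t \<ge> 0" "\<tau> \<ge> 0" and w: "w \<in> \<Omega>" and \<xi>: "\<xi> \<in> mspace V" for t \<tau> w \<xi>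
  proof -
    note sol = solves[OF \<Omega>[OF w] \<xi>]
    have "wiener_shift \<tau> w \<in> \<Omega>"
      using w wiener_shift_in_Holder_paths by (simp add: \<Omega>_def)
    then have "mild (wiener_shift \<tau> w) (segment \<mu> (mild w \<xi>) \<tau>) = restrict (\<lambda>s. mild w \<xi> (s + \<tau>)) {-\<mu>..}"
      using \<Omega>[OF w] t by (intro mild_eqI \<Omega> w solution_shift[OF _ _ sol] seg_in_V sol_continuous[OF sol])
    then show ?thesis
      using t(1) by (auto simp: \<phi> segment_def restrict_def fun_eq_iff add_ac)
  qed
  have "random_dynamical_system (noise_space \<beta> W) wiener_shift V \<phi>"
    unfolding random_dynamical_system_def space
  proof (intro conjI allI ballI impI)
    show "wiener_shift t w \<in> \<Omega>" if "w \<in> \<Omega>" for t w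
      using that wiener_shift_in_Holder_paths by (simp add: \<Omega>_def)
    show "(\<lambda>(t, w, v). \<phi> t w v)
       \<in> (restrict_space borel {0..} \<Otimes>\<^sub>M (noise_space \<beta> W \<Otimes>\<^sub>M borel_of_topology (mtopology_of V)))
           \<rightarrow>\<^sub>M borel_of_topology (mtopology_of V)"
      unfolding \<phi> V_def by (rule solution_segment_measurable[OF eval]) (use \<Omega> in \<open>simp add: space\<close>)
    show "\<phi> 0 w \<xi> = \<xi>" if "w \<in> \<Omega>" "\<xi> \<in> mspace V" for w \<xi>
      unfolding \<phi> using sol_seg_0[OF solves[OF \<Omega>[OF that(1)] that(2)]] that(2) by (simp add: V_def)
  qed (use cocycle in auto)
  moreover have "continuous_map (mtopology_of V) (mtopology_of V) (\<phi> t w)" if "t \<ge> 0" "w \<in> \<Omega>" for t w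
    unfolding \<phi>[abs_def] V_def by (rule solution_segment_continuous[OF that(1) \<Omega>[OF that(2)]])
  ultimately show ?thesis
    using unique formula by blast
qed

end
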